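(* Let $\mathcal{D}=\{W\subseteq\mathbb{P} : R_W \text{ admits a diophantine model of } \mathbb{Z}\}$. One (and only one) of the following two possibilities holds. (1) The class $\mathcal{D}$ is meager in $2^{\mathbb{P}}$. (2) There exist a particular triple $(h,h_+,h_\times)$ of polynomials over $\mathbb{Z}$ and a finite binary string $\sigma\in 2^{<\mathbb{P}}$ such that, for every HTP-generic $V\in\mathcal{U}_\sigma$, $R_V$ admits a diophantine model of $\mathbb{Z}$ via these three polynomials. Moreover, if (2) holds, then $\mathbb{P}\in\mathcal{D}$ (i.e., $\mathbb{Q}$ admits a diophantine model of $\mathbb{Z}$).
   Context: $\mathbb{P}$ is the set of all prime numbers. For $W\subseteq\mathbb{P}$, $R_W=\mathbb{Z}[\frac1p : p\in W]$ is the corresponding subring of $\mathbb{Q}$ (so $R_{\mathbb{P}}=\mathbb{Q}$). For a subring $R\subseteq\mathbb{Q}$, $\mathrm{HTP}(R)$ denotes the set of polynomials (each in finitely many variables, with coefficients in $\mathbb{Z}$ or, equivalently after clearing denominators, in $R$) that have a zero with all coordinates in $R$. Diophantine model: in a ring $R$, a diophantine model of $\mathbb{Z}$ consists of three polynomials $h$, $h_+$, $h_\times$ with $h\in R[X_1,\ldots,X_n,\vec{Y}]$ and $h_+,h_\times\in R[X_1,\ldots,X_{3n},\vec{Y}]$ (for some $n$, with $\vec Y$ a finite tuple of variables), such that the set $$\{\vec{x}\in R^n : h(\vec{x},\vec{Y})\in\mathrm{HTP}(R)\}$$ (that is, the set of $\vec x\in R^n$ such that $h(\vec x,\vec y)=0$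 for some finite tuple $\vec y$ from $R$) is isomorphic to the structure $(\mathbb{Z},+,\cdot)$ under the binary operations whose graphs are $$\{(\vec{x}_1,\vec{x}_2,\vec{x}_3)\in R^{3n} : h_+(\vec{x}_1,\vec{x}_2,\vec{x}_3,\vec{Y})\in\mathrm{HTP}(R)\}$$ for addition, and the corresponding set with $h_\times$ in place of $h_+$ for multiplication. In this case $R$ is said to admit a diophantine model of $\mathbb{Z}$ via $(h,h_+,h_\times)$. Topology: the power set $2^{\mathbb{P}}$ of $\mathbb{P}$ carries the Cantor-space (product) topology, identifying $W\subseteq\mathbb{P}$ with its characteristic function $\mathbb{P}\to\{0,1\}$. $2^{<\mathbb{P}}$ is the set of functions $\sigma$ from finite initial segments of $\mathbb{P}$ (in increasing order) to $\{0,1\}$, and $\mathcal{U}_\sigma=\{W\subseteq\mathbb{P} : \sigma\subset W\}$ is the basic open set of those $W$ whose characteristic function extends $\sigma$. A set is nowhere dense if its closure contains no nonempty open set, and meager if it is a countable union of nowhere dense sets. HTP-generic: for $f\in\mathbb{Z}[X_0,X_1,\ldots]$ let $\mathcal{A}(f)=\{W\subseteq\mathbb{P} : f\in\mathrm{HTP}(R_W)\}$ (an open set), and let $\mathcal{B}(f)=2^{\mathbb{P}}-\mathcal{A}(f)-\mathrm{Int}(2^{\mathbb{P}}-\mathcal{A}(f))$ be its topological boundary. A set $W\subseteq\mathbb{P}$ is HTP-generic if $W\notin\mathcal{B}(f)$ for every $f\in\mathbb{Z}[X_0,X_1,\ldots]$. *)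

theory Defs
  imports
    "HOL-Analysis.Analysis"
    "HOL-Library.Poly_Mapping"
    "HOL-Computational_Algebra.Primes"
begin

section \<open>Polynomials in countably many variables\<close>

text \<open>
  An element of \<open>\<rat>[X\<^sub>0, X\<^sub>1, \<dots>]\<close> is a finitely supported map from monomials (finitely supported
  exponent functions) to coefficients.  For a subring \<open>R\<close> of \<open>\<rat>\<close>, the elements of
  \<open>R[X\<^sub>0, X\<^sub>1, \<dots>]\<close> are those whose coefficients all lie in \<open>R\<close>; thus \<open>polys_over \<int>\<close>
  is \<open>\<int>[X\<^sub>0, X\<^sub>1, \<dots>]\<close>.
\<close>

type_synonym rpoly = "(nat \<Rightarrow>\<^sub>0 nat) \<Rightarrow>\<^sub>0 rat"

definition polys_over :: "rat set \<Rightarrow> rpoly set" where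
  "polys_over R = {f. \<forall>m. Poly_Mapping.lookup f m \<in> R}"

definition eval_rpoly :: "(nat \<Rightarrow> rat) \<Rightarrow> rpoly \<Rightarrow> rat" where
  "eval_rpoly v f = (\<Sum>m\<in>Poly_Mapping.keys f.
     Poly_Mapping.lookup f m * (\<Prod>i\<in>Poly_Mapping.keys m. v i ^ Poly_Mapping.lookup m i))"

text \<open>
  A zero is given by values for all variables; only the finitely many variables that occur in the
  polynomial matter.
\<close>

definition HTP :: "rat set \<Rightarrow> rpoly set" where
  "HTP R = {f \<in> polys_over R. \<exists>v. (\<forall>i. v i \<in> R) \<and> eval_rpoly v f = 0}"


section \<open>The subrings of the rationals\<close>

abbreviation Primes :: "nat set" where
  "Primes \<equiv> {p. prime p}"

text \<open>\<open>RW W\<close> is the subring of \<open>\<rat>\<close> generated by the inverses of the elements of \<open>W\<close>.\<close>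

inductive_set RW :: "nat set \<Rightarrow> rat set" for W :: "nat set" where
  one: "1 \<in> RW W"
| inverse: "p \<in> W \<Longrightarrow> 1 / of_nat p \<in> RW W"
| uminus: "x \<in> RW W \<Longrightarrow> - x \<in> RW W"
| add: "x \<in> RW W \<Longrightarrow> y \<in> RW W \<Longrightarrow> x + y \<in> RW W"
| mult: "x \<in> RW W \<Longrightarrow> y \<in> RW W \<Longrightarrow> x * y \<in> RW W"


section \<open>Diophantine models of the integers\<close>

definition tuples :: "rat set \<Rightarrow> nat \<Rightarrow> rat list set" where
  "tuples R k = {xs. length xs = k \<and> set xs \<subseteq> R}"

text \<open>
  \<open>dioph_holds R h xs\<close> says that \<open>h(xs, Y)\<close> lies in \<open>HTP(R)\<close>: with the first \<open>length xs\<close> variables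
  set to \<open>xs\<close>, the polynomial has a zero in \<open>R\<close> in its remaining variables, the parameters \<open>Y\<close>.
\<close>

definition append_vals :: "rat list \<Rightarrow> (nat \<Rightarrow> rat) \<Rightarrow> nat \<Rightarrow> rat" where
  "append_vals xs y i = (if i < length xs then xs ! i else y (i - length xs))"

definition dioph_holds :: "rat set \<Rightarrow> rpoly \<Rightarrow> rat list \<Rightarrow> bool" where
  "dioph_holds R h xs \<longleftrightarrow> (\<exists>y. (\<forall>i. y i \<in> R) \<and> eval_rpoly (append_vals xs y) h = 0)"

definition dioph_set :: "rat set \<Rightarrow> nat \<Rightarrow> rpoly \<Rightarrow> rat list set" where
  "dioph_set R n h = {xs \<in> tuples R n. dioph_holds R h xs}"

definition dioph_graph :: "rat set \<Rightarrow> nat \<Rightarrow> rpoly \<Rightarrow> (rat list \<times> rat list \<times> rat list) set" where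
  "dioph_graph R n g = {(xs, ys, zs). xs \<in> tuples R n \<and> ys \<in> tuples R n \<and> zs \<in> tuples R n
     \<and> dioph_holds R g (xs @ ys @ zs)}"

text \<open>
  The number \<open>n\<close> belongs to the data of a triple: it says which of the variables of \<open>h\<close>,
  \<open>hadd\<close>, \<open>hmul\<close> are the \<open>X\<close>'s and which are the \<open>Y\<close>'s.  The isomorphism \<open>\<phi>\<close> goes from \<open>\<int>\<close> to
  the model; the two equations say that the sets defined by \<open>hadd\<close> and \<open>hmul\<close> are exactly the
  graphs of the operations on the model that \<open>\<phi>\<close> transports from \<open>\<int>\<close> (in particular they contain
  only triples of elements of the model).
\<close>

definition dioph_model_via :: "rat set \<Rightarrow> nat \<Rightarrow> rpoly \<Rightarrow> rpoly \<Rightarrow> rpoly \<Rightarrow> bool" where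
  "dioph_model_via R n h hadd hmul \<longleftrightarrow>
     h \<in> polys_over R \<and> hadd \<in> polys_over R \<and> hmul \<in> polys_over R \<and>
     (\<exists>\<phi> :: int \<Rightarrow> rat list.
        bij_betw \<phi> UNIV (dioph_set R n h) \<and>
        dioph_graph R n hadd = {(\<phi> a, \<phi> b, \<phi> (a + b)) | a b. True} \<and>
        dioph_graph R n hmul = {(\<phi> a, \<phi> b, \<phi> (a * b)) | a b. True})"

definition admits_dioph_model :: "rat set \<Rightarrow> bool" where
  "admits_dioph_model R \<longleftrightarrow> (\<exists>n h hadd hmul. dioph_model_via R n h hadd hmul)"

definition \<D> :: "nat set set" where
  "\<D> = {W. W \<subseteq> Primes \<and> admits_dioph_model (RW W)}"


section \<open>The Cantor space of sets of primes\<close>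

text \<open>
  The product topology on \<open>{0,1}\<^sup>\<P>\<close>, where \<open>\<P>\<close> is the set of primes, transported to the power set
  of \<open>\<P>\<close> along characteristic functions.  Functions on \<open>\<P>\<close> are extensional functions, as in
  \<open>product_topology\<close>.
\<close>

definition cantor_primes :: "nat set topology" where
  "cantor_primes = pullback_topology (Pow Primes) (\<lambda>W. restrict (\<lambda>p. p \<in> W) Primes)
     (product_topology (\<lambda>_. discrete_topology (UNIV :: bool set)) Primes)"

definition nowhere_dense_in :: "'a topology \<Rightarrow> 'a set \<Rightarrow> bool" where
  "nowhere_dense_in X S \<longleftrightarrow>
     S \<subseteq> topspace X \<and> (\<forall>U. openin X U \<and> U \<subseteq> X closure_of S \<longrightarrow> U = {})"

definition meager_in :: "'a topology \<Rightarrow> 'a set \<Rightarrow> bool" where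
  "meager_in X S \<longleftrightarrow>
     (\<exists>N :: nat \<Rightarrow> 'a set. (\<forall>i. nowhere_dense_in X (N i)) \<and> S = (\<Union>i. N i))"

text \<open>
  A finite binary string is a partial function whose domain is a finite initial segment of the
  primes; \<open>\<U> \<sigma>\<close> consists of the sets whose characteristic function extends \<open>\<sigma>\<close>.
\<close>

definition binary_strings :: "(nat \<rightharpoonup> bool) set" where
  "binary_strings = {\<sigma>. \<exists>N. dom \<sigma> = {p \<in> Primes. p < N}}"

definition char_map :: "nat set \<Rightarrow> (nat \<rightharpoonup> bool)" where
  "char_map W = (\<lambda>p. if prime p then Some (p \<in> W) else None)"

definition \<U> :: "(nat \<rightharpoonup> bool) \<Rightarrow> nat set set" where
  "\<U> \<sigma> = {W. W \<subseteq> Primes \<and> \<sigma> \<subseteq>\<^sub>m char_map W}"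


section \<open>HTP-generic sets\<close>

definition \<A> :: "rpoly \<Rightarrow> nat set set" where
  "\<A> f = {W. W \<subseteq> Primes \<and> f \<in> HTP (RW W)}"

definition \<B> :: "rpoly \<Rightarrow> nat set set" where
  "\<B> f = Pow Primes - \<A> f - cantor_primes interior_of (Pow Primes - \<A> f)"

definition HTP_generic :: "nat set \<Rightarrow> bool" where
  "HTP_generic W \<longleftrightarrow> W \<subseteq> Primes \<and> (\<forall>f \<in> polys_over \<int>. W \<notin> \<B> f)"

end

theory Submission
  imports Defs
    "HOL-Number_Theory.Number_Theory"
    "HOL-Computational_Algebra.Squarefree"
begin

text \<open>
  Why the theorem holds.  For a tuple of rational numbers, lying in a diophantine set over the subring
  of \<open>W\<close> is a positive fact: it is witnessed by finitely many inverted primes, so it persists to larger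
  sets \<open>W\<close> and holds throughout a neighbourhood of \<open>W\<close>.

  If \<open>\<D>\<close> is not meager, one of the countably many integer triples defines models for a dense subset
  of some cylinder (\<open>nonmeager_dense_triple\<close>).  Two sets in a cylinder have their union there, and near
  the union there is a model in which the positive facts of both can be compared.  Since the ring of
  integers is rigid, all the models of the triple in the cylinder have one and the same isomorphism
  from the integers (\<open>models_coincide\<close>).  The truth values of the positive facts are therefore constant
  on a dense set, and a generic set must have the same ones (\<open>generic_model\<close>).  Conversely the
  boundaries \<open>\<B> f\<close> are nowhere dense, so by Baire's theorem a meager class cannot contain all the
  generic sets of a cylinder (\<open>generic_in_cylinder_not_meager\<close>).

  For the rational field, cofinite sets are generic (\<open>cofinite_generic\<close>), so in the second case a
  semilocal ring, in which the primes of a finite set \<open>S\<close> are not inverted, has a model.  This is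
  transferred to the rational field by a diophantine definition of integrality at \<open>p\<close>, in the
  spirit of Julia Robinson.  For a suitable prime \<open>d\<close>, the equation
  \<open>u^2 - d v^2 + d p w^2 = 1 + p (d x)^2\<close> is solvable in rational numbers \<open>u, v, w\<close> if neither
  \<open>p\<close> nor \<open>d\<close> divides the denominator of \<open>x\<close> (\<open>anisotropic_form_represents\<close>), and, because the form
  is anisotropic at \<open>p\<close>, if \<open>x\<close> is a square then its solvability prevents \<open>p\<close> from
  dividing the denominator (\<open>anisotropic_form_integral\<close>).  The gap between the two conditions, the
  prime \<open>d\<close>, does no harm: removing it from the set of inverted primes yields another generic set,
  which carries the same model (\<open>Primes_in_D\<close>).

  Solvability is a local-global principle for a quaternary form.  It is reduced to two ternary
  forms with a common represented prime \<open>l\<close>; these are treated by Legendre's theorem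
  (\<open>legendre_form_zero\<close>, by the pigeonhole principle).  The prime \<open>l\<close> has to have prescribed Legendre
  symbols, and it exists by Dirichlet's argument for real characters
  (\<open>prime_with_real_characters\<close>), based on \<open>L1_nonzero\<close> and a Mertens estimate.
\<close>

section \<open>Real characters and summation by parts\<close>

text \<open>
  The real Dirichlet characters modulo \<open>m\<close>, extended by zero to the numbers that are not coprime
  to \<open>m\<close>.  They are real valued so that they can be used directly in estimates.
\<close>

definition real_char :: "nat \<Rightarrow> (nat \<Rightarrow> real) \<Rightarrow> bool" where
  "real_char m \<psi> \<longleftrightarrow> (\<forall>a b. \<psi> (a * b) = \<psi> a * \<psi> b) \<and> (\<forall>a. \<psi> (a mod m) = \<psi> a) \<and>
     (\<forall>a. \<psi> a \<in> {-1, 0, 1}) \<and> (\<forall>a. \<psi> a \<noteq> 0 \<longleftrightarrow> coprime a m)"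

lemma real_charD:
  assumes "real_char m \<psi>"
  shows "\<psi> (a * b) = \<psi> a * \<psi> b" "\<psi> (a mod m) = \<psi> a" "\<psi> a \<in> {-1, 0, 1}"
    "\<psi> a \<noteq> 0 \<longleftrightarrow> coprime a m" "\<bar>\<psi> a\<bar> \<le> 1" "\<psi> 1 = 1"
proof -
  show *: "\<psi> (a * b) = \<psi> a * \<psi> b" "\<psi> (a mod m) = \<psi> a" "\<psi> a \<in> {-1, 0, 1}"
    "\<psi> a \<noteq> 0 \<longleftrightarrow> coprime a m" for a b
    using assms unfolding real_char_def by blast+
  show "\<bar>\<psi> a\<bar> \<le> 1" using *(3)[of a] by auto
  have "\<psi> 1 \<noteq> 0" using *(4) coprime_1_left by blast
  moreover have "\<psi> 1 * \<psi> 1 = \<psi> 1" using *(1)[of 1 1] by (simp del: One_nat_def)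
  ultimately show "\<psi> 1 = 1" by (metis mult_cancel_right1)
qed

lemma real_char_power: "real_char m \<psi> \<Longrightarrow> \<psi> (a ^ k) = \<psi> a ^ k"
  by (induction k) (simp_all add: real_charD(1) real_charD(6)[unfolded One_nat_def])

lemma real_char_sum_period:
  assumes "real_char m \<psi>" "m > 0" "\<psi> g = -1"
  shows "(\<Sum>k<m. \<psi> k) = 0"
proof -
  have cop: "coprime g m" using real_charD(4)[OF assms(1), of g] assms(3) by simp
  have inj: "inj_on (\<lambda>k. g * k mod m) {..<m}"
  proof (rule inj_onI)
    fix x y assume "x \<in> {..<m}" "y \<in> {..<m}" "g * x mod m = g * y mod m"
    hence "[g * x = g * y] (mod m)" unfolding Cong.cong_def by blast
    hence "[x = y] (mod m)" using cong_mult_lcancel_nat[OF cop] by blast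
    thus "x = y" using \<open>x \<in> _\<close> \<open>y \<in> _\<close> by (simp add: Cong.cong_def)
  qed
  have bij: "bij_betw (\<lambda>k. g * k mod m) {..<m} {..<m}"
    unfolding bij_betw_def using inj assms(2)
    by (intro conjI endo_inj_surj) auto
  have "(\<Sum>k<m. \<psi> k) = (\<Sum>k<m. \<psi> (g * k mod m))"
    by (rule sum.reindex_bij_betw[OF bij, symmetric])
  also have "\<dots> = - (\<Sum>k<m. \<psi> k)"
    by (simp add: real_charD(1,2)[OF assms(1)] assms(3) sum_negf)
  finally show ?thesis by simp
qed

lemma real_char_sum_bound:
  assumes "real_char m \<psi>" "m > 0" "\<psi> g = -1"
  shows "\<bar>\<Sum>k\<in>{a..<b}. \<psi> k\<bar> \<le> 2 * m"
proof -
  have shift: "(\<Sum>k<n + m. \<psi> k) = (\<Sum>k<n. \<psi> k)" for n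
  proof -
    have "\<psi> (m + k) = \<psi> k" for k
      using real_charD(2)[OF assms(1), of "m + k"] real_charD(2)[OF assms(1), of k] by simp
    moreover have "(\<Sum>k<n + m. \<psi> k) = (\<Sum>k<m. \<psi> k) + (\<Sum>k<n. \<psi> (m + k))"
      by (subst add.commute) (simp add: sum.lessThan_Suc sum_up_index_split
          lessThan_atLeast0 sum.atLeastLessThan_concat[symmetric, of 0 m "m+n"] 
          sum.shift_bounds_nat_ivl[of _ 0 m n, simplified, symmetric] add.commute)
    ultimately show ?thesis using real_char_sum_period[OF assms] by simp
  qed
  have one: "\<bar>\<Sum>k<n. \<psi> k\<bar> \<le> m" for n
  proof (induction n rule: less_induct)
    case (less n)
    show ?case
    proof (cases "n < m")
      case True
      have "\<bar>\<Sum>k<n. \<psi> k\<bar> \<le> (\<Sum>k<n. 1)"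
        using real_charD(5)[OF assms(1)] by (intro order_trans[OF sum_abs] sum_mono)
      thus ?thesis using True by simp
    next
      case False
      thus ?thesis using less.IH[of "n - m"] shift[of "n - m"] assms(2) by simp
    qed
  qed
  show ?thesis
  proof (cases "a \<le> b")
    case True
    have "(\<Sum>k<b. \<psi> k) = (\<Sum>k<a. \<psi> k) + (\<Sum>k\<in>{a..<b}. \<psi> k)"
      using True by (simp add: lessThan_atLeast0 sum.atLeastLessThan_concat)
    thus ?thesis using one[of a] one[of b] by linarith
  qed auto
qed

text \<open>
  Summation by parts: a sequence with bounded partial sums, weighted by a decreasing sequence, has
  partial sums controlled by the first weight alone.  This gives convergence and all the tail
  estimates for sums over a nonprincipal character below.
\<close>

lemma abel_bound:
  fixes c f :: "nat \<Rightarrow> real"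
  assumes B: "\<And>j. \<bar>\<Sum>k\<in>{a..<j}. c k\<bar> \<le> B"
    and f: "\<And>k. a \<le> k \<Longrightarrow> f (Suc k) \<le> f k" "\<And>k. a \<le> k \<Longrightarrow> 0 \<le> f k"
  shows "\<bar>\<Sum>k\<in>{a..<b}. c k * f k\<bar> \<le> B * f a"
proof (cases "a \<le> b")
  case True
  then obtain n where b: "b = a + n" using le_Suc_ex by blast
  define S where "S j = (\<Sum>k\<in>{a..<a + j}. c k)" for j
  have "(\<Sum>k\<in>{a..<a + n}. c k * f k) =
     S n * f (a + n) + (\<Sum>k<n. S (Suc k) * (f (a + k) - f (a + Suc k)))"
    by (induction n) (simp_all add: S_def algebra_simps)
  also have "\<bar>\<dots>\<bar> \<le> B * f (a + n) + (\<Sum>k<n. B * (f (a + k) - f (a + Suc k)))"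
  proof (intro order_trans[OF abs_triangle_ineq] add_mono order_trans[OF sum_abs] sum_mono)
    show "\<bar>S n * f (a + n)\<bar> \<le> B * f (a + n)"
      using B[of "a + n"] f(2)[of "a + n"] by (simp add: abs_mult S_def mult_right_mono)
    show "\<bar>S (Suc k) * (f (a + k) - f (a + Suc k))\<bar> \<le> B * (f (a + k) - f (a + Suc k))" for k
      using B[of "a + Suc k"] f(1)[of "a + k"] by (simp add: abs_mult S_def mult_right_mono)
  qed
  also have "(\<Sum>k<n. B * (f (a + k) - f (a + Suc k))) = B * (f a - f (a + n))"
    by (induction n) (simp_all add: algebra_simps)
  finally show ?thesis by (simp add: b algebra_simps)
next
  case False
  have "0 \<le> B" using B[of a] by simp
  thus ?thesis using False f(2)[of a] by simp
qed

text \<open>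
  Dirichlet's rearrangement: both sides run over the pairs \<open>(d, j)\<close> with \<open>d j \<le> N\<close>.
\<close>

lemma sum_divisors_swap:
  fixes g :: "nat \<Rightarrow> nat \<Rightarrow> real"
  shows "(\<Sum>n\<in>{1..N}. \<Sum>d | d dvd n. g d (n div d)) = (\<Sum>d\<in>{1..N}. \<Sum>j\<in>{1..N div d}. g d j)"
proof -
  have "(\<Sum>n\<in>{1..N}. \<Sum>d | d dvd n. g d (n div d)) =
      (\<Sum>(n, d)\<in>(SIGMA n:{1..N}. {d. d dvd n}). g d (n div d))"
    by (subst sum.Sigma) (auto simp: case_prod_unfold intro!: finite_divisors_nat)
  also have "\<dots> = (\<Sum>(d, j)\<in>(SIGMA d:{1..N}. {1..N div d}). g d j)"
  proof (rule sum.reindex_bij_witness[where i = "\<lambda>(d, j). (d * j, d)" and j = "\<lambda>(n, d). (d, n div d)"], goal_cases)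
    case (4 a)
    then obtain d j where a: "a = (d, j)" "1 \<le> d" "1 \<le> j" "j \<le> N div d" by auto
    have "d * j \<le> N" using a by (metis dual_order.trans mult_le_mono2 times_div_less_eq_dividend)
    moreover have "1 \<le> d * j" using a by simp
    ultimately show ?case using a by simp
  next
    case (2 a)
    then obtain n d where a: "a = (n, d)" "1 \<le> n" "n \<le> N" "d dvd n" by auto
    then obtain j where j: "n = d * j" by blast
    have "1 \<le> d" "1 \<le> j" using a j by (auto simp: Suc_le_eq)
    moreover have "d \<le> N" using a dvd_imp_le[of d n] by linarith
    moreover have "j \<le> N div d" using a j \<open>1 \<le> d\<close> by (metis div_le_mono nonzero_mult_div_cancel_left not_one_le_zero)
    ultimately show ?case using a j by simp
  qed auto
  also have "\<dots> = (\<Sum>d\<in>{1..N}. \<Sum>j\<in>{1..N div d}. g d j)"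
    by (subst sum.Sigma) auto
  finally show ?thesis .
qed

section \<open>L(1) does not vanish for a real character\<close>

text \<open>
  The value \<open>L(1, \<psi>)\<close> of the Dirichlet series of \<open>\<psi>\<close>.
\<close>

definition L1 :: "(nat \<Rightarrow> real) \<Rightarrow> real" where
  "L1 \<psi> = suminf (\<lambda>n. \<psi> n / n)"

lemma L1_approx:
  assumes "real_char m \<psi>" "m > 0" "\<psi> g = -1"
  shows "\<bar>(\<Sum>j\<in>{1..J}. \<psi> j / j) - L1 \<psi>\<bar> \<le> 2 * m / Suc J"
proof -
  have tail: "\<bar>\<Sum>k\<in>{a..<b}. \<psi> k / k\<bar> \<le> 2 * m / a" if "a > 0" for a b
    using abel_bound[where a = a and b = b and f = "\<lambda>k. 1 / real k", OF real_char_sum_bound[OF assms]] that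
    by (simp add: frac_le)
  have Cau: "Cauchy (\<lambda>N. \<Sum>k<N. \<psi> k / k)"
  proof (rule CauchyI')
    fix e :: real assume e: "e > 0"
    obtain M where M: "2 * m / e < real M" using reals_Archimedean2 by blast
    have M0: "M > 0" using M e by (cases "M = 0") (auto simp: divide_less_0_iff)
    have Me: "2 * real m / real M < e" using M e M0 by (simp add: field_simps)
    have "dist (\<Sum>k<a. \<psi> k / k) (\<Sum>k<b. \<psi> k / k) < e" if "a \<ge> M" "b > a" for a b
    proof -
      have "(\<Sum>k<b. \<psi> k / k) = (\<Sum>k<a. \<psi> k / k) + (\<Sum>k\<in>{a..<b}. \<psi> k / k)"
        using that by (simp add: lessThan_atLeast0 sum.atLeastLessThan_concat)
      moreover have "2 * m / real a \<le> 2 * m / real M" using that M0 by (intro divide_left_mono) auto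
      ultimately show ?thesis using tail[of a b] that M0 Me by (simp add: dist_real_def)
    qed
    thus "\<exists>M. \<forall>a\<ge>M. \<forall>b>a. dist (\<Sum>k<a. \<psi> k / k) (\<Sum>k<b. \<psi> k / k) < e" by blast
  qed
  hence "summable (\<lambda>k. \<psi> k / k)" by (simp add: summable_iff_convergent Cauchy_convergent_iff)
  hence lim: "(\<lambda>N. \<Sum>k<N. \<psi> k / k) \<longlonglongrightarrow> L1 \<psi>"
    unfolding L1_def by (rule summable_LIMSEQ)
  have eq: "(\<Sum>j\<in>{1..J}. \<psi> j / j) = (\<Sum>k<Suc J. \<psi> k / k)"
    by (intro sum.mono_neutral_left) auto
  have "\<bar>(\<Sum>j\<in>{1..J}. \<psi> j / j) - (\<Sum>k<N. \<psi> k / k)\<bar> \<le> 2 * m / Suc J" if "N \<ge> Suc J" for N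
  proof -
    have "(\<Sum>k<N. \<psi> k / k) = (\<Sum>k<Suc J. \<psi> k / k) + (\<Sum>k\<in>{Suc J..<N}. \<psi> k / k)"
      using that by (simp only: lessThan_atLeast0 sum.atLeastLessThan_concat)
    thus ?thesis using tail[of "Suc J" N] eq by linarith
  qed
  moreover have "(\<lambda>N. \<bar>(\<Sum>j\<in>{1..J}. \<psi> j / j) - (\<Sum>k<N. \<psi> k / k)\<bar>) \<longlonglongrightarrow> \<bar>(\<Sum>j\<in>{1..J}. \<psi> j / j) - L1 \<psi>\<bar>"
    by (intro tendsto_intros lim)
  ultimately show ?thesis by (intro LIMSEQ_le_const2) auto
qed

lemma divisors_prime_power_mult:
  fixes q s :: nat
  assumes "prime q" "\<not> q dvd s"
  shows "(\<Sum>d | d dvd q ^ k * s. f d) = (\<Sum>i\<le>k. \<Sum>t | t dvd s. (f (q ^ i * t) :: real))"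
proof -
  have s: "s > 0" using assms by (cases s) auto
  have q: "q > 0" using assms by (simp add: prime_gt_0_nat)
  have "(\<Sum>i\<le>k. \<Sum>t | t dvd s. f (q ^ i * t)) = (\<Sum>(i, t)\<in>{..k} \<times> {t. t dvd s}. f (q ^ i * t))"
    using s by (subst sum.cartesian_product) auto
  also have "\<dots> = sum f ((\<lambda>(i, t). q ^ i * t) ` ({..k} \<times> {t. t dvd s}))"
  proof (subst sum.reindex)
    show "inj_on (\<lambda>(i, t). q ^ i * t) ({..k} \<times> {t. t dvd s})"
    proof (rule inj_onI, clarsimp)
      fix i t j u assume *: "t dvd s" "u dvd s" "q ^ i * t = q ^ j * u"
      hence nd: "\<not> q dvd t" "\<not> q dvd u" using assms(2) dvd_trans by blast+
      have "multiplicity q (q ^ a * v) = a" if "\<not> q dvd v" for a v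
        using that q by (intro multiplicity_eqI) (auto simp: mult.commute[of q])
      hence "multiplicity q (q ^ i * t) = i" "multiplicity q (q ^ j * u) = j"
        using nd by blast+
      hence "i = j" using * by simp
      thus "i = j \<and> t = u" using * q by simp
    qed
  qed (simp add: case_prod_unfold)
  also have "(\<lambda>(i, t). q ^ i * t) ` ({..k} \<times> {t. t dvd s}) = {d. d dvd q ^ k * s}"
  proof (intro equalityI subsetI)
    fix d assume "d \<in> {d. d dvd q ^ k * s}"
    then obtain a t where d: "d = a * t" "a dvd q ^ k" "t dvd s" using division_decomp by blast
    moreover obtain i where "i \<le> k" "a = q ^ i" using d divides_primepow_nat[OF assms(1)] by blast
    ultimately show "d \<in> (\<lambda>(i, t). q ^ i * t) ` ({..k} \<times> {t. t dvd s})" by force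
  qed (auto intro!: mult_dvd_mono le_imp_power_dvd)
  finally show ?thesis by simp
qed

text \<open>
  The divisor sum is multiplicative, and on a prime power it is a geometric sum with ratio -1, 0
  or 1.  Such a sum is never negative, and it is at least 1 if it has an odd number of terms.
\<close>

lemma real_char_divisor_sum:
  assumes "real_char m \<psi>" "n > 0"
  shows "(\<Sum>d | d dvd n. \<psi> d) \<ge> 0" "(\<Sum>d | d dvd n\<^sup>2. \<psi> d) \<ge> 1"
proof -
  have geo: "(\<Sum>i\<le>k. \<psi> q ^ i) \<ge> 0 \<and> (even k \<longrightarrow> (\<Sum>i\<le>k. \<psi> q ^ i) \<ge> 1)" for q k
  proof -
    have "\<psi> q \<in> {-1, 0, 1}" using real_charD(3)[OF assms(1)] .
    then consider "\<psi> q = -1" | "\<psi> q = 0" | "\<psi> q = 1" by blast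
    thus ?thesis
    proof cases
      case 1
      have "(\<Sum>i\<le>k. (-1 :: real) ^ i) = (if even k then 1 else 0)" by (induction k) auto
      thus ?thesis using 1 by simp
    next
      case 2
      have "(\<Sum>i\<le>k. (0 :: real) ^ i) = 1" by (induction k) auto
      thus ?thesis using 2 by simp
    qed auto
  qed
  have step: "(\<Sum>d | d dvd q ^ k * s. \<psi> d) = (\<Sum>i\<le>k. \<psi> q ^ i) * (\<Sum>d | d dvd s. \<psi> d)"
    if "prime q" "\<not> q dvd s" for q k s
    using divisors_prime_power_mult[OF that]
    by (simp add: real_charD(1)[OF assms(1)] real_char_power[OF assms(1)] sum_product)
  have "0 \<le> (\<Sum>d | d dvd n. \<psi> d) \<and> 1 \<le> (\<Sum>d | d dvd n\<^sup>2. \<psi> d)"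
    using assms(2)
  proof (induction n rule: less_induct)
    case (less n)
    show ?case
    proof (cases "n = 1")
      case True
      thus ?thesis using real_charD(6)[OF assms(1)] by (simp add: dvd_1_iff_1)
    next
      case False
      then obtain q where q: "prime q" "q dvd n" using prime_factor_nat by blast
      obtain s where s: "n = q ^ multiplicity q n * s" "\<not> q dvd s"
        using less.prems q by (metis multiplicity_decompose' not_prime_unit less_not_refl)
      define k where "k = multiplicity q n"
      have ns: "n = q ^ k * s" "n\<^sup>2 = q ^ (2 * k) * s\<^sup>2"
        using s(1) unfolding k_def by (simp, metis power_mult_distrib power_mult mult.commute)
      have k: "k > 0" using q less.prems unfolding k_def by (simp add: prime_multiplicity_gt_zero_iff)
      have spos: "s > 0" using ns less.prems by (cases s) auto
      have "1 < q ^ k" using one_less_power[OF prime_gt_1_nat[OF q(1)] k] .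
      hence "s < n" using ns spos by simp
      hence IH: "0 \<le> (\<Sum>d | d dvd s. \<psi> d)" "1 \<le> (\<Sum>d | d dvd s\<^sup>2. \<psi> d)"
        using less.IH spos by blast+
      have "\<not> q dvd s\<^sup>2" using s(2) q(1) prime_dvd_power by blast
      hence "(\<Sum>d | d dvd n\<^sup>2. \<psi> d) = (\<Sum>i\<le>2*k. \<psi> q ^ i) * (\<Sum>d | d dvd s\<^sup>2. \<psi> d)"
        using step[OF q(1)] ns by simp
      moreover have "1 * 1 \<le> (\<Sum>i\<le>2*k. \<psi> q ^ i) * (\<Sum>d | d dvd s\<^sup>2. \<psi> d)"
        using geo[of q "2 * k"] IH by (intro mult_mono) auto
      moreover have "(\<Sum>d | d dvd n. \<psi> d) = (\<Sum>i\<le>k. \<psi> q ^ i) * (\<Sum>d | d dvd s. \<psi> d)"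
        using step[OF q(1) s(2)] ns by simp
      ultimately show ?thesis using geo[of q k] IH(1) by simp
    qed
  qed
  thus "(\<Sum>d | d dvd n. \<psi> d) \<ge> 0" "(\<Sum>d | d dvd n\<^sup>2. \<psi> d) \<ge> 1" by auto
qed

text \<open>
  Pairing the terms \<open>x^i\<close> and \<open>x^(n-1-i)\<close> shows that a geometric sum of \<open>n\<close> terms is at least \<open>n\<close>
  times its middle term.  This is the inequality behind the monotonicity of the weights in the
  next lemma.
\<close>

lemma geometric_AM_GM:
  fixes x :: real
  assumes "0 < x" "x < 1" "n > 0"
  shows "real n * real (Suc n) * x ^ n \<le> (\<Sum>i<n. x ^ i) * (\<Sum>i<Suc n. x ^ i)"
proof -
  have half: "real n * sqrt x ^ (n - 1) \<le> (\<Sum>i<n. x ^ i)" if "n > 0" for n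
  proof -
    have "2 * (\<Sum>i<n. x ^ i) = (\<Sum>i<n. x ^ i) + (\<Sum>i<n. x ^ (n - Suc i))"
      by (subst sum.nat_diff_reindex) simp
    also have "\<dots> = (\<Sum>i<n. x ^ i + x ^ (n - Suc i))" by (simp add: sum.distrib)
    also have "\<dots> \<ge> (\<Sum>i<n. 2 * sqrt x ^ (n - 1))"
    proof (rule sum_mono)
      fix i assume i: "i \<in> {..<n}"
      have "sqrt x ^ (n - 1) = sqrt (x ^ i * x ^ (n - Suc i))"
        using i by (simp add: power_add[symmetric] real_sqrt_power)
      thus "2 * sqrt x ^ (n - 1) \<le> x ^ i + x ^ (n - Suc i)"
        using arith_geo_mean_sqrt[of "x ^ i" "x ^ (n - Suc i)"] assms by simp
    qed
    finally show ?thesis by simp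
  qed
  have "x ^ n \<le> sqrt x ^ (n - 1) * sqrt x ^ n"
  proof -
    have "x ^ n = sqrt x ^ n * sqrt x ^ n" using assms by (simp add: power_mult_distrib[symmetric])
    also have "\<dots> \<le> sqrt x ^ (n - 1) * sqrt x ^ n"
      using assms by (intro mult_right_mono power_decreasing) auto
    finally show ?thesis .
  qed
  hence "real n * real (Suc n) * x ^ n \<le> real n * real (Suc n) * (sqrt x ^ (n - 1) * sqrt x ^ n)"
    by (intro mult_left_mono) auto
  also have "\<dots> = (real n * sqrt x ^ (n - 1)) * (real (Suc n) * sqrt x ^ (Suc n - 1))" by simp
  also have "\<dots> \<le> (\<Sum>i<n. x ^ i) * (\<Sum>i<Suc n. x ^ i)"
    using assms half[of n] half[of "Suc n"]
    by (intro mult_mono) (auto intro!: sum_nonneg)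
  finally show ?thesis .
qed

text \<open>
  The weights that compare the Lambert series \<open>\<Sum>n. \<psi>(n) x^n / (1 - x^n)\<close> with
  \<open>L(1, \<psi>) / (1 - x)\<close>.  At \<open>n = 1\<close> the weight is 1 for every \<open>x\<close>, so summation by parts bounds
  the difference uniformly as \<open>x\<close> tends to 1.
\<close>

lemma lambert_weight_antimono:
  fixes x :: real
  assumes "0 < x" "x < 1"
  defines "b \<equiv> \<lambda>n. 1 / (real n * (1 - x)) - x ^ n / (1 - x ^ n)"
  assumes "n \<ge> 1"
  shows "b (Suc n) \<le> b n" "0 \<le> b n"
proof -
  define G where "G k = (\<Sum>i<k. x ^ i)" for k
  have xn: "1 - x ^ k = (1 - x) * G k" for k
    unfolding G_def using sum_gp_strict[of x k] assms by simp
  have Gpos: "G k > 0" if "k \<ge> 1" for k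
    unfolding G_def using assms that by (intro sum_pos) (auto simp: lessThan_empty_iff)
  have b: "b k = (1 / k - x ^ k / G k) / (1 - x)" for k
    unfolding b_def xn using assms by (simp add: diff_divide_distrib)
  have "G (Suc n) = G n + x ^ n" "x * G n = G (Suc n) - 1" 
    unfolding G_def by (simp, subst sum.lessThan_Suc_shift, simp add: sum_distrib_left)
  have le: "real n * x ^ n \<le> G n" 
  proof -
    have "(\<Sum>i<n. x ^ n) \<le> G n" unfolding G_def using assms
      by (intro sum_mono power_decreasing) auto
    thus ?thesis by simp
  qed
  thus "0 \<le> b n" unfolding b using assms Gpos[of n] by (simp add: field_simps)
  have "x ^ n / G n - x ^ Suc n / G (Suc n) = x ^ n / (G n * G (Suc n))"
  proof -
    have "x ^ n * G (Suc n) - x ^ Suc n * G n = x ^ n"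
    proof -
      have "x ^ n * G (Suc n) - x ^ n * (x * G n) = x ^ n"
        unfolding \<open>x * G n = _\<close> by (simp add: right_diff_distrib)
      thus ?thesis by (simp add: mult_ac)
    qed
    thus ?thesis using Gpos[of n] Gpos[of "Suc n"] assms(4) by (simp add: field_simps)
  qed
  also have "\<dots> \<le> 1 / (real n * real (Suc n))"
  proof -
    have "real n * real (Suc n) * x ^ n \<le> G n * G (Suc n)"
      using geometric_AM_GM[OF assms(1,2), of n] assms(4) unfolding G_def by simp
    thus ?thesis using Gpos[of n] Gpos[of "Suc n"] assms(4) by (simp add: field_simps del: of_nat_Suc)
  qed
  also have "\<dots> = 1 / real n - 1 / real (Suc n)" using assms(4) by (simp add: field_simps)
  finally show "b (Suc n) \<le> b n" unfolding b using assms by (intro divide_right_mono) auto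
qed

text \<open>
  If \<open>L(1, \<psi>)\<close> were zero, the Lambert series would stay bounded as \<open>x\<close> tends to 1.  But
  rearranged as a power series its coefficients are the divisor sums of \<open>\<psi>\<close>, which are nonnegative
  and at least 1 at the squares, so it is unbounded.  The argument is carried out with finite
  sums: all \<open>d j \<le> M\<close> are kept, and \<open>M\<close> tends to infinity before \<open>x\<close> tends to 1.
\<close>

theorem L1_nonzero:
  assumes \<psi>: "real_char m \<psi>" "m > 0" "\<psi> g = -1"
  shows "L1 \<psi> \<noteq> 0"
proof
  assume L0: "L1 \<psi> = 0"
  have bound: "(\<Sum>k\<in>{1..K}. x ^ k\<^sup>2) \<le> 2 * m" if x: "0 < x" "x < 1" for x :: real and K :: nat
  proof -
    define b where "b n = 1 / (real n * (1 - x)) - x ^ n / (1 - x ^ n)" for n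
    have "(\<Sum>k\<in>{1..K}. x ^ k\<^sup>2) \<le> 2 * m + 2 * m / (1 - x) * (1 / Suc M) + M * x ^ M / (1 - x)"
      if M: "M \<ge> K\<^sup>2" for M
    proof -
      have xn: "0 < 1 - x ^ n" if "n \<ge> 1" for n using x that power_Suc_less_one[of x "n - 1"] by simp
      have xn1: "1 - x \<le> 1 - x ^ n" if "n \<ge> 1" for n using x that power_decreasing[of 1 n x] by simp
      have "(\<Sum>k\<in>{1..K}. x ^ k\<^sup>2) \<le> (\<Sum>k\<in>{1..K}. (\<Sum>d | d dvd k\<^sup>2. \<psi> d) * x ^ k\<^sup>2)"
        using x real_char_divisor_sum(2)[OF \<psi>(1)] by (intro sum_mono) auto
      also have "\<dots> = (\<Sum>r\<in>(\<lambda>k. k\<^sup>2) ` {1..K}. (\<Sum>d | d dvd r. \<psi> d) * x ^ r)"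
        by (subst sum.reindex) (auto simp: inj_on_def)
      also have "\<dots> \<le> (\<Sum>r\<in>{1..M}. (\<Sum>d | d dvd r. \<psi> d) * x ^ r)"
      proof (rule sum_mono2)
        show "(\<lambda>k. k\<^sup>2) ` {1..K} \<subseteq> {1..M}"
          using M by (auto intro!: order_trans[OF power_mono[of _ K 2] M])
      qed (use x real_char_divisor_sum(1)[OF \<psi>(1)] in auto)
      also have "\<dots> = (\<Sum>r\<in>{1..M}. \<Sum>d | d dvd r. \<psi> d * x ^ (d * (r div d)))"
        by (simp add: sum_distrib_right)
      also have "\<dots> = (\<Sum>d\<in>{1..M}. \<Sum>j\<in>{1..M div d}. \<psi> d * x ^ (d * j))"
        by (rule sum_divisors_swap)
      also have "\<dots> = (\<Sum>d\<in>{1..M}. \<psi> d * ((x ^ d - x ^ (d * Suc (M div d))) / (1 - x ^ d)))"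
      proof (rule sum.cong[OF refl])
        fix d assume d: "d \<in> {1..M}"
        have "(\<Sum>j\<in>{1..J}. y ^ j) * (1 - y) = y - y ^ Suc J" for J and y :: real
          by (induction J) (simp, simp add: distrib_right, simp add: algebra_simps)
        hence "(\<Sum>j\<in>{1..M div d}. x ^ (d * j)) = (x ^ d - x ^ (d * Suc (M div d))) / (1 - x ^ d)"
          using xn[of d] d by (simp only: power_mult eq_divide_eq) auto
        thus "(\<Sum>j\<in>{1..M div d}. \<psi> d * x ^ (d * j)) = \<psi> d * ((x ^ d - x ^ (d * Suc (M div d))) / (1 - x ^ d))"
          by (simp only: sum_distrib_left[symmetric])
      qed
      also have "\<dots> \<le> (\<Sum>d\<in>{1..M}. \<psi> d / (real d * (1 - x)) - \<psi> d * b d + x ^ M / (1 - x))"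
      proof (rule sum_mono)
        fix d assume d: "d \<in> {1..M}"
        have "M < d * Suc (M div d)" using d by (simp add: dividend_less_times_div)
        hence "x ^ (d * Suc (M div d)) \<le> x ^ M" using x by (intro power_decreasing) auto
        hence "x ^ (d * Suc (M div d)) / (1 - x ^ d) \<le> x ^ M / (1 - x)"
          using x xn[of d] xn1[of d] d by (intro frac_le) auto
        moreover have "- \<psi> d * (x ^ (d * Suc (M div d)) / (1 - x ^ d)) \<le> 1 * (x ^ (d * Suc (M div d)) / (1 - x ^ d))"
          using real_charD(5)[OF \<psi>(1), of d] x xn[of d] d by (intro mult_right_mono) auto
        ultimately show "\<psi> d * ((x ^ d - x ^ (d * Suc (M div d))) / (1 - x ^ d)) \<le>
            \<psi> d / (real d * (1 - x)) - \<psi> d * b d + x ^ M / (1 - x)"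
          unfolding b_def by (simp add: diff_divide_distrib algebra_simps)
      qed
      also have "\<dots> = (\<Sum>d\<in>{1..M}. \<psi> d / d) / (1 - x) - (\<Sum>d\<in>{1..<Suc M}. \<psi> d * b d) + M * x ^ M / (1 - x)"
        by (simp add: sum.distrib sum_subtractf sum_divide_distrib atLeastLessThanSuc_atLeastAtMost)
      also have "\<dots> \<le> 2 * m / Suc M / (1 - x) + 2 * m * 1 + M * x ^ M / (1 - x)"
      proof -
        have "b 1 = 1" unfolding b_def using x by (simp add: field_simps)
        moreover have "\<bar>\<Sum>d\<in>{1..<Suc M}. \<psi> d * b d\<bar> \<le> real (2 * m) * b 1"
          using lambert_weight_antimono[OF x] unfolding b_def
          by (intro abel_bound real_char_sum_bound[OF \<psi>]) auto
        moreover have "(\<Sum>d\<in>{1..M}. \<psi> d / d) / (1 - x) \<le> 2 * m / Suc M / (1 - x)"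
          using L1_approx[OF \<psi>, of M] L0 x by (intro divide_right_mono) auto
        ultimately show ?thesis by simp
      qed
      finally show ?thesis by (simp add: mult.commute)
    qed
    moreover have "(\<lambda>M. 2 * m + 2 * m / (1 - x) * (1 / Suc M) + M * x ^ M / (1 - x))
        \<longlonglongrightarrow> 2 * m + 2 * m / (1 - x) * 0 + 0 / (1 - x)"
    proof (intro tendsto_intros)
      show "(\<lambda>M. 1 / real (Suc M)) \<longlonglongrightarrow> 0" using LIMSEQ_inverse_real_of_nat by (simp add: inverse_eq_divide)
      show "(\<lambda>M. real M * x ^ M) \<longlonglongrightarrow> 0" using x by (intro powser_times_n_limit_0) auto
    qed (use x in auto)
    ultimately show ?thesis using LIMSEQ_le_const by fastforce
  qed
  define K where "K = Suc (2 * m)"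
  have "((\<lambda>x::real. \<Sum>k\<in>{1..K}. x ^ k\<^sup>2) \<longlongrightarrow> (\<Sum>k\<in>{1..K}. 1 ^ k\<^sup>2)) (at_left 1)"
    by (intro tendsto_intros)
  moreover have "eventually (\<lambda>x::real. (\<Sum>k\<in>{1..K}. x ^ k\<^sup>2) \<le> 2 * m) (at_left 1)"
  proof (rule eventually_mono)
    show "eventually (\<lambda>x::real. x \<in> {0<..<1}) (at_left 1)" by (rule eventually_at_left_real) simp
    show "(\<Sum>k\<in>{1..K}. x ^ k\<^sup>2) \<le> 2 * m" if "x \<in> {0<..<1}" for x :: real
      using bound[of x K] that by (simp del: One_nat_def)
  qed
  ultimately have "(\<Sum>k\<in>{1..K}. (1::real) ^ k\<^sup>2) \<le> 2 * m"
    using tendsto_upperbound trivial_limit_at_left_real by blast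
  thus False unfolding K_def by simp
qed

section \<open>Estimates of Chebyshev and Mertens\<close>

lemma ln_over_antimono:
  assumes "k \<ge> 3"
  shows "ln (real (Suc k)) / real (Suc k) \<le> ln (real k) / real k"
proof -
  have "exp 1 \<le> real k" using exp_le assms by (meson of_nat_le_iff order_trans of_nat_numeral order.trans numeral_le_real_of_nat_iff)
  have "ln (real (Suc k)) = ln (real k) + ln (1 + 1 / real k)"
  proof -
    have "real (Suc k) = real k * (1 + 1 / real k)" using assms by (simp add: field_simps)
    moreover have "0 < real k" "0 < 1 + 1 / real k" using assms by (auto intro: add_pos_nonneg)
    ultimately show ?thesis by (metis ln_mult_pos)
  qed
  also have "ln (1 + 1 / real k) \<le> 1 / real k" using assms by (intro ln_add_one_self_le_self) auto
  also have "1 / real k \<le> ln (real k) / real k"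
    using \<open>exp 1 \<le> real k\<close> assms by (intro divide_right_mono) (auto simp: ln_ge_iff)
  finally show ?thesis using assms by (simp add: field_simps)
qed

text \<open>
  The logarithm of \<open>N!\<close>, computed from \<open>ln n = \<Sum>d | d dvd n. mangoldt d\<close>.
\<close>

lemma sum_ln_eq_mangoldt:
  "(\<Sum>n\<in>{1..N}. ln (real n)) = (\<Sum>d\<in>{1..N}. mangoldt d * real (N div d))"
proof -
  have "(\<Sum>n\<in>{1..N}. ln (real n)) = (\<Sum>n\<in>{1..N}. \<Sum>d | d dvd n. mangoldt d)"
    by (intro sum.cong refl) (simp add: mangoldt_sum)
  also have "\<dots> = (\<Sum>d\<in>{1..N}. \<Sum>j\<in>{1..N div d}. mangoldt d)"
    by (rule sum_divisors_swap)
  finally show ?thesis by (simp add: mult.commute)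
qed

text \<open>
  The binomial coefficient \<open>2n choose n\<close> is divisible by all the primes between \<open>n\<close> and \<open>2n\<close> and is
  at most \<open>4^n\<close>; this bounds the increase from \<open>n\<close> to \<open>2n\<close>, and halving \<open>N\<close> repeatedly gives the
  linear bound.
\<close>

lemma chebyshev_bound: "(\<Sum>d\<in>{1..N}. mangoldt d :: real) \<le> 4 * N"
proof (induction N rule: less_induct)
  case (less N)
  show ?case
  proof (cases "N \<le> 1")
    case True
    thus ?thesis by (cases N) auto
  next
    case False
    define n where "n = N div 2"
    have n: "n < N" "2 * n \<le> N" "N \<le> Suc (2 * n)" using False by (auto simp: n_def)
    have "(\<Sum>d\<in>{n<..2*n}. mangoldt d :: real) \<le> (\<Sum>d\<in>{1..2*n}. mangoldt d * (real (2 * n div d) - 2 * real (n div d)))"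
    proof -
      have "(\<Sum>d\<in>{n<..2*n}. mangoldt d :: real) = (\<Sum>d\<in>{n<..2*n}. mangoldt d * (real (2 * n div d) - 2 * real (n div d)))"
      proof (rule sum.cong[OF refl])
        fix d assume d: "d \<in> {n<..2*n}"
        hence "2 * n div d = 1" by (intro div_nat_eqI) auto
        thus "(mangoldt d :: real) = mangoldt d * (real (2 * n div d) - 2 * real (n div d))" using d by simp
      qed
      also have "\<dots> \<le> (\<Sum>d\<in>{1..2*n}. mangoldt d * (real (2 * n div d) - 2 * real (n div d)))"
      proof (rule sum_mono2)
        fix d
        have "2 * (n div d) \<le> 2 * n div d" 
          by (cases "d = 0") (simp_all add: less_eq_div_iff_mult_less_eq)
        hence "2 * real (n div d) \<le> real (2 * n div d)" by (metis of_nat_le_iff of_nat_mult of_nat_numeral)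
        thus "0 \<le> mangoldt d * (real (2 * n div d) - 2 * real (n div d))"
          using mangoldt_nonneg by simp
      qed auto
      finally show ?thesis .
    qed
    also have "\<dots> = (\<Sum>k\<in>{1..2*n}. ln (real k)) - 2 * (\<Sum>k\<in>{1..n}. ln (real k))"
    proof -
      have "(\<Sum>d\<in>{1..n}. mangoldt d * real (n div d)) = (\<Sum>d\<in>{1..2*n}. mangoldt d * real (n div d))"
        by (intro sum.mono_neutral_left) auto
      thus ?thesis unfolding sum_ln_eq_mangoldt
        by (simp add: sum_distrib_left sum_subtractf right_diff_distrib mult_ac)
    qed
    also have "\<dots> = ln (real ((2 * n) choose n))"
    proof -
      have f: "(\<Sum>k\<in>{1..j}. ln (real k)) = ln (fact j)" for j
        unfolding fact_prod of_nat_prod by (subst ln_prod) auto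
      have "real ((2 * n) choose n) = fact (2 * n) / (fact n * fact n)"
        by (simp add: binomial_fact)
      thus ?thesis unfolding f by (simp add: ln_div ln_mult)
    qed
    also have "\<dots> \<le> ln (real (2 ^ (2 * n)))"
    proof -
      have "(2 * n) choose n \<le> 2 ^ (2 * n)" by (rule binomial_le_pow2)
      moreover have "0 < (2 * n) choose n" by simp
      ultimately show ?thesis by (subst ln_le_cancel_iff) (auto simp del: of_nat_power)
    qed
    also have "\<dots> = 2 * n * ln 2" by (simp add: ln_realpow)
    also have "\<dots> \<le> 2 * n * (7 / 10)" using ln_2_less_1 ln2_le_25_over_36 by (intro mult_left_mono) auto
    finally have *: "(\<Sum>d\<in>{n<..2*n}. mangoldt d :: real) \<le> 1.4 * n" by simp
    have **: "(mangoldt N :: real) \<le> ln (real N)"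
    proof -
      have "(mangoldt N :: real) \<le> (\<Sum>d | d dvd N. mangoldt d)"
        using False mangoldt_nonneg by (intro member_le_sum) auto
      thus ?thesis using mangoldt_sum[of N, where ?'a = real] False by simp
    qed
    have "ln (real N) \<le> real N - 1" using False by (intro ln_le_minus_one) auto
    have "(\<Sum>d\<in>{1..N}. mangoldt d :: real) \<le> (\<Sum>d\<in>{1..2*n}. mangoldt d) + mangoldt N"
    proof (cases "N = 2 * n")
      case True
      thus ?thesis using mangoldt_nonneg by simp
    next
      case False
      hence "N = Suc (2 * n)" using n by simp
      thus ?thesis by simp
    qed
    also have "(\<Sum>d\<in>{1..2*n}. mangoldt d) = (\<Sum>d\<in>{1..n}. mangoldt d) + (\<Sum>d\<in>{n<..2*n}. mangoldt d :: real)"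
      by (subst sum.union_disjoint[symmetric]) (auto intro!: sum.cong)
    also have "(\<Sum>d\<in>{1..n}. mangoldt d :: real) \<le> 4 * n" using less.IH n by blast
    finally show ?thesis using * ** \<open>ln (real N) \<le> real N - 1\<close> n by simp
  qed
qed

text \<open>
  The sum is at least \<open>ln (N!) / N\<close>, and half of the factors of \<open>N!\<close> are at least \<open>N / 2\<close>.
\<close>

lemma mangoldt_over_unbounded: "\<exists>N. (\<Sum>d\<in>{1..N}. mangoldt d / d :: real) > C"
proof -
  obtain K :: nat where K: "exp (2 * C + 2) < real K" using reals_Archimedean2 by blast
  hence K0: "K > 0" using exp_gt_zero[of "2 * C + 2"] by (cases K) auto
  define N where "N = 2 * K"
  have lnK: "2 * C + 2 < ln (real K)" using K K0 by (metis exp_less_cancel_iff exp_ln of_nat_0_less_iff)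
  have "real K * ln (real K) = (\<Sum>n\<in>{K<..2*K}. ln (real K))" by simp
  also have "\<dots> \<le> (\<Sum>n\<in>{K<..2*K}. ln (real n))" using K0 by (intro sum_mono) auto
  also have "\<dots> \<le> (\<Sum>n\<in>{1..N}. ln (real n))" unfolding N_def by (intro sum_mono2) auto
  also have "\<dots> = (\<Sum>d\<in>{1..N}. mangoldt d * real (N div d))" by (rule sum_ln_eq_mangoldt)
  also have "\<dots> \<le> (\<Sum>d\<in>{1..N}. mangoldt d * (real N / d))"
    using mangoldt_nonneg by (intro sum_mono mult_left_mono of_nat_div_le_of_nat) auto
  also have "\<dots> = 2 * K * (\<Sum>d\<in>{1..N}. mangoldt d / d)" by (simp add: N_def sum_distrib_left mult_ac)
  finally have "real K * (ln (real K)) \<le> real K * (2 * (\<Sum>d\<in>{1..N}. mangoldt d / d))" by simp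
  hence "ln (real K) \<le> 2 * (\<Sum>d\<in>{1..N}. mangoldt d / d)" using K0 by simp
  hence "C < (\<Sum>d\<in>{1..N}. mangoldt d / d)" using lnK by simp
  thus ?thesis by blast
qed

text \<open>
  Write \<open>\<Sum>n\<le>N. \<psi>(n) ln n / n\<close>, which is bounded by summation by parts, as a double sum over
  \<open>n = d j\<close>.  The inner sum over \<open>j\<close> is \<open>L(1, \<psi>)\<close> up to \<open>O(d / N)\<close>, and Chebyshev's bound absorbs
  the error.  Dividing by the nonzero number \<open>L(1, \<psi>)\<close> leaves the claim.
\<close>

lemma mertens_nonprincipal:
  assumes \<psi>: "real_char m \<psi>" "m > 0" "\<psi> g = -1"
  shows "\<exists>C. \<forall>N. \<bar>\<Sum>d\<in>{1..N}. \<psi> d * mangoldt d / d\<bar> \<le> C"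
proof -
  define f where "f k = ln (real k) / real k" for k :: nat
  have f0: "f k \<ge> 0" for k unfolding f_def by (cases k) auto
  have A: "\<bar>\<Sum>k\<in>{1..N}. \<psi> k * f k\<bar> \<le> f 1 + f 2 + 2 * m * f 3" (is "_ \<le> ?A") for N
  proof -
    have t: "\<bar>\<Sum>k\<in>{3..<Suc N}. \<psi> k * f k\<bar> \<le> real (2 * m) * f 3"
      using f0 ln_over_antimono unfolding f_def by (intro abel_bound real_char_sum_bound[OF \<psi>]) auto
    have "\<bar>\<Sum>k\<in>{1..<3}. \<psi> k * f k\<bar> \<le> (\<Sum>k\<in>{1..<3}. 1 * f k)"
    proof (intro order_trans[OF sum_abs] sum_mono)
      show "\<bar>\<psi> k * f k\<bar> \<le> 1 * f k" for k
        using mult_right_mono[of "\<bar>\<psi> k\<bar>" 1 "f k"] f0[of k] real_charD(5)[OF \<psi>(1), of k]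
        by (simp add: abs_mult)
    qed
    also have "\<dots> = f 1 + f 2" by (simp add: numeral_3_eq_3 numeral_2_eq_2)
    finally have h: "\<bar>\<Sum>k\<in>{1..<3}. \<psi> k * f k\<bar> \<le> f 1 + f 2" .
    show ?thesis
    proof (cases "N \<ge> 2")
      case True
      have "(\<Sum>k\<in>{1..N}. \<psi> k * f k) = (\<Sum>k\<in>{1..<3}. \<psi> k * f k) + (\<Sum>k\<in>{3..<Suc N}. \<psi> k * f k)"
        using True by (subst sum.atLeastLessThan_concat) (auto simp: atLeastLessThanSuc_atLeastAtMost)
      thus ?thesis using h t by simp
    next
      case False
      hence "N = 0 \<or> N = 1" by auto
      hence "(\<Sum>k\<in>{1..N}. \<psi> k * f k) = 0" by (auto simp: f_def)
      thus ?thesis using f0[of 1] f0[of 2] f0[of 3] by simp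
    qed
  qed
  have "\<bar>L1 \<psi>\<bar> * \<bar>\<Sum>d\<in>{1..N}. \<psi> d * mangoldt d / d\<bar> \<le> ?A + 8 * m" for N
  proof (cases "N = 0")
    case False
    define e where "e d = (\<Sum>j\<in>{1..N div d}. \<psi> j / j) - L1 \<psi>" for d
    have "(\<Sum>k\<in>{1..N}. \<psi> k * f k) = (\<Sum>k\<in>{1..N}. \<Sum>d | d dvd k. \<psi> d * mangoldt d / d * (\<psi> (k div d) / (k div d)))"
    proof (rule sum.cong[OF refl])
      fix k assume k: "k \<in> {1..N}"
      have "(\<Sum>d | d dvd k. \<psi> d * mangoldt d / d * (\<psi> (k div d) / (k div d))) = (\<Sum>d | d dvd k. \<psi> k / k * mangoldt d)"
      proof (rule sum.cong[OF refl])
        fix d assume "d \<in> {d. d dvd k}"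
        then obtain j where j: "k = d * j" by auto
        hence "d > 0" "j > 0" using k by (auto intro: Nat.gr0I)
        thus "\<psi> d * mangoldt d / d * (\<psi> (k div d) / (k div d)) = \<psi> k / k * mangoldt d"
          using j by (simp add: real_charD(1)[OF \<psi>(1)])
      qed
      also have "\<dots> = \<psi> k / k * (\<Sum>d | d dvd k. mangoldt d)" by (simp only: sum_distrib_left)
      also have "\<dots> = \<psi> k * f k"
        using mangoldt_sum[of k, where ?'a = real] k by (simp add: f_def)
      finally show "\<psi> k * f k = (\<Sum>d | d dvd k. \<psi> d * mangoldt d / d * (\<psi> (k div d) / (k div d)))" by simp
    qed
    also have "\<dots> = (\<Sum>d\<in>{1..N}. \<Sum>j\<in>{1..N div d}. \<psi> d * mangoldt d / d * (\<psi> j / j))"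
      by (rule sum_divisors_swap)
    also have "\<dots> = (\<Sum>d\<in>{1..N}. \<psi> d * mangoldt d / d * (L1 \<psi> + e d))"
      unfolding sum_distrib_left[symmetric] e_def by simp
    also have "\<dots> = L1 \<psi> * (\<Sum>d\<in>{1..N}. \<psi> d * mangoldt d / d) + (\<Sum>d\<in>{1..N}. \<psi> d * mangoldt d / d * e d)"
      by (simp add: distrib_left sum.distrib sum_distrib_left mult_ac add_divide_distrib)
    finally have eq: "(\<Sum>k\<in>{1..N}. \<psi> k * f k) = \<dots>" .
    have "\<bar>\<Sum>d\<in>{1..N}. \<psi> d * mangoldt d / d * e d\<bar> \<le> (\<Sum>d\<in>{1..N}. mangoldt d * (2 * m / N))"
    proof (intro order_trans[OF sum_abs] sum_mono)
      fix d assume d: "d \<in> {1..N}"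
      have "\<bar>e d\<bar> \<le> 2 * m / Suc (N div d)" unfolding e_def using L1_approx[OF \<psi>, of "N div d"] by simp
      also have "\<dots> \<le> 2 * m * (d / N)"
      proof -
        have "N < d * Suc (N div d)" using d by (simp add: dividend_less_times_div)
        hence "real N \<le> real d * real (Suc (N div d))" by (metis less_imp_le of_nat_le_iff of_nat_mult)
        hence "1 / real (Suc (N div d)) \<le> d / N" using d False by (simp add: field_simps del: of_nat_Suc)
        hence "2 * m * (1 / real (Suc (N div d))) \<le> 2 * m * (d / N)" by (intro mult_left_mono) auto
        thus ?thesis by simp
      qed
      finally have e: "\<bar>e d\<bar> \<le> 2 * m * (d / N)" .
      have "\<bar>\<psi> d * mangoldt d / d * e d\<bar> = \<bar>\<psi> d\<bar> * (mangoldt d / d * \<bar>e d\<bar>)"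
        using mangoldt_nonneg[of d] by (simp add: abs_mult)
      also have "\<dots> \<le> 1 * (mangoldt d / d * (2 * m * (d / N)))"
        using e real_charD(5)[OF \<psi>(1)] mangoldt_nonneg[of d] d by (intro mult_mono mult_left_mono) auto
      finally show "\<bar>\<psi> d * mangoldt d / d * e d\<bar> \<le> mangoldt d * (2 * m / N)" using d by simp
    qed
    also have "\<dots> \<le> 4 * N * (2 * m / N)"
      unfolding sum_distrib_right[symmetric] using chebyshev_bound by (intro mult_right_mono) auto
    finally have "\<bar>\<Sum>d\<in>{1..N}. \<psi> d * mangoldt d / d * e d\<bar> \<le> 8 * m" using False by simp
    hence "\<bar>L1 \<psi> * (\<Sum>d\<in>{1..N}. \<psi> d * mangoldt d / d)\<bar> \<le> ?A + 8 * m" using A[of N] eq by linarith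
    thus ?thesis by (simp add: abs_mult)
  qed (use f0[of 1] f0[of 2] f0[of 3] in simp)
  hence "\<bar>\<Sum>d\<in>{1..N}. \<psi> d * mangoldt d / d\<bar> \<le> (?A + 8 * m) / \<bar>L1 \<psi>\<bar>" for N
    using L1_nonzero[OF \<psi>] by (simp add: field_simps)
  thus ?thesis by blast
qed

text \<open>
  Prime powers with exponent at least 2 contribute a convergent series, so the estimates for the
  von Mangoldt function are estimates for primes.
\<close>

lemma proper_prime_powers_bound:
  "\<exists>C. \<forall>N. (\<Sum>d | d \<in> {1..N} \<and> \<not> prime d. mangoldt d / d :: real) \<le> C"
proof -
  have "summable (\<lambda>q::nat. 4 * (1 / real q powr (3/2)))"
    by (intro summable_mult) (simp add: summable_real_powr_iff inverse_eq_divide[symmetric] powr_minus[symmetric])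
  then obtain C where C: "(\<Sum>q<N. 4 * (1 / real q powr (3/2))) \<le> C" for N
    using sum_le_suminf[of "\<lambda>q::nat. 4 * (1 / real q powr (3/2))"] by force
  have "(\<Sum>d | d \<in> {1..N} \<and> \<not> prime d. mangoldt d / d :: real) \<le> C" for N
  proof -
    define T where "T = {2..N} \<times> {2..N}"
    define h where "h = (\<lambda>(q, k). ln (real q) * (1 / real q) ^ k)"
    have "(\<Sum>d | d \<in> {1..N} \<and> \<not> prime d. mangoldt d / d :: real) =
        (\<Sum>d | d \<in> {1..N} \<and> \<not> prime d \<and> primepow d. mangoldt d / d :: real)"
      by (intro sum.mono_neutral_right) (auto simp: mangoldt_def)
    also have "\<dots> \<le> (\<Sum>x\<in>T. h x)"
    proof (rule sum_le_included[where i = "\<lambda>(q, k). q ^ k"])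
      show "\<forall>x\<in>T. 0 \<le> h x" by (auto simp: T_def h_def)
      show "\<forall>d\<in>{d. d \<in> {1..N} \<and> \<not> prime d \<and> primepow d}.
          \<exists>x\<in>T. (case x of (q, k) \<Rightarrow> q ^ k) = d \<and> mangoldt d / real d \<le> h x"
      proof
        fix d assume d: "d \<in> {d. d \<in> {1..N} \<and> \<not> prime d \<and> primepow d}"
        then obtain q k where qk: "prime q" "k > 0" "d = q ^ k" by (auto simp: primepow_def)
        have "k \<noteq> 1" using qk d by auto
        hence k2: "k \<ge> 2" using qk by simp
        have q2: "q \<ge> 2" using qk prime_ge_2_nat by blast
        have "q \<le> q ^ k" using qk q2 by (simp add: self_le_power)
        moreover have "k < q ^ k" using q2 by (meson less_exp order_less_le_trans power_mono zero_le)
        ultimately have "(q, k) \<in> T" using k2 q2 qk d by (auto simp: T_def)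
        moreover have "mangoldt d / real d \<le> h (q, k)" using qk by (simp add: h_def power_divide)
        ultimately show "\<exists>x\<in>T. (case x of (q, k) \<Rightarrow> q ^ k) = d \<and> mangoldt d / real d \<le> h x"
          using qk by (intro bexI[of _ "(q, k)"]) auto
      qed
    qed (auto simp: T_def)
    also have "\<dots> = (\<Sum>q\<in>{2..N}. ln (real q) * (\<Sum>k\<in>{2..N}. (1 / real q) ^ k))"
      unfolding T_def h_def by (simp add: sum.cartesian_product[symmetric] sum_distrib_left)
    also have "\<dots> \<le> (\<Sum>q\<in>{2..N}. 4 * (1 / real q powr (3/2)))"
    proof (rule sum_mono)
      fix q assume q: "q \<in> {2..N}"
      define y where "y = 1 / real q"
      have y: "0 \<le> y" "y \<le> 1 / 2" using q by (auto simp: y_def)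
      have "(\<Sum>k\<in>{2..N}. y ^ k) * (1 - y) \<le> y\<^sup>2"
      proof (cases "N \<ge> 2")
        case True
        hence "(\<Sum>k\<in>{2..N}. y ^ k) * (1 - y) = y\<^sup>2 - y ^ Suc N"
        proof (induction N rule: dec_induct)
          case base
          show ?case by (simp add: algebra_simps power2_eq_square power3_eq_cube numeral_3_eq_3)
        next
          case (step n)
          have "(\<Sum>k\<in>{2..Suc n}. y ^ k) * (1 - y) = (\<Sum>k\<in>{2..n}. y ^ k) * (1 - y) + y ^ Suc n * (1 - y)"
            using step.hyps by (simp add: distrib_right)
          also have "\<dots> = y\<^sup>2 - y ^ Suc n + y ^ Suc n * (1 - y)" by (simp only: step.IH)
          also have "\<dots> = y\<^sup>2 - y ^ Suc (Suc n)" by (simp add: algebra_simps)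
          finally show ?case .
        qed
        thus ?thesis using y by simp
      qed simp
      moreover have "(\<Sum>k\<in>{2..N}. y ^ k) * (1 / 2) \<le> (\<Sum>k\<in>{2..N}. y ^ k) * (1 - y)"
        using y by (intro mult_left_mono sum_nonneg) auto
      ultimately have s: "(\<Sum>k\<in>{2..N}. y ^ k) \<le> 2 * y\<^sup>2" by linarith
      have "ln (real q) = 2 * ln (sqrt (real q))" using q by (simp add: ln_sqrt)
      also have "\<dots> \<le> 2 * sqrt (real q)"
        using q ln_le_minus_one[of "sqrt (real q)"] by simp
      finally have "ln (real q) * (\<Sum>k\<in>{2..N}. y ^ k) \<le> 2 * sqrt (real q) * (2 * y\<^sup>2)"
        using s q y by (intro mult_mono sum_nonneg) auto
      also have "\<dots> = 4 * (1 / real q powr (3/2))"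
      proof -
        have "real q powr (3/2) = real q powr (1 + 1/2)" by simp
        also have "\<dots> = real q * sqrt (real q)" using q unfolding powr_add by (simp add: powr_half_sqrt)
        finally have *: "real q powr (3/2) = real q * sqrt (real q)" .
        have "sqrt (real q) * sqrt (real q) = real q" "sqrt (real q) > 0" using q by auto
        thus ?thesis unfolding * y_def using q by (simp add: power2_eq_square divide_simps)
      qed
      finally show "ln (real q) * (\<Sum>k\<in>{2..N}. (1 / real q) ^ k) \<le> 4 * (1 / real q powr (3/2))"
        unfolding y_def .
    qed
    also have "\<dots> \<le> (\<Sum>q<Suc N. 4 * (1 / real q powr (3/2)))" by (intro sum_mono2) auto
    also have "\<dots> \<le> C" by (rule C)
    finally show ?thesis .
  qed
  thus ?thesis by blast
qed

section \<open>Primes with prescribed values of real characters\<close>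

definition mertens_sum :: "(nat \<Rightarrow> real) \<Rightarrow> nat \<Rightarrow> real" where
  "mertens_sum \<psi> N = (\<Sum>l | l \<in> {1..N} \<and> prime l. \<psi> l * (ln (real l) / real l))"

lemma mangoldt_sum_split:
  "(\<Sum>d\<in>{1..N}. \<psi> d * mangoldt d / d) = mertens_sum \<psi> N +
     (\<Sum>d | d \<in> {1..N} \<and> \<not> prime d. \<psi> d * mangoldt d / d)"
proof -
  have "(\<Sum>d\<in>{1..N}. \<psi> d * mangoldt d / d) =
    (\<Sum>d\<in>{d. d \<in> {1..N} \<and> prime d} \<union> {d. d \<in> {1..N} \<and> \<not> prime d}. \<psi> d * mangoldt d / d)"
    by (intro sum.cong) auto
  also have "\<dots> = (\<Sum>d | d \<in> {1..N} \<and> prime d. \<psi> d * mangoldt d / d) +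
     (\<Sum>d | d \<in> {1..N} \<and> \<not> prime d. \<psi> d * mangoldt d / d)"
    by (intro sum.union_disjoint) auto
  finally show ?thesis by (simp add: mertens_sum_def)
qed

lemma mertens_sum_nonprincipal:
  assumes \<psi>: "real_char m \<psi>" "m > 0" "\<psi> g = -1"
  shows "\<exists>C. \<forall>N. \<bar>mertens_sum \<psi> N\<bar> \<le> C"
proof -
  obtain C1 where C1: "\<bar>\<Sum>d\<in>{1..N}. \<psi> d * mangoldt d / d\<bar> \<le> C1" for N
    using mertens_nonprincipal[OF \<psi>] by blast
  obtain C2 where C2: "(\<Sum>d | d \<in> {1..N} \<and> \<not> prime d. mangoldt d / d :: real) \<le> C2" for N
    using proper_prime_powers_bound by blast
  have "\<bar>mertens_sum \<psi> N\<bar> \<le> C1 + C2" for N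
  proof -
    have "\<bar>\<Sum>d | d \<in> {1..N} \<and> \<not> prime d. \<psi> d * mangoldt d / d\<bar> \<le> (\<Sum>d | d \<in> {1..N} \<and> \<not> prime d. mangoldt d / d)"
    proof (intro order_trans[OF sum_abs] sum_mono)
      show "\<bar>\<psi> d * mangoldt d / d\<bar> \<le> mangoldt d / d" for d
        using mult_right_mono[of "\<bar>\<psi> d\<bar>" 1 "mangoldt d / d"] real_charD(5)[OF \<psi>(1), of d]
          mangoldt_nonneg[of d] by (simp add: abs_mult)
    qed
    thus ?thesis using C1[of N] C2[of N] mangoldt_sum_split[of \<psi> N] by linarith
  qed
  thus ?thesis by blast
qed

lemma mertens_sum_unbounded: "\<exists>N. mertens_sum (\<lambda>_. 1) N > C"
proof -
  obtain C2 where C2: "(\<Sum>d | d \<in> {1..N} \<and> \<not> prime d. mangoldt d / d :: real) \<le> C2" for N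
    using proper_prime_powers_bound by blast
  obtain N where "(\<Sum>d\<in>{1..N}. mangoldt d / d :: real) > C + C2" using mangoldt_over_unbounded by blast
  thus ?thesis using C2[of N] mangoldt_sum_split[of "\<lambda>_. 1" N] by (intro exI[of _ N]) simp
qed

text \<open>
  Expand \<open>\<Prod>\<psi>\<in>I. 1 + \<psi>(n) \<psi>(l)\<close>, which is nonzero exactly if \<open>\<psi>(l) = \<psi>(n)\<close> for all \<open>\<psi>\<close> in \<open>I\<close>,
  into the characters \<open>\<Psi> T\<close>, the products over subsets \<open>T\<close>, and sum it over primes with weight
  \<open>ln l / l\<close>.  The nonprincipal \<open>\<Psi> T\<close> contribute bounded amounts and the principal ones nonnegative
  amounts, because \<open>\<Psi> T n = 1\<close> for them; the empty \<open>T\<close> contributes an unbounded amount.  So no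
  independence of the characters has to be assumed: it is enough that the prescribed values are
  those at some \<open>n\<close>.
\<close>

theorem prime_with_real_characters:
  fixes I :: "(nat \<Rightarrow> real) set"
  assumes I: "finite I" "\<And>\<psi>. \<psi> \<in> I \<Longrightarrow> real_char m \<psi>" and m: "m > 0" and n: "coprime n m"
  shows "\<exists>l. prime l \<and> coprime l m \<and> (\<forall>\<psi>\<in>I. \<psi> l = \<psi> n)"
proof (rule ccontr)
  assume none: "\<not> ?thesis"
  define \<Psi> where "\<Psi> T a = (if coprime a m then \<Prod>\<psi>\<in>T. \<psi> a else 0)" for T :: "(nat \<Rightarrow> real) set" and a
  have \<Psi>: "real_char m (\<Psi> T)" if "T \<subseteq> I" for T
  proof -
    have char: "real_char m \<psi>" if "\<psi> \<in> T" for \<psi> using \<open>T \<subseteq> I\<close> that I(2) by blast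
    have fin: "finite T" using that I(1) finite_subset by blast
    have pm: "(\<Prod>\<psi>\<in>T. \<psi> a) \<in> {-1, 1}" if "coprime a m" for a
    proof -
      have "\<psi> a \<in> {-1, 1}" if "\<psi> \<in> T" for \<psi>
        using real_charD(3,4)[OF char[OF that], of a] \<open>coprime a m\<close> by auto
      with fin show ?thesis by (induction T rule: finite_induct) force+
    qed
    show ?thesis unfolding real_char_def
    proof (intro conjI allI)
      show "\<Psi> T (a * b) = \<Psi> T a * \<Psi> T b" for a b
      proof -
        have "(\<Prod>\<psi>\<in>T. \<psi> (a * b)) = (\<Prod>\<psi>\<in>T. \<psi> a * \<psi> b)"
          by (intro prod.cong refl) (rule real_charD(1)[OF char])
        thus ?thesis by (simp add: \<Psi>_def prod.distrib)
      qed
      show "\<Psi> T (a mod m) = \<Psi> T a" for a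
      proof -
        have "(\<Prod>\<psi>\<in>T. \<psi> (a mod m)) = (\<Prod>\<psi>\<in>T. \<psi> a)"
          by (intro prod.cong refl) (rule real_charD(2)[OF char])
        thus ?thesis using m by (simp add: \<Psi>_def)
      qed
      show "\<Psi> T a \<in> {-1, 0, 1}" for a using pm[of a] by (auto simp: \<Psi>_def)
      show "\<Psi> T a \<noteq> 0 \<longleftrightarrow> coprime a m" for a using pm[of a] by (auto simp: \<Psi>_def)
    qed
  qed
  have zero: "(\<Sum>T\<in>Pow I. \<Psi> T n * \<Psi> T l) = 0" if "prime l" for l
  proof (cases "coprime l m")
    case True
    then obtain \<psi> where \<psi>: "\<psi> \<in> I" "\<psi> l \<noteq> \<psi> n" using none \<open>prime l\<close> by blast
    have "\<psi> l \<in> {-1, 1}" "\<psi> n \<in> {-1, 1}"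
      using real_charD(3,4)[OF I(2)[OF \<psi>(1)]] True n by auto
    hence "1 + \<psi> n * \<psi> l = 0" using \<psi>(2) by auto
    hence "0 = (\<Prod>\<psi>\<in>I. 1 + \<psi> n * \<psi> l)" using \<psi>(1) I(1) by (metis prod_zero)
    also have "\<dots> = (\<Sum>T\<in>Pow I. \<Psi> T n * \<Psi> T l)"
      using prod_add[OF I(1), of "\<lambda>\<psi>. \<psi> n * \<psi> l" "\<lambda>_. 1"] True n
      by (simp add: \<Psi>_def prod.distrib add.commute)
    finally show ?thesis by simp
  qed (simp add: \<Psi>_def)
  have "\<exists>C. \<forall>N. \<Psi> T n * mertens_sum (\<Psi> T) N \<ge> C" if T: "T \<in> Pow I" for T
  proof (cases "\<exists>g. \<Psi> T g = -1")
    case True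
    then obtain C where C: "\<bar>mertens_sum (\<Psi> T) N\<bar> \<le> C" for N
      using mertens_sum_nonprincipal[OF \<Psi> m] T by blast
    have "- C \<le> \<Psi> T n * mertens_sum (\<Psi> T) N" for N
    proof -
      have "\<bar>\<Psi> T n * mertens_sum (\<Psi> T) N\<bar> \<le> 1 * C"
        unfolding abs_mult using C[of N] real_charD(5)[OF \<Psi>, of T n] T by (intro mult_mono) auto
      thus ?thesis by linarith
    qed
    thus ?thesis by blast
  next
    case False
    hence "\<Psi> T a \<ge> 0" for a using real_charD(3)[OF \<Psi>, of T a] T by auto
    hence "0 \<le> \<Psi> T n * mertens_sum (\<Psi> T) N" for N
      unfolding mertens_sum_def by (intro mult_nonneg_nonneg sum_nonneg) auto
    thus ?thesis by blast
  qed
  then obtain C where C: "\<And>T N. T \<in> Pow I \<Longrightarrow> \<Psi> T n * mertens_sum (\<Psi> T) N \<ge> C T" by metis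
  have fin: "finite (Pow I)" using I by simp
  have "mertens_sum (\<lambda>_. 1) N \<le> mertens_sum (\<lambda>_. 1) m - (\<Sum>T\<in>Pow I - {{}}. C T)" for N
  proof -
    have "0 = (\<Sum>l | l \<in> {1..N} \<and> prime l. (\<Sum>T\<in>Pow I. \<Psi> T n * \<Psi> T l) * (ln (real l) / real l))"
      using zero by simp
    also have "\<dots> = (\<Sum>T\<in>Pow I. \<Psi> T n * mertens_sum (\<Psi> T) N)"
      unfolding mertens_sum_def sum_distrib_right sum_distrib_left
      by (subst sum.swap) (simp add: mult_ac)
    also have "\<dots> = \<Psi> {} n * mertens_sum (\<Psi> {}) N + (\<Sum>T\<in>Pow I - {{}}. \<Psi> T n * mertens_sum (\<Psi> T) N)"
      using fin by (intro sum.remove) auto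
    also have "\<dots> \<ge> mertens_sum (\<Psi> {}) N + (\<Sum>T\<in>Pow I - {{}}. C T)"
      using C n by (intro add_mono sum_mono) (auto simp: \<Psi>_def)
    finally have 1: "mertens_sum (\<Psi> {}) N \<le> - (\<Sum>T\<in>Pow I - {{}}. C T)" by simp
    have "mertens_sum (\<lambda>_. 1) N - mertens_sum (\<Psi> {}) N =
        (\<Sum>l | l \<in> {1..N} \<and> prime l. (1 - \<Psi> {} l) * (ln (real l) / real l))"
      unfolding mertens_sum_def sum_subtractf[symmetric] by (simp add: left_diff_distrib diff_divide_distrib)
    also have "\<dots> = (\<Sum>l | l \<in> {1..N} \<and> prime l \<and> \<not> coprime l m. 1 * (ln (real l) / real l))"
      by (intro sum.mono_neutral_cong_right) (auto simp: \<Psi>_def)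
    also have "\<dots> \<le> (\<Sum>l | l \<in> {1..m} \<and> prime l. 1 * (ln (real l) / real l))"
      using m by (intro sum_mono2) (auto simp: prime_imp_coprime_nat intro: dvd_imp_le prime_imp_coprime)
    finally show ?thesis using 1 by (simp add: mertens_sum_def)
  qed
  thus False using mertens_sum_unbounded not_less by blast
qed

section \<open>Legendre symbols and ternary quadratic forms\<close>

lemma Legendre_cong:
  assumes "[a = b] (mod p)"
  shows "Legendre a p = Legendre b p"
proof -
  have "QuadRes p a \<longleftrightarrow> QuadRes p b" "[a = 0] (mod p) \<longleftrightarrow> [b = 0] (mod p)"
    unfolding QuadRes_def using assms by (metis cong_sym cong_trans)+
  thus ?thesis unfolding Legendre_def by simp
qed

lemma Legendre_values: "Legendre a p \<in> {-1, 0, 1}"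
  unfolding Legendre_def by simp

lemma Legendre_eq_0_iff: "Legendre a p = 0 \<longleftrightarrow> p dvd a"
  unfolding Legendre_def by (simp add: cong_0_iff)

lemma Legendre_mult:
  fixes q :: nat
  assumes "prime q" "q > 2"
  shows "Legendre (a * b) q = Legendre a q * Legendre b q"
proof -
  have "[Legendre (a * b) q = (a * b) ^ ((q - 1) div 2)] (mod q)"
    using euler_criterion[OF assms] .
  moreover have "[Legendre a q * Legendre b q = a ^ ((q - 1) div 2) * b ^ ((q - 1) div 2)] (mod q)"
    using euler_criterion[OF assms] by (intro cong_mult)
  ultimately have "[Legendre (a * b) q = Legendre a q * Legendre b q] (mod q)"
    by (simp only: power_mult_distrib) (metis cong_sym cong_trans)
  hence dvd: "int q dvd Legendre (a * b) q - Legendre a q * Legendre b q"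
    by (simp add: cong_iff_dvd_diff)
  have "\<bar>Legendre (a * b) q - Legendre a q * Legendre b q\<bar> < int q"
    using Legendre_values[of "a * b" q] Legendre_values[of a q] Legendre_values[of b q] assms(2) by auto
  thus ?thesis using dvd_imp_le_int[OF _ dvd] by force
qed

lemma Legendre_square:
  fixes q :: nat
  assumes "prime q" "\<not> int q dvd a"
  shows "Legendre (a\<^sup>2) q = 1"
proof -
  have "\<not> int q dvd a\<^sup>2" using assms prime_dvd_power[of "int q"] by auto
  moreover have "QuadRes q (a\<^sup>2)" unfolding QuadRes_def using cong_refl by blast
  ultimately show ?thesis by (simp add: Legendre_def cong_0_iff)
qed

lemma Legendre_eq_1_D: "Legendre a p = 1 \<Longrightarrow> \<exists>r. p dvd r\<^sup>2 - a"
  by (auto simp: Legendre_def QuadRes_def cong_iff_dvd_diff split: if_splits)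

lemma Legendre_recip:
  fixes q l :: nat
  assumes "prime q" "prime l" "q > 2" "l mod 4 = 1" "q \<noteq> l"
  shows "Legendre q l = Legendre l q"
proof -
  have l2: "l > 2" using assms(2,4) prime_ge_2_nat[of l] by (cases "l = 2") auto
  have "even ((l - 1) div 2)" using assms(4) by presburger
  hence "Legendre q l * Legendre l q = 1"
    using Quadratic_Reciprocity[OF assms(1,3,2) l2 assms(5)] by simp
  thus ?thesis using Legendre_values[of q l] Legendre_values[of l q] by auto
qed

text \<open>
  Gauss's lemma: of the numbers \<open>2, 4, \<dots>, l - 1\<close>, those above \<open>l / 2\<close> are even in number if
  \<open>l mod 8 = 1\<close>.
\<close>

lemma Legendre_2:
  fixes l :: nat
  assumes "prime l" "l mod 8 = 1"
  shows "Legendre 2 l = 1"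
proof -
  obtain k where k: "l = 8 * k + 1" using assms(2) by (metis mod_div_decomp mult.commute)
  have l2: "l > 2" using assms prime_ge_2_nat[of l] by (cases "l = 2") auto
  have k0: "k > 0" using l2 k by (cases k) auto
  interpret GAUSS l 2
    using assms l2 by unfold_locales (auto simp: cong_def zdvd_not_zless cong_0_iff)
  have A: "A = {0<..4 * int k}" unfolding A_def using k by simp
  have "E = (\<lambda>x. 2 * x) ` {2 * int k<..4 * int k}"
  proof (intro equalityI subsetI)
    fix y assume "y \<in> E"
    then obtain x where x: "x \<in> {0<..4 * int k}" "y = x * 2 mod int l" "y > (int l - 1) div 2"
      unfolding E_def C_def B_def A by auto
    have "x * 2 mod int l = x * 2" using x(1) k by simp
    thus "y \<in> (\<lambda>x. 2 * x) ` {2 * int k<..4 * int k}" using x k by auto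
  next
    fix y assume "y \<in> (\<lambda>x. 2 * x) ` {2 * int k<..4 * int k}"
    then obtain x where x: "2 * int k < x" "x \<le> 4 * int k" "y = 2 * x" by auto
    have "x * 2 mod int l = x * 2" using x k by simp
    moreover have "x \<in> {0<..4 * int k}" using x by auto
    ultimately have "y \<in> C" unfolding C_def B_def A using x(3) by (force simp: mult.commute)
    thus "y \<in> E" unfolding E_def using x k by auto
  qed
  hence "card E = 2 * k" by (simp add: card_image inj_on_def)
  thus ?thesis using gauss_lemma by simp
qed

lemma Legendre_agree:
  fixes n l d :: nat
  assumes "prime l" "l > 2" "prime d" "d > 2" "n > 0"
    and "\<And>q. prime q \<Longrightarrow> q dvd n \<Longrightarrow> Legendre q l = Legendre q d"
  shows "Legendre n l = Legendre n d"
  using assms(5,6)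
proof (induction n rule: less_induct)
  case (less n)
  show ?case
  proof (cases "n = 1")
    case True
    have "Legendre 1 l = 1" "Legendre 1 d = 1" using Legendre_square[of l 1] Legendre_square[of d 1] assms by (auto dest: prime_gt_1_nat)
    thus ?thesis using True by simp
  next
    case False
    then obtain q where q: "prime q" "q dvd n" using prime_factor_nat by blast
    then obtain s where s: "n = q * s" by blast
    have "s > 0" using s less.prems by (cases s) auto
    moreover have "s < n" using s \<open>s > 0\<close> prime_gt_1_nat[OF q(1)] by simp
    ultimately    have "Legendre s l = Legendre s d" using less.IH[of s] less.prems s by auto
    thus ?thesis using less.prems(2)[OF q] s Legendre_mult[OF assms(1,2)] Legendre_mult[OF assms(3,4)] by simp
  qed
qed

lemma root_mod_coprime:
  fixes a b c :: int
  assumes "coprime a b" "a dvd x\<^sup>2 - c" "b dvd y\<^sup>2 - c"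
  shows "\<exists>r. a * b dvd r\<^sup>2 - c"
proof -
  obtain r where r: "[r = x] (mod a)" "[r = y] (mod b)"
    using binary_chinese_remainder_int[OF assms(1)] by blast
  have "[r\<^sup>2 - c = x\<^sup>2 - c] (mod a)" "[r\<^sup>2 - c = y\<^sup>2 - c] (mod b)"
    using r by (auto intro!: cong_diff cong_pow)
  hence "a dvd r\<^sup>2 - c" "b dvd r\<^sup>2 - c" using assms(2,3) cong_dvd_iff by blast+
  thus ?thesis using assms(1) divides_mult by blast
qed

text \<open>
  Square roots modulo the prime factors are glued by the Chinese remainder theorem.
\<close>

lemma root_mod_squarefree:
  fixes n :: nat and c :: int
  assumes "squarefree n" "\<And>q. prime q \<Longrightarrow> q dvd n \<Longrightarrow> \<exists>r. int q dvd r\<^sup>2 - c"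
  shows "\<exists>r. int n dvd r\<^sup>2 - c"
  using assms
proof (induction n rule: less_induct)
  case (less n)
  have n0: "n > 0" using less.prems(1) by (intro Nat.gr0I) auto
  show ?case
  proof (cases "n = 1")
    case False
    then obtain q where q: "prime q" "q dvd n" using prime_factor_nat by blast
    then obtain s where s: "n = q * s" by blast
    have "s > 0" using s n0 by (cases s) auto
    hence sn: "s < n" using s prime_gt_1_nat[OF q(1)] by simp
    have sf: "squarefree s" using less.prems(1) s squarefree_mono[of s n] by auto
    have "\<not> q dvd s"
    proof
      assume "q dvd s"
      hence "q\<^sup>2 dvd n" unfolding s power2_eq_square by simp
      thus False using less.prems(1) q(1) unfolding squarefree_def by (metis not_prime_unit)
    qed
    hence "coprime (int q) (int s)" using q(1) prime_imp_coprime by simp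
    moreover obtain x where "int s dvd x\<^sup>2 - c" using less.IH[OF sn sf] less.prems(2) s by auto
    moreover obtain y where "int q dvd y\<^sup>2 - c" using less.prems(2)[OF q] by blast
    ultimately show ?thesis using root_mod_coprime[of "int q" "int s"] s by fastforce
  qed auto
qed

text \<open>
  Legendre's theorem.  The congruences \<open>b y \<equiv> r z\<close> modulo \<open>a\<close>, \<open>a x \<equiv> s z\<close> modulo \<open>b\<close> and
  \<open>a x \<equiv> t y\<close> modulo \<open>c\<close> make the form divisible by \<open>a b c\<close>.  By the pigeonhole principle they have a
  nonzero solution in the box \<open>x^2 \<le> b c, y^2 \<le> a c, z^2 \<le> a b\<close>, and there the form can only
  be 0 or \<open>- a b c\<close>: the other multiples on the boundary of the box are excluded because the prime
  \<open>c\<close> divides neither \<open>a\<close> nor \<open>b\<close>.  In the second case a composition identity yields a zero.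
\<close>

lemma legendre_form_zero:
  fixes a b c r s t :: int
  assumes pos: "a > 0" "b > 0" "c > 0" and cop: "coprime a b" and c: "prime c" "\<not> c dvd a" "\<not> c dvd b"
    and res: "a dvd r\<^sup>2 + b * c" "b dvd s\<^sup>2 - a * c" "c dvd t\<^sup>2 - a * b"
  shows "\<exists>x y z. (x, y, z) \<noteq> (0, 0, 0) \<and> a * x\<^sup>2 = b * y\<^sup>2 + c * z\<^sup>2"
proof -
  define R where "R n = int (floor_sqrt (nat n))" for n
  have R: "R n \<ge> 0" "(R n)\<^sup>2 \<le> n" "n < (R n + 1)\<^sup>2" if "n > 0" for n
  proof -
    show "R n \<ge> 0" by (simp add: R_def)
    have "(floor_sqrt (nat n))\<^sup>2 \<le> nat n" by simp
    hence "int ((floor_sqrt (nat n))\<^sup>2) \<le> int (nat n)" by (simp only: of_nat_le_iff)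
    thus "(R n)\<^sup>2 \<le> n" using that by (simp add: R_def)
    have "nat n < (Suc (floor_sqrt (nat n)))\<^sup>2" by (rule Suc_floor_sqrt_power2_gt)
    hence "int (nat n) < int ((Suc (floor_sqrt (nat n)))\<^sup>2)" by (simp only: of_nat_less_iff)
    thus "n < (R n + 1)\<^sup>2" using that by (simp add: R_def add.commute)
  qed
  define Box where "Box = {0..R (b * c)} \<times> {0..R (a * c)} \<times> {0..R (a * b)}"
  define Res where "Res = {0..<a} \<times> {0..<b} \<times> {0..<c}"
  define f where "f = (\<lambda>(x, y, z). ((b * y - r * z) mod a, (a * x - s * z) mod b, (a * x - t * y) mod c))"
  have "f ` Box \<subseteq> Res" using pos by (auto simp: f_def Res_def)
  moreover have "card Res < card Box"
  proof -
    have p: "0 < b * c" "0 < a * c" "0 < a * b" using pos by auto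
    hence r: "R (b * c) + 1 \<noteq> 0" "R (a * c) + 1 \<noteq> 0" "R (a * b) + 1 \<noteq> 0"
      using R(1)[of "b * c"] R(1)[of "a * c"] R(1)[of "a * b"] by linarith+
    have "(a * b * c)\<^sup>2 = (b * c) * (a * c) * (a * b)" by (simp add: power2_eq_square mult_ac)
    also have "\<dots> < (R (b * c) + 1)\<^sup>2 * (R (a * c) + 1)\<^sup>2 * (R (a * b) + 1)\<^sup>2"
      using R(3)[of "b * c"] R(3)[of "a * c"] R(3)[of "a * b"] p r
      by (intro mult_strict_mono mult_pos_pos) (auto simp: less_imp_le)
    also have "\<dots> = ((R (b * c) + 1) * (R (a * c) + 1) * (R (a * b) + 1))\<^sup>2"
      by (simp add: power_mult_distrib)
    finally have "a * b * c < (R (b * c) + 1) * (R (a * c) + 1) * (R (a * b) + 1)"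
      using R(1)[of "b * c"] R(1)[of "a * c"] R(1)[of "a * b"] pos by (intro power2_less_imp_less[of "a * b * c"]) auto
    moreover have "int (card Res) = a * b * c" unfolding Res_def using pos by (simp add: card_cartesian_product)
    moreover have "int (card Box) = (R (b * c) + 1) * (R (a * c) + 1) * (R (a * b) + 1)"
      unfolding Box_def using R(1) pos by (simp add: card_cartesian_product)
    ultimately show ?thesis by linarith
  qed
  ultimately have "\<not> inj_on f Box"
    using card_inj_on_le[of f Box Res] by (auto simp: Res_def)
  then obtain v v' where v: "v \<in> Box" "v' \<in> Box" "f v = f v'" "v \<noteq> v'" unfolding inj_on_def by blast
  obtain x1 y1 z1 where v1: "v = (x1, y1, z1)" by (cases v) auto
  obtain x2 y2 z2 where v2: "v' = (x2, y2, z2)" by (cases v') auto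
  define x y z where "x = x1 - x2" and "y = y1 - y2" and "z = z1 - z2"
  have nz: "(x, y, z) \<noteq> (0, 0, 0)" using v(4) v1 v2 by (auto simp: x_def y_def z_def)
  have sq: "w\<^sup>2 \<le> n" if "\<bar>w\<bar> \<le> R n" "n > 0" for w n
  proof -
    have "\<bar>w\<bar>\<^sup>2 \<le> (R n)\<^sup>2" using that(1) by (intro power_mono) auto
    thus ?thesis using R(2)[OF that(2)] by simp
  qed
  have x: "x\<^sup>2 \<le> b * c" and y: "y\<^sup>2 \<le> a * c" and z: "z\<^sup>2 \<le> a * b"
    using v(1,2) pos unfolding v1 v2 Box_def x_def y_def z_def by (auto intro!: sq)
  have 1: "a dvd b * y - r * z" and 2: "b dvd a * x - s * z" and 3: "c dvd a * x - t * y"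
  proof -
    have "(b * y1 - r * z1) mod a = (b * y2 - r * z2) mod a" "(a * x1 - s * z1) mod b = (a * x2 - s * z2) mod b"
       "(a * x1 - t * y1) mod c = (a * x2 - t * y2) mod c" using v(3) unfolding v1 v2 f_def by auto
    thus "a dvd b * y - r * z" "b dvd a * x - s * z" "c dvd a * x - t * y"
      unfolding mod_eq_dvd_iff x_def y_def z_def by (simp_all add: algebra_simps)
  qed
  define F where "F = a * x\<^sup>2 - b * y\<^sup>2 - c * z\<^sup>2"
  have dva: "a dvd F"
  proof -
    have "b * (b * y\<^sup>2 + c * z\<^sup>2) = (b * y - r * z) * (b * y + r * z) + (r\<^sup>2 + b * c) * z\<^sup>2"
      by (simp add: power2_eq_square algebra_simps)
    hence "a dvd b * (b * y\<^sup>2 + c * z\<^sup>2)" using 1 res(1) by simp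
    hence "a dvd b * y\<^sup>2 + c * z\<^sup>2" using cop by (simp add: coprime_dvd_mult_right_iff)
    thus ?thesis unfolding F_def diff_diff_eq by simp
  qed
  have dvb: "b dvd F"
  proof -
    have "a * (a * x\<^sup>2 - c * z\<^sup>2) = (a * x - s * z) * (a * x + s * z) + (s\<^sup>2 - a * c) * z\<^sup>2"
      by (simp add: power2_eq_square algebra_simps)
    hence "b dvd a * (a * x\<^sup>2 - c * z\<^sup>2)" using 2 res(2) by simp
    hence "b dvd a * x\<^sup>2 - c * z\<^sup>2" using cop by (simp add: coprime_dvd_mult_right_iff coprime_commute)
    moreover have "F = (a * x\<^sup>2 - c * z\<^sup>2) - b * y\<^sup>2" by (simp add: F_def)
    ultimately show ?thesis by simp
  qed
  have cop': "coprime a c" "coprime b c" using c prime_imp_coprime coprime_commute by blast+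
  have dvc: "c dvd F"
  proof -
    have "a * (a * x\<^sup>2 - b * y\<^sup>2) = (a * x - t * y) * (a * x + t * y) + (t\<^sup>2 - a * b) * y\<^sup>2"
      by (simp add: power2_eq_square algebra_simps)
    hence "c dvd a * (a * x\<^sup>2 - b * y\<^sup>2)" using 3 res(3) by simp
    hence "c dvd a * x\<^sup>2 - b * y\<^sup>2" using cop' by (simp add: coprime_dvd_mult_right_iff coprime_commute)
    thus ?thesis by (simp add: F_def)
  qed
  have "a * b dvd F" using dva dvb cop divides_mult by blast
  hence "a * b * c dvd F" using dvc cop' divides_mult by (metis coprime_mult_left_iff)
  then obtain k where k: "F = a * b * c * k" by blast
  have nonsq: "w\<^sup>2 \<noteq> e * c" if "\<not> c dvd e" for w e
  proof
    assume "w\<^sup>2 = e * c"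
    hence "c dvd w" using c(1) prime_dvd_power by (metis dvd_triv_right)
    hence "c * c dvd w\<^sup>2" unfolding power2_eq_square by (intro mult_dvd_mono)
    thus False using \<open>w\<^sup>2 = e * c\<close> that pos by simp
  qed
  have "F < a * b * c"
  proof -
    have "x\<^sup>2 < b * c" using x nonsq[OF c(3), of x] by linarith
    hence "a * x\<^sup>2 < a * (b * c)" using pos by (intro mult_strict_left_mono)
    moreover have "0 \<le> b * y\<^sup>2" "0 \<le> c * z\<^sup>2" using pos by auto
    ultimately show ?thesis unfolding F_def by (simp add: mult_ac)
  qed
  moreover have "F > -2 * (a * b * c)"
  proof -
    have "y\<^sup>2 < a * c" using y nonsq[OF c(2), of y] by linarith
    hence "b * y\<^sup>2 < b * (a * c)" using pos by (intro mult_strict_left_mono)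
    moreover have "c * z\<^sup>2 \<le> c * (a * b)" using z pos by (intro mult_left_mono) auto
    moreover have "0 \<le> a * x\<^sup>2" using pos by auto
    ultimately show ?thesis unfolding F_def by (simp add: mult_ac)
  qed
  ultimately have "a * b * c * k < a * b * c * 1" "a * b * c * (-2) < a * b * c * k" using k by linarith+
  moreover have "a * b * c > 0" using pos by simp
  ultimately have "k < 1" "-2 < k" by (simp_all only: mult_less_cancel_left_pos)
  hence "k = 0 \<or> k = -1" by linarith
  thus ?thesis
  proof
    assume "k = 0"
    thus ?thesis using k nz unfolding F_def by (intro exI[of _ x] exI[of _ y] exI[of _ z]) simp
  next
    assume "k = -1"
    hence eq: "b * y\<^sup>2 + c * z\<^sup>2 = a * (x\<^sup>2 + b * c)" using k unfolding F_def by (simp add: algebra_simps)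
    have "b * (x * y + c * z)\<^sup>2 + c * (x * z - b * y)\<^sup>2 = (b * y\<^sup>2 + c * z\<^sup>2) * (x\<^sup>2 + b * c)"
      by (simp add: power2_eq_square algebra_simps)
    also have "\<dots> = a * (x\<^sup>2 + b * c)\<^sup>2" unfolding eq by (simp add: power2_eq_square)
    finally have "a * (x\<^sup>2 + b * c)\<^sup>2 = b * (x * y + c * z)\<^sup>2 + c * (x * z - b * y)\<^sup>2" by simp
    moreover have "x\<^sup>2 + b * c > 0" using pos by (simp add: add_nonneg_pos)
    ultimately show ?thesis
      by (intro exI[of _ "x\<^sup>2 + b * c"] exI[of _ "x * y + c * z"] exI[of _ "x * z - b * y"]) auto
  qed
qed

section \<open>Primes with prescribed Legendre symbols\<close>

text \<open>
  The nonprincipal characters modulo 4 and modulo 8 that send \<open>l\<close> to \<open>(-1/l)\<close> and \<open>(2/l)\<close>; together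
  they determine an odd number modulo 8.
\<close>

definition chi4 :: "nat \<Rightarrow> real" where
  "chi4 n = (if n mod 8 \<in> {1, 5} then 1 else if n mod 8 \<in> {3, 7} then -1 else 0)"

definition chi8 :: "nat \<Rightarrow> real" where
  "chi8 n = (if n mod 8 \<in> {1, 7} then 1 else if n mod 8 \<in> {3, 5} then -1 else 0)"

lemma coprime_8_iff: "coprime n (8::nat) \<longleftrightarrow> odd n"
proof -
  have "coprime n (2 ^ 3) \<longleftrightarrow> odd n" by (subst coprime_power_right_iff) simp
  thus ?thesis by simp
qed

lemma real_char_8: "real_char 8 chi4" "real_char 8 chi8"
proof -
  have r: "n mod 8 \<in> {0,1,2,3,4,5,6,7}" for n :: nat by auto
  have c: "coprime n 8 \<longleftrightarrow> n mod 8 \<in> {1,3,5,7}" for n :: nat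
    unfolding coprime_8_iff using r[of n] by auto presburger+
  have "chi4 (x * y) = chi4 x * chi4 y" "chi8 (x * y) = chi8 x * chi8 y"
    if "x \<in> {0,1,2,3,4,5,6,7}" "y \<in> {0,1,2,3,4,5,6,7}" for x y
    using that unfolding insert_iff empty_iff by (elim disjE; simp add: chi4_def chi8_def)+
  note tab = this
  have mod: "chi4 (n mod 8) = chi4 n" "chi8 (n mod 8) = chi8 n" for n
    by (simp_all add: chi4_def chi8_def)
  have "chi4 (a * b) = chi4 a * chi4 b" "chi8 (a * b) = chi8 a * chi8 b" for a b
  proof -
    have "chi4 (a * b) = chi4 ((a mod 8) * (b mod 8))" "chi8 (a * b) = chi8 ((a mod 8) * (b mod 8))"
      using mod(1)[of "a * b"] mod(1)[of "(a mod 8) * (b mod 8)"] mod(2)[of "a * b"]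
        mod(2)[of "(a mod 8) * (b mod 8)"] by (simp_all add: mod_mult_eq)
    thus "chi4 (a * b) = chi4 a * chi4 b" "chi8 (a * b) = chi8 a * chi8 b"
      using tab[OF r r] mod by simp_all
  qed
  thus "real_char 8 chi4" "real_char 8 chi8"
    unfolding real_char_def c by (auto simp: chi4_def chi8_def)
qed

lemma chi_determine: "chi4 l = chi4 n \<Longrightarrow> chi8 l = chi8 n \<Longrightarrow> odd n \<Longrightarrow> l mod 8 = n mod 8"
proof -
  assume a: "chi4 l = chi4 n" "chi8 l = chi8 n" "odd n"
  have r: "k mod 8 \<in> {0,1,2,3,4,5,6,7}" for k :: nat by auto
  have "n mod 8 \<in> {1,3,5,7}" using a(3) r[of n] by auto presburger+
  thus ?thesis using a(1,2) r[of l] unfolding chi4_def chi8_def by auto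
qed

lemma real_char_Legendre:
  fixes q :: nat
  assumes "prime q" "q > 2"
  shows "real_char q (\<lambda>n. of_int (Legendre (int n) (int q)))"
  unfolding real_char_def
proof (intro conjI allI)
  show "real_of_int (Legendre (int (a mod q)) q) = of_int (Legendre a q)" for a
    using Legendre_cong[of "int (a mod q)" "int a" "int q"] by (simp add: zmod_int)
  show "(real_of_int (Legendre a q) \<noteq> 0) = coprime a q" for a :: nat
  proof -
    have "coprime a q \<longleftrightarrow> \<not> q dvd a"
      using assms(1) by (metis coprime_commute prime_imp_coprime coprime_absorb_left not_prime_unit)
    thus ?thesis by (simp add: Legendre_eq_0_iff)
  qed
  show "real_of_int (Legendre (int (a * b)) q) = of_int (Legendre a q) * of_int (Legendre b q)" for a b :: nat
    by (simp add: Legendre_mult[OF assms])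
  show "real_of_int (Legendre a q) \<in> {-1, 0, 1}" for a :: nat
    using Legendre_values[of a q] by auto
qed

lemma real_char_lift:
  assumes "real_char m' \<psi>" "m' dvd m"
  shows "real_char m (\<lambda>a. if coprime a m then \<psi> a else 0)"
  unfolding real_char_def
proof (intro conjI allI)
  show "(if coprime (a * b) m then \<psi> (a * b) else 0) =
      (if coprime a m then \<psi> a else 0) * (if coprime b m then \<psi> b else 0)" for a b
    using real_charD(1)[OF assms(1), of a b] by (simp add: coprime_mult_left_iff)
  show "(if coprime (a mod m) m then \<psi> (a mod m) else 0) = (if coprime a m then \<psi> a else 0)" for a
  proof -
    have "\<psi> (a mod m) = \<psi> (a mod m mod m')" by (rule real_charD(2)[OF assms(1), symmetric])
    also have "\<dots> = \<psi> (a mod m')" using assms(2) by (simp add: mod_mod_cancel)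
    also have "\<dots> = \<psi> a" by (rule real_charD(2)[OF assms(1)])
    finally show ?thesis by (cases "m = 0") simp_all
  qed
  show "(if coprime a m then \<psi> a else 0) \<in> {-1, 0, 1}" for a
    using real_charD(3)[OF assms(1), of a] by (cases "coprime a m") simp_all
  show "((if coprime a m then \<psi> a else 0) \<noteq> 0) = coprime a m" for a
  proof (cases "coprime a m")
    case True
    hence "coprime a m'" using coprime_divisors[OF dvd_refl assms(2)] by simp
    thus ?thesis using True real_charD(4)[OF assms(1), of a] by simp
  qed simp
qed

text \<open>
  The case of Dirichlet's theorem that quadratic forms need: only the values of quadratic characters
  are prescribed, so only real characters enter.
\<close>

theorem prime_with_Legendre_symbols:
  fixes Q :: "nat set" and n :: nat
  assumes Q: "finite Q" "\<And>q. q \<in> Q \<Longrightarrow> prime q \<and> q > 2" and n: "coprime n (8 * \<Prod>Q)"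
  obtains l :: nat where "prime l" "l \<notin> Q" "l mod 8 = n mod 8" "\<And>q. q \<in> Q \<Longrightarrow> Legendre l q = Legendre n q"
proof -
  define m where "m = 8 * \<Prod>Q"
  define lift where "lift \<psi> = (\<lambda>a. if coprime a m then \<psi> a else (0 :: real))" for \<psi> :: "nat \<Rightarrow> real"
  define leg where "leg q = (\<lambda>n. real_of_int (Legendre (int n) (int q)))" for q :: nat
  define I where "I = {lift chi4, lift chi8} \<union> (\<lambda>q. lift (leg q)) ` Q"
  have qm: "q dvd m" if "q \<in> Q" for q
    unfolding m_def using dvd_prodI[OF Q(1) that, of "\<lambda>q. q"] by (rule dvd_mult)
  have I: "finite I" using Q(1) by (simp add: I_def)
  have lift: "real_char m (lift \<psi>)" if "real_char m' \<psi>" "m' dvd m" for m' \<psi>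
    unfolding lift_def using real_char_lift[OF that] .
  have leg: "real_char q (leg q)" if "q \<in> Q" for q
    unfolding leg_def using real_char_Legendre[of q] Q(2)[OF that] by simp
  have "8 dvd m" by (simp add: m_def)
  note l48 = lift[OF real_char_8(1) this] lift[OF real_char_8(2) this]
  have chars: "real_char m \<psi>" if "\<psi> \<in> I" for \<psi>
  proof -
    from that consider "\<psi> = lift chi4" | "\<psi> = lift chi8" | q where "q \<in> Q" "\<psi> = lift (leg q)"
      unfolding I_def by (elim UnE insertE emptyE imageE)
    thus ?thesis
    proof cases
      case 3
      show ?thesis unfolding 3(2) by (rule lift[OF leg[OF 3(1)] qm[OF 3(1)]])
    qed (simp_all only: l48)
  qed
  have "\<Prod>Q > 0" using Q(2) by (intro prod_pos) (auto dest: prime_gt_0_nat)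
  hence m0: "m > 0" by (simp add: m_def)
  have nm: "coprime n m" using n by (simp add: m_def)
  obtain l where l: "prime l" "coprime l m" "\<forall>\<psi>\<in>I. \<psi> l = \<psi> n"
    using prime_with_real_characters[OF I chars m0 nm] by auto
  have lQ: "l \<notin> Q"
  proof
    assume "l \<in> Q"
    hence "is_unit l" by (intro coprime_common_divisor[OF l(2) dvd_refl qm])
    thus False using l(1) not_prime_unit by blast
  qed
  have l8: "l mod 8 = n mod 8"
  proof (rule chi_determine)
    have "lift chi4 \<in> I" "lift chi8 \<in> I" by (simp_all add: I_def)
    note bspec[OF l(3) this(1)] bspec[OF l(3) this(2)]
    thus "chi4 l = chi4 n" "chi8 l = chi8 n" using l(2) nm by (simp_all add: lift_def)
    show "odd n" using n by (simp add: coprime_8_iff[symmetric])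
  qed
  have lL: "Legendre l q = Legendre n q" if "q \<in> Q" for q
  proof -
    have "lift (leg q) \<in> I" using that unfolding I_def by (intro UnI2 imageI)
    note bspec[OF l(3) this]
    thus ?thesis using l(2) nm by (simp add: lift_def leg_def)
  qed
  show ?thesis by (rule that[OF l(1) lQ l8 lL])
qed

lemma nonresidue_exists:
  fixes p :: nat
  assumes "prime p" "p > 2"
  obtains c :: nat where "Legendre c p = -1"
proof -
  let ?f = "\<lambda>x. x\<^sup>2 mod p"
  have "?f 1 = ?f (p - 1)"
  proof -
    obtain k where k: "p = k + 2" using assms(2) by (metis add.commute less_imp_add_positive)
    have "(p - 1)\<^sup>2 = 1 + p * k" by (simp add: k power2_eq_square algebra_simps)
    thus ?thesis by (metis mod_mult_self2 power_one)
  qed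
  moreover have "1 \<in> {..<p}" "p - 1 \<in> {..<p}" "1 \<noteq> p - 1" using assms(2) by auto
  ultimately have "\<not> inj_on ?f {..<p}" by (meson inj_onD)
  moreover have "?f ` {..<p} \<subseteq> {..<p}" using assms(2) by auto
  ultimately have "?f ` {..<p} \<noteq> {..<p}" using eq_card_imp_inj_on[of "{..<p}" ?f] by auto
  then obtain c where c: "c < p" "c \<notin> ?f ` {..<p}" using \<open>?f ` {..<p} \<subseteq> {..<p}\<close> by blast
  have "\<not> QuadRes p c"
  proof
    assume "QuadRes p c"
    then obtain y where y: "[y\<^sup>2 = int c] (mod p)" unfolding QuadRes_def by blast
    define x where "x = nat (y mod p)"
    have x: "int x = y mod p" using assms(2) by (simp add: x_def)
    have "int (x\<^sup>2 mod p) = int c"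
      using y c(1) unfolding Cong.cong_def by (simp add: zmod_int x power_mod)
    hence "x\<^sup>2 mod p = c" by linarith
    moreover have "x < p"
    proof -
      have "y mod int p < int p" using assms(2) by (intro pos_mod_bound) simp
      thus ?thesis using x by linarith
    qed
    ultimately show False using c(2) by blast
  qed
  moreover have "\<not> int p dvd int c"
  proof -
    have "?f 0 \<in> ?f ` {..<p}" using assms(2) by (intro imageI) auto
    hence "c \<noteq> 0" using c(2) by (metis mod_0 zero_power2)
    thus ?thesis using c(1) by (simp add: nat_dvd_not_less)
  qed
  ultimately have "Legendre c p = -1" by (simp add: Legendre_def cong_0_iff)
  thus ?thesis using that by blast
qed

text \<open>
  These conditions say that \<open>\<rat>(\<surd>d)\<close> is inert at \<open>p\<close>, so that norms from it have even \<open>p\<close>-adic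
  valuation, and that reciprocity with \<open>d\<close> has no sign.  The residue 5 modulo 8 makes 2 inert; in
  the other cases the residue 1 modulo 8 makes 2 a square modulo \<open>d\<close>.
\<close>

definition anisotropic_pair :: "nat \<Rightarrow> nat \<Rightarrow> bool" where
  "anisotropic_pair p d \<longleftrightarrow> prime p \<and> prime d \<and> p \<noteq> d \<and>
     (if p = 2 then d mod 8 = 5 else d mod 8 = 1 \<and> Legendre d p = -1)"

lemma anisotropic_pair_exists:
  assumes "prime p"
  obtains d where "anisotropic_pair p d" "d > N"
proof -
  define Q where "Q = {q. prime q \<and> 2 < q \<and> q \<le> max N p}"
  have Q: "finite Q" "\<And>q. q \<in> Q \<Longrightarrow> prime q \<and> q > 2" unfolding Q_def by auto
  have big: "d > max N p" if "prime d" "d \<notin> Q" "odd d" for d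
    using that prime_ge_2_nat[of d] unfolding Q_def by (cases "d = 2") auto
  have oddprod: "odd (\<Prod>R)" if "R \<subseteq> Q" for R
  proof -
    have "coprime 2 (\<Prod>R)" using that Q(2) by (intro prod_coprime_right) (auto simp: prime_odd_nat)
    thus ?thesis by simp
  qed
  show ?thesis
  proof (cases "p = 2")
    case True
    have "coprime (8::nat) (\<Prod>Q)" using oddprod[of Q] coprime_8_iff by (simp add: coprime_commute)
    then obtain n where n: "[n = 5] (mod 8)" "[n = 1] (mod \<Prod>Q)"
      using binary_chinese_remainder_nat by blast
    have "coprime n 8" using n(1) coprime_8_iff by (simp add: Cong.cong_def) presburger
    moreover have "coprime n (\<Prod>Q)" using n(2) by (metis cong_imp_coprime cong_sym coprime_1_left)
    ultimately obtain d where d: "prime d" "d \<notin> Q" "d mod 8 = n mod 8"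
      using prime_with_Legendre_symbols[OF Q] by (metis coprime_mult_right_iff)
    have d8: "d mod 8 = 5" using d(3) n(1) by (simp add: Cong.cong_def)
    hence "odd d" by presburger
    hence dN: "d > max N p" by (rule big[OF d(1,2)])
    have "anisotropic_pair p d" unfolding anisotropic_pair_def using assms d(1) d8 dN True by simp
    thus ?thesis by (rule that) (use dN in simp)
  next
    case False
    hence p2: "p > 2" using prime_ge_2_nat[OF assms] by simp
    hence pQ: "p \<in> Q" using assms by (simp add: Q_def)
    obtain c where c: "Legendre (int c) p = -1" using nonresidue_exists[OF assms p2] .
    define R where "R = 8 * \<Prod>(Q - {p})"
    have prod: "8 * \<Prod>Q = R * p" unfolding R_def using prod.remove[OF Q(1) pQ, of id] by simp
    have "\<not> p dvd R"
    proof -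
      have "coprime p (\<Prod>(Q - {p}))" using Q(2) assms by (intro prod_coprime_right) (auto intro: primes_coprime)
      moreover have "coprime p 8" using coprime_8_iff p2 assms prime_odd_nat by blast
      ultimately have "coprime p R" unfolding R_def by simp
      thus ?thesis using assms by (metis coprime_absorb_left not_prime_unit)
    qed
    hence "coprime R p" using assms prime_imp_coprime coprime_commute by blast
    then obtain n where n: "[n = 1] (mod R)" "[n = c] (mod p)" using binary_chinese_remainder_nat by blast
    have Ln: "Legendre n p = -1" using n(2) c Legendre_cong[of n c p] by (simp add: cong_int_iff)
    have "coprime n R" using n(1) by (metis cong_imp_coprime cong_sym coprime_1_left)
    moreover have "coprime n p"
      using Ln Legendre_eq_0_iff[of n p] prime_imp_coprime[OF assms, of n] by (auto simp: coprime_commute)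
    ultimately have "coprime n (8 * \<Prod>Q)" unfolding prod by simp
    then obtain d where d: "prime d" "d \<notin> Q" "d mod 8 = n mod 8" "Legendre d p = Legendre n p"
      using prime_with_Legendre_symbols[OF Q] pQ by metis
    have "[n = 1] (mod 8)" using n(1) by (rule cong_dvd_modulus_nat) (simp add: R_def)
    hence d8: "d mod 8 = 1" using d(3) by (simp add: Cong.cong_def)
    hence "odd d" by presburger
    hence dN: "d > max N p" by (rule big[OF d(1,2)])
    have "anisotropic_pair p d" unfolding anisotropic_pair_def using assms d(1,4) d8 dN Ln False by simp
    thus ?thesis by (rule that) (use dN in simp)
  qed
qed

section \<open>A quaternary form that detects the denominator prime p\<close>

lemma int_prime_dvd_power2: "prime p \<Longrightarrow> int p dvd x\<^sup>2 \<longleftrightarrow> int p dvd x"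
  using prime_dvd_power_iff[of "int p" 2 x] by simp

text \<open>
  Descent: the two sides have \<open>d\<close>-adic valuations of different parity.
\<close>

lemma no_quadratic_ratio:
  fixes d :: nat and A B x y :: int
  assumes "prime d" "\<not> int d dvd A" "\<not> int d dvd B" "A * x\<^sup>2 = int d * B * y\<^sup>2"
  shows "x = 0 \<and> y = 0"
  using assms(4)
proof (induction "nat \<bar>x\<bar>" arbitrary: x y rule: less_induct)
  case less
  have d: "prime (int d)" "int d > 1" using assms(1) prime_gt_1_nat by auto
  have "int d dvd A * x\<^sup>2" unfolding less.prems by (simp add: mult.assoc)
  hence "int d dvd x" using assms(2) d by (simp add: prime_dvd_mult_iff int_prime_dvd_power2[OF assms(1)])
  then obtain x' where x': "x = int d * x'" by blast
  have eq: "int d * (A * x'\<^sup>2) = B * y\<^sup>2" using less.prems d unfolding x' by (simp add: power2_eq_square algebra_simps)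
  hence "int d dvd B * y\<^sup>2" by (metis dvd_triv_left)
  hence "int d dvd y" using assms(3) d by (simp add: prime_dvd_mult_iff int_prime_dvd_power2[OF assms(1)])
  then obtain y' where y': "y = int d * y'" by blast
  have eq': "A * x'\<^sup>2 = int d * B * y'\<^sup>2" using eq d unfolding y' by (simp add: power2_eq_square algebra_simps)
  show ?case
  proof (cases "x' = 0")
    case True
    hence "y' = 0" using eq' assms(3) d by auto
    thus ?thesis using True x' y' by simp
  next
    case False
    hence "\<bar>x'\<bar> < \<bar>x\<bar>" using d unfolding x' by (simp add: abs_mult)
    hence "x' = 0 \<and> y' = 0" using less.hyps[of x' y'] eq' by simp
    thus ?thesis using x' y' by simp
  qed
qed

lemma anisotropic_pairD:
  assumes "anisotropic_pair p d"
  shows "prime p" "prime d" "p \<noteq> d" "d > 2" "d mod 4 = 1" "\<not> int p dvd int d" "\<not> int d dvd int p"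
proof -
  show *: "prime p" "prime d" "p \<noteq> d" using assms unfolding anisotropic_pair_def by auto
  have "d mod 8 = 5 \<or> d mod 8 = 1" using assms unfolding anisotropic_pair_def by (auto split: if_splits)
  thus d4: "d mod 4 = 1" by presburger
  show "d > 2" using d4 prime_ge_2_nat[OF *(2)] by (cases "d = 2") auto
  show "\<not> int p dvd int d" "\<not> int d dvd int p" using * primes_dvd_imp_eq by auto
qed

text \<open>
  The Hasse principle for one quaternary form.  With \<open>M = b^2 + p (d a)^2 = M0 m^2\<close>, \<open>M0\<close>
  squarefree, it suffices to find a number represented by both \<open>x^2 - d y^2\<close> and
  \<open>M0 x^2 - d p y^2\<close>.  A prime \<open>l\<close> is such a number as soon as Legendre's conditions hold
  for the two ternary forms.  Up to reciprocity, these conditions prescribe \<open>l\<close> modulo 8 and the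
  symbols \<open>(l/p) = (l/d) = 1\<close> and \<open>(l/q) = (d/q)\<close> for the odd primes \<open>q\<close> dividing \<open>M0\<close>, where one
  uses that \<open>-p\<close> is a square modulo \<open>q\<close>.  The condition modulo \<open>l\<close> itself then holds automatically:
  \<open>(M0/l) = (M0/d)\<close>, and \<open>M0\<close> is a square modulo \<open>d\<close> because \<open>M \<equiv> b^2\<close>.
\<close>

lemma anisotropic_form_represents:
  fixes a b :: int and p d :: nat
  assumes ap: "anisotropic_pair p d" and ab: "coprime a b" and pb: "\<not> int p dvd b" and db: "\<not> int d dvd b"
  shows "\<exists>u v w :: rat. u\<^sup>2 - of_nat d * v\<^sup>2 + of_nat d * of_nat p * w\<^sup>2 =
     1 + of_nat p * (of_nat d * (of_int a / of_int b))\<^sup>2"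
proof -
  note P = anisotropic_pairD[OF ap]
  define M where "M = b\<^sup>2 + int p * (int d * a)\<^sup>2"
  have b0: "b \<noteq> 0" using pb by auto
  have Mpos: "M > 0" unfolding M_def using b0 by (intro add_pos_nonneg) auto
  have pM: "\<not> int p dvd M" and dM: "\<not> int d dvd M"
    using pb db P(1,2) int_prime_dvd_power2[of _ b] unfolding M_def
    by (auto simp: dvd_add_left_iff power_mult_distrib)
  define M0 where "M0 = squarefree_part (nat M)"
  define m where "m = square_part (nat M)"
  have "nat M = M0 * m\<^sup>2" unfolding M0_def m_def by (rule squarefree_decompose)
  hence "int (nat M) = int (M0 * m\<^sup>2)" by (rule arg_cong)
  hence M: "M = int M0 * (int m)\<^sup>2" using Mpos by simp
  have sf: "squarefree M0" unfolding M0_def by (rule squarefree_squarefree_part)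
  have m0: "m \<noteq> 0" and M0: "M0 > 0" using M Mpos by (auto intro: Nat.gr0I)
  have pM0: "\<not> int p dvd M0" "\<not> int p dvd m" and dM0: "\<not> int d dvd M0" "\<not> int d dvd m"
  proof -
    have "int q dvd int M0 \<Longrightarrow> int q dvd M" "int q dvd int m \<Longrightarrow> int q dvd M" for q
      by (simp_all add: M power2_eq_square)
    thus "\<not> int p dvd M0" "\<not> int p dvd m" "\<not> int d dvd M0" "\<not> int d dvd m" using pM dM by blast+
  qed
  \<comment> \<open>The symbol at 2 is controlled by \<open>l\<close> modulo 8, so only the odd part of \<open>M0\<close> enters the congruences.\<close>
  define M1 where "M1 = (if even M0 then M0 div 2 else M0)"
  have M1: "M1 dvd M0" "odd M1"
  proof -
    show "M1 dvd M0" unfolding M1_def by (auto intro: dvdI[of _ _ 2])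
    have "\<not> 2\<^sup>2 dvd M0" using sf unfolding squarefree_def by (metis dvd_1_iff_1 is_unit_power_iff numeral_eq_one_iff semiring_norm(85) dvd_refl nat_dvd_1_iff_1)
    thus "odd M1" unfolding M1_def by auto
  qed
  have q_M1: "q dvd M1" if "prime q" "q > 2" "q dvd M0" for q
  proof (cases "even M0")
    case True
    hence "M0 = 2 * M1" unfolding M1_def by simp
    hence "q dvd 2 * M1" using that by simp
    moreover have "\<not> q dvd 2" using that by (auto dest: dvd_imp_le)
    ultimately show ?thesis using that(1) prime_dvd_mult_iff by blast
  qed (use that in \<open>simp add: M1_def\<close>)
  have copM1: "coprime (8 * p * d) M1"
  proof -
    have "\<not> p dvd M1" "\<not> d dvd M1" using pM0(1) dM0(1) M1(1) dvd_trans by auto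
    hence "coprime p M1" "coprime d M1" using P(1,2) prime_imp_coprime by blast+
    moreover have "coprime 8 M1" using M1(2) coprime_8_iff[of M1] by (simp add: coprime_commute)
    ultimately show ?thesis by simp
  qed
  \<comment> \<open>A number with the symbols wanted for \<open>l\<close>; \<open>prime_with_Legendre_symbols\<close> replaces it by a prime.\<close>
  obtain n where n: "[n = 1] (mod 8 * p * d)" "[n = d] (mod M1)"
    using binary_chinese_remainder_nat[OF copM1] by blast
  define Q where "Q = {q. prime q \<and> 2 < q \<and> q dvd p * d * M0}"
  have pdM: "p * d * M0 > 0" using M0 P(1,2) prime_gt_0_nat by simp
  have Q: "finite Q" "\<And>q. q \<in> Q \<Longrightarrow> prime q \<and> q > 2"
    unfolding Q_def using pdM by auto
  have cn: "coprime n (8 * p * d)" using n(1) by (metis cong_imp_coprime cong_sym coprime_1_left)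
  have "coprime d M1" using copM1 by simp
  hence cn1: "coprime n M1" using n(2) by (metis cong_imp_coprime cong_sym)
  have "coprime n (\<Prod>Q)"
  proof (rule prod_coprime_right)
    fix q assume q: "q \<in> Q"
    hence "q dvd p \<or> q dvd d \<or> q dvd M0" unfolding Q_def by (auto simp: prime_dvd_mult_iff)
    hence "q dvd 8 * p * d \<or> q dvd M1" using q_M1 Q(2)[OF q] by auto
    thus "coprime n q" using cn cn1 coprime_divisors[OF dvd_refl] by blast
  qed
  hence "coprime n (8 * \<Prod>Q)" using cn by simp
  then obtain l :: nat where l: "prime l" "l \<notin> Q" "l mod 8 = n mod 8" and
    lQ: "\<And>q. q \<in> Q \<Longrightarrow> Legendre l q = Legendre n q"
    using prime_with_Legendre_symbols[OF Q] by blast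
  have n8: "[n = 1] (mod 8)" and nd: "[n = 1] (mod d)" and np: "[n = 1] (mod p)"
    using n(1) by (auto elim!: cong_dvd_modulus_nat)
  have l8: "l mod 8 = 1" using l(3) n8 by (simp add: Cong.cong_def)
  hence l4: "l mod 4 = 1" by presburger
  have l2: "l > 2" using l4 prime_ge_2_nat[OF l(1)] by (cases "l = 2") auto
  have lpdM: "\<not> l dvd p * d * M0" using l(1,2) l2 unfolding Q_def by blast
  have ldvd: "\<not> int l dvd int p" "\<not> int l dvd int d" "\<not> int l dvd int M0" using lpdM by auto
  have Lsq: "Legendre (x\<^sup>2) q = 1" if "prime q" "\<not> int q dvd x" for q x using Legendre_square[OF that] .
  have L1: "Legendre 1 q = 1" if "prime q" for q :: nat using Lsq[of q 1] that by (auto dest: prime_gt_1_nat)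
  have Lld: "Legendre l d = 1"
  proof -
    have "d \<in> Q" unfolding Q_def using P by simp
    thus ?thesis using lQ[of d] nd L1[OF P(2)] Legendre_cong[of n 1 d] by (simp add: cong_int_iff[of n 1 d, simplified])
  qed
  have Llp: "Legendre l p = 1" if "p \<noteq> 2"
  proof -
    have "p \<in> Q" unfolding Q_def using P that prime_ge_2_nat[of p] by simp
    thus ?thesis using lQ[of p] np L1[OF P(1)] Legendre_cong[of n 1 p] by (simp add: cong_int_iff[of n 1 p, simplified])
  qed
  have Llq: "Legendre l q = Legendre d q" if "prime q" "q > 2" "q dvd M0" for q
  proof -
    have "q \<in> Q" unfolding Q_def using that by simp
    moreover have "[n = d] (mod q)" using n(2) q_M1[OF that] by (rule cong_dvd_modulus_nat)
    ultimately show ?thesis using lQ[of q] Legendre_cong[of n d q] by (simp add: cong_int_iff)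
  qed
  have LM0: "Legendre M0 q = 1" if "prime q" "q > 2" "q = p \<or> q = d" for q
  proof -
    have nd: "\<not> int q dvd b" "\<not> int q dvd m" using that pb db pM0 dM0 by auto
    have "[M = b\<^sup>2] (mod q)" unfolding cong_iff_dvd_diff M_def using that by (auto simp: power_mult_distrib power2_eq_square)
    hence "Legendre M q = 1" using Legendre_cong Lsq[OF that(1) nd(1)] by metis
    thus ?thesis using Legendre_mult[OF that(1,2)] Lsq[OF that(1) nd(2)] unfolding M by simp
  qed
  have Lql: "Legendre q l = Legendre q d" if q: "prime q" "q dvd M0" for q :: nat
  proof (cases "q = 2")
    case True
    hence "p \<noteq> 2" using q(2) pM0 by auto
    hence "d mod 8 = 1" using ap unfolding anisotropic_pair_def by simp
    thus ?thesis using True Legendre_2[OF l(1) l8] Legendre_2[OF P(2)] by simp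
  next
    case False
    hence q2: "q > 2" using prime_ge_2_nat[OF q(1)] by simp
    have "q \<noteq> l" "q \<noteq> d" using q(2) ldvd(3) dM0(1) by auto
    hence "Legendre q l = Legendre l q" "Legendre q d = Legendre d q"
      using Legendre_recip[OF q(1) l(1) q2 l4] Legendre_recip[OF q(1) P(2) q2 P(5)] by auto
    thus ?thesis using Llq[OF q(1) q2 q(2)] by simp
  qed
  have LM0l: "Legendre M0 l = 1"
    using Legendre_agree[OF l(1) l2 P(2,4) M0 Lql] LM0[OF P(2,4)] by simp
  have Ldl: "Legendre d l = 1"
    using Legendre_recip[OF P(2) l(1) P(4) l4] Lld ldvd(2) by auto
  have Lpl: "Legendre p l = 1"
  proof (cases "p = 2")
    case True
    thus ?thesis using Legendre_2[OF l(1) l8] by simp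
  next
    case False
    hence "p > 2" using prime_ge_2_nat[OF P(1)] by simp
    thus ?thesis using Legendre_recip[OF P(1) l(1) _ l4] Llp[OF False] ldvd(1) by auto
  qed
  have lprime: "prime (int l)" using l(1) by simp
  \<comment> \<open>The zero of this form must have \<open>z1 \<noteq> 0\<close>: only then is \<open>l\<close> itself represented by \<open>x^2 - d y^2\<close>.\<close>
  obtain s1 where s1: "int d dvd s1\<^sup>2 - 1 * int l" using Legendre_eq_1_D[OF Lld] by auto
  obtain t1 where t1: "int l dvd t1\<^sup>2 - 1 * int d" using Legendre_eq_1_D[OF Ldl] by auto
  have "\<exists>x y z. (x, y, z) \<noteq> (0, 0, 0) \<and> 1 * x\<^sup>2 = int d * y\<^sup>2 + int l * z\<^sup>2"
  proof (rule legendre_form_zero)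
    show "int d dvd s1\<^sup>2 - 1 * int l" "int l dvd t1\<^sup>2 - 1 * int d" by (fact s1, fact t1)
  qed (use P(4) l2 ldvd(2) lprime in auto)
  then obtain x1 y1 z1 where 1: "(x1, y1, z1) \<noteq> (0, 0, 0)" "1 * x1\<^sup>2 = int d * y1\<^sup>2 + int l * z1\<^sup>2"
    by blast
  have z1: "z1 \<noteq> 0"
  proof
    assume "z1 = 0"
    hence "x1 = 0 \<and> y1 = 0" using 1(2) no_quadratic_ratio[OF P(2), of 1 1 x1 y1] P(4) by (auto dest: zdvd_imp_le)
    thus False using 1(1) \<open>z1 = 0\<close> by simp
  qed
  \<comment> \<open>The same for \<open>M0 x^2 - d p y^2\<close>; a squarefree coefficient lets the local roots be glued.\<close>
  have "\<exists>r. int M0 dvd r\<^sup>2 - (- (int d * int p * int l))"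
  proof (rule root_mod_squarefree[OF sf])
    fix q assume q: "prime q" "q dvd M0"
    show "\<exists>r. int q dvd r\<^sup>2 - (- (int d * int p * int l))"
    proof (cases "q = 2")
      case True
      show ?thesis unfolding True by (rule exI[of _ "int d * int p * int l"]) (simp add: power2_eq_square)
    next
      case False
      hence q2: "q > 2" using prime_ge_2_nat[OF q(1)] by simp
      have qM: "int q dvd M" using q(2) unfolding M by simp
      have qp: "\<not> int q dvd int p" and qd: "\<not> int q dvd int d"
        using q P(1,2) pM0(1) dM0(1) primes_dvd_imp_eq[of q] by auto
      have qb: "\<not> int q dvd b"
      proof
        assume "int q dvd b"
        hence "int q dvd int p * (int d * a)\<^sup>2" using qM unfolding M_def
          by (simp add: dvd_add_right_iff power2_eq_square)
        hence "int q dvd a" using qp qd q(1) int_prime_dvd_power2[OF q(1)] by (simp add: prime_dvd_mult_iff)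
        thus False using \<open>int q dvd b\<close> ab q(1) by (metis coprime_common_divisor not_prime_unit prime_nat_int_transfer)
      qed
      have qa: "\<not> int q dvd int d * a"
      proof
        assume "int q dvd int d * a"
        hence "int q dvd int p * (int d * a)\<^sup>2" by (simp add: power2_eq_square)
        hence "int q dvd b\<^sup>2" using qM unfolding M_def by (simp add: dvd_add_left_iff)
        thus False using qb int_prime_dvd_power2[OF q(1)] by simp
      qed
      have "[- int p * (int d * a)\<^sup>2 = b\<^sup>2] (mod q)"
        using qM unfolding M_def cong_iff_dvd_diff by (metis add_diff_cancel_right' diff_minus_eq_add dvd_minus_iff minus_diff_eq minus_mult_left uminus_add_conv_diff)
      hence "Legendre (- int p) q = 1"
        using Legendre_cong Lsq[OF q(1) qb] Legendre_mult[OF q(1) q2] Lsq[OF q(1) qa] by (metis mult.right_neutral)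
      moreover have "Legendre d q * Legendre l q = 1"
        using Llq[OF q(1) q2 q(2)] Legendre_values[of d q] Legendre_eq_0_iff[of d q] qd by auto
      moreover have "- (int d * int p * int l) = (- int p) * (int d * int l)" by simp
      ultimately have "Legendre (- (int d * int p * int l)) q = 1"
        by (simp only: Legendre_mult[OF q(1) q2])
      thus ?thesis by (rule Legendre_eq_1_D)
    qed
  qed
  then obtain r2 where r2: "int M0 dvd r2\<^sup>2 + int d * int p * int l" by auto
  have "\<exists>s. int d * int p dvd s\<^sup>2 - int M0 * int l"
  proof -
    obtain s where s: "int d dvd s\<^sup>2 - int M0 * int l"
      using Legendre_eq_1_D[of "int M0 * int l" d] Legendre_mult[OF P(2,4)] LM0[OF P(2,4)] Lld by auto
    obtain s' where s': "int p dvd s'\<^sup>2 - int M0 * int l"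
    proof (cases "p = 2")
      case True
      have "int p dvd (int M0 * int l)\<^sup>2 - int M0 * int l" unfolding True by (simp add: power2_eq_square)
      thus ?thesis using that by blast
    next
      case False
      hence p2: "p > 2" using prime_ge_2_nat[OF P(1)] by simp
      show ?thesis
        using that Legendre_eq_1_D[of "int M0 * int l" p] Legendre_mult[OF P(1) p2] LM0[OF P(1) p2] Llp[OF False] by auto
    qed
    have "coprime (int d) (int p)" using P(1,2,3) primes_coprime by auto
    thus ?thesis using root_mod_coprime s s' by blast
  qed
  then obtain s2 where s2: "int d * int p dvd s2\<^sup>2 - int M0 * int l" by blast
  obtain t2 where t2: "int l dvd t2\<^sup>2 - int M0 * (int d * int p)"
    using Legendre_eq_1_D[of "int M0 * (int d * int p)" l] Legendre_mult[OF l(1) l2] LM0l Ldl Lpl by auto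
  have copdp: "coprime (int M0) (int d * int p)"
    using pM0(1) dM0(1) P(1,2) prime_imp_coprime[of p M0] prime_imp_coprime[of d M0] by (simp add: coprime_commute)
  have "\<exists>x y z. (x, y, z) \<noteq> (0, 0, 0) \<and> int M0 * x\<^sup>2 = int d * int p * y\<^sup>2 + int l * z\<^sup>2"
  proof (rule legendre_form_zero)
    show "int M0 dvd r2\<^sup>2 + int d * int p * int l" "int d * int p dvd s2\<^sup>2 - int M0 * int l"
      "int l dvd t2\<^sup>2 - int M0 * (int d * int p)" by (fact r2, fact s2, fact t2)
    show "\<not> int l dvd int d * int p" using ldvd lprime prime_dvd_mult_iff by blast
    show "0 < int d * int p" using P(1,4) prime_gt_0_nat[of p] by simp
  qed (use M0 l2 ldvd lprime copdp in auto)
  then obtain x2 y2 z2 where 2: "(x2, y2, z2) \<noteq> (0, 0, 0)" "int M0 * x2\<^sup>2 = int d * int p * y2\<^sup>2 + int l * z2\<^sup>2"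
    by blast
  have z2: "z2 \<noteq> 0"
  proof
    assume "z2 = 0"
    hence "x2 = 0 \<and> y2 = 0" using 2(2) no_quadratic_ratio[OF P(2) dM0(1) P(7), of x2 y2] by simp
    thus False using 2(1) \<open>z2 = 0\<close> by simp
  qed
  have x2: "x2 \<noteq> 0"
  proof
    assume "x2 = 0"
    hence "int d * int p * y2\<^sup>2 + int l * z2\<^sup>2 = 0" using 2(2) by simp
    moreover have "0 < int l * z2\<^sup>2" using z2 l2 by simp
    moreover have "0 \<le> int d * int p * y2\<^sup>2" by simp
    ultimately show False by linarith
  qed
  have e1: "(of_int x1 :: rat)\<^sup>2 = of_nat d * (of_int y1)\<^sup>2 + of_nat l * (of_int z1)\<^sup>2"
    using arg_cong[OF 1(2), of "of_int :: int \<Rightarrow> rat"] by simp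
  have e2: "of_nat M0 * (of_int x2 :: rat)\<^sup>2 = of_nat d * of_nat p * (of_int y2)\<^sup>2 + of_nat l * (of_int z2)\<^sup>2"
    using arg_cong[OF 2(2), of "of_int :: int \<Rightarrow> rat"] by simp
  have e3: "(of_nat M0 :: rat) * (of_nat m)\<^sup>2 = (of_int b)\<^sup>2 + of_nat p * (of_nat d * of_int a)\<^sup>2"
    using arg_cong[OF M[unfolded M_def], of "of_int :: int \<Rightarrow> rat"] by simp
  define c :: rat where "c = of_nat m / (of_int x2 * of_int b)"
  define g :: rat where "g = of_int z2 / of_int z1"
  have "(c * g * of_int x1)\<^sup>2 - of_nat d * (c * g * of_int y1)\<^sup>2 + of_nat d * of_nat p * (c * of_int y2)\<^sup>2
      = c\<^sup>2 * (g\<^sup>2 * ((of_int x1)\<^sup>2 - of_nat d * (of_int y1)\<^sup>2) + of_nat d * of_nat p * (of_int y2)\<^sup>2)"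
    by (simp add: power_mult_distrib algebra_simps)
  also have "g\<^sup>2 * ((of_int x1)\<^sup>2 - of_nat d * (of_int y1)\<^sup>2) = of_nat l * (of_int z2)\<^sup>2"
    unfolding e1 g_def using z1 by (simp add: power_divide)
  also have "of_nat l * (of_int z2)\<^sup>2 + of_nat d * of_nat p * (of_int y2)\<^sup>2 = of_nat M0 * (of_int x2 :: rat)\<^sup>2"
    unfolding e2 by simp
  also have "c\<^sup>2 * (of_nat M0 * (of_int x2)\<^sup>2) = of_nat M0 * (of_nat m)\<^sup>2 / (of_int b)\<^sup>2"
    unfolding c_def using x2 by (simp add: power_divide power_mult_distrib)
  also have "\<dots> = 1 + of_nat p * (of_nat d * (of_int a / of_int b))\<^sup>2"
    unfolding e3 using b0 by (simp add: add_divide_distrib power_divide power_mult_distrib)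
  finally show ?thesis by blast
qed

text \<open>
  The norm form of an inert quadratic field has no nontrivial zero modulo \<open>p\<close>.
\<close>

lemma anisotropic_norm_dvd:
  fixes p d :: nat and U V :: int
  assumes "prime p" "p > 2" "Legendre d p = -1" "int p dvd U\<^sup>2 - int d * V\<^sup>2"
  shows "int p dvd U" "int p dvd V"
proof -
  show V: "int p dvd V"
  proof (rule ccontr)
    assume nV: "\<not> int p dvd V"
    have "[U\<^sup>2 = int d * V\<^sup>2] (mod p)" using assms(4) by (simp add: cong_iff_dvd_diff)
    hence "Legendre (U\<^sup>2) p = Legendre d p * Legendre (V\<^sup>2) p"
      using Legendre_cong Legendre_mult[OF assms(1,2)] by metis
    hence "Legendre U p * Legendre U p = -1"
      using Legendre_square[OF assms(1) nV] assms(3) Legendre_mult[OF assms(1,2), of U U] by (simp add: power2_eq_square)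
    thus False using Legendre_values[of U p] by auto
  qed
  hence "int p dvd int d * V\<^sup>2" by (simp add: power2_eq_square)
  hence "int p dvd U\<^sup>2" using dvd_add[OF assms(4)] by fastforce
  thus "int p dvd U" using int_prime_dvd_power2[OF assms(1)] by blast
qed

lemma square_mod_16: "(x :: int)\<^sup>2 mod 16 \<in> {0, 4} \<and> even x \<or> x\<^sup>2 mod 16 \<in> {1, 9} \<and> odd x"
proof -
  have "x mod 8 \<in> {0,1,2,3,4,5,6,7}" by auto
  then obtain k r where x: "x = 8 * k + r" "r \<in> {0,1,2,3,4,5,6,7}"
    by (metis mult_div_mod_eq)
  have "x\<^sup>2 = r\<^sup>2 + 16 * (4 * k\<^sup>2 + k * r)" unfolding x(1) by (simp add: power2_eq_square algebra_simps)
  hence "x\<^sup>2 mod 16 = r\<^sup>2 mod 16" by (simp only: mod_mult_self2)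
  moreover have "even x \<longleftrightarrow> even r" unfolding x(1) by simp
  ultimately show ?thesis using x(2) by auto
qed

text \<open>
  The prime 2 has to be treated modulo 16, since \<open>u^2 - d v^2\<close> is a norm from an order of index 2,
  which has nontrivial zeros modulo 4.
\<close>

lemma mod_16_table:
  "\<forall>u\<in>{0,1,4,9::int}. \<forall>v\<in>{0,1,4,9::int}. \<forall>w\<in>{0,1,4,9::int}. \<forall>y\<in>{0,1,4,9::int}. \<forall>e\<in>{5,13::int}.
     (u - e * v + e * 2 * w - 2 * (e * e) * y) mod 16 = 0 \<longrightarrow> even u \<and> even v \<and> even w \<and> even y"
  by simp

lemma anisotropic_form_descent_step:
  fixes p d :: nat and U V W Y D :: int
  assumes ap: "anisotropic_pair p d"
    and eq: "U\<^sup>2 - int d * V\<^sup>2 + int d * int p * W\<^sup>2 = D\<^sup>2 + int p * (int d * Y)\<^sup>2"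
    and D: "(int p)\<^sup>2 dvd D"
  shows "int p dvd U \<and> int p dvd V \<and> int p dvd W \<and> int p dvd Y"
proof (cases "p = 2")
  case False
  note P = anisotropic_pairD[OF ap]
  hence p2: "p > 2" using prime_ge_2_nat[OF P(1)] False by simp
  have L: "Legendre d p = -1" using ap False unfolding anisotropic_pair_def by simp
  have pp: "int p * int p dvd D\<^sup>2" using D by (simp add: power2_eq_square dvd_mult)
  have "U\<^sup>2 - int d * V\<^sup>2 = D\<^sup>2 + int p * (int d * (int d * Y\<^sup>2 - W\<^sup>2))"
    using eq by (simp add: power_mult_distrib power2_eq_square algebra_simps)
  moreover have "int p dvd D\<^sup>2" using pp dvd_mult_left by blast
  ultimately have "int p dvd U\<^sup>2 - int d * V\<^sup>2" by simp
  note UV = anisotropic_norm_dvd[OF P(1) p2 L this]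
  have "int p * int p dvd U\<^sup>2" "int p * int p dvd V\<^sup>2"
    unfolding power2_eq_square using UV by (auto intro: mult_dvd_mono)
  hence "int p * int p dvd D\<^sup>2 - (U\<^sup>2 - int d * V\<^sup>2)" using pp by auto
  also have "D\<^sup>2 - (U\<^sup>2 - int d * V\<^sup>2) = int p * (int d * (W\<^sup>2 - int d * Y\<^sup>2))"
    using eq by (simp add: power_mult_distrib power2_eq_square algebra_simps)
  finally have "int p dvd int d * (W\<^sup>2 - int d * Y\<^sup>2)" using P(1) by (auto dest: prime_gt_0_nat)
  hence "int p dvd W\<^sup>2 - int d * Y\<^sup>2" using P(1,6) by (simp add: prime_dvd_mult_iff)
  note WY = anisotropic_norm_dvd[OF P(1) p2 L this]
  show ?thesis using UV WY by blast
next
  case True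
  hence "d mod 8 = 5" using ap unfolding anisotropic_pair_def by simp
  hence "int d mod 16 \<in> {5, 13}" by (auto simp: zmod_int[symmetric]) presburger
  obtain k where "D = 4 * k" using D True by (auto simp: dvd_def)
  hence "16 dvd D\<^sup>2" by (simp add: power2_eq_square)
  define F where "F u v w y e = (u - e * v + e * 2 * w - 2 * (e * e) * y)" for u v w y e :: int
  have "F (U\<^sup>2) (V\<^sup>2) (W\<^sup>2) (Y\<^sup>2) (int d) = D\<^sup>2"
    using eq True unfolding F_def by (simp add: power2_eq_square algebra_simps)
  hence "F (U\<^sup>2) (V\<^sup>2) (W\<^sup>2) (Y\<^sup>2) (int d) mod 16 = 0" using \<open>16 dvd D\<^sup>2\<close> by simp
  moreover have "[F (U\<^sup>2) (V\<^sup>2) (W\<^sup>2) (Y\<^sup>2) (int d) =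
      F (U\<^sup>2 mod 16) (V\<^sup>2 mod 16) (W\<^sup>2 mod 16) (Y\<^sup>2 mod 16) (int d mod 16)] (mod 16)"
    unfolding F_def by (intro cong_add cong_diff cong_mult cong_refl) (auto simp: Cong.cong_def)
  ultimately have F0: "F (U\<^sup>2 mod 16) (V\<^sup>2 mod 16) (W\<^sup>2 mod 16) (Y\<^sup>2 mod 16) (int d mod 16) mod 16 = 0"
    by (simp add: Cong.cong_def)
  have sq: "x\<^sup>2 mod 16 \<in> {0,1,4,9}" "even (x\<^sup>2 mod 16) \<longleftrightarrow> even x" for x :: int
    using square_mod_16[of x] by auto
  have "even (U\<^sup>2 mod 16) \<and> even (V\<^sup>2 mod 16) \<and> even (W\<^sup>2 mod 16) \<and> even (Y\<^sup>2 mod 16)"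
    by (rule mod_16_table[rule_format, OF sq(1) sq(1) sq(1) sq(1) \<open>int d mod 16 \<in> {5, 13}\<close> F0[unfolded F_def]])
  hence "even U \<and> even V \<and> even W \<and> even Y" by (simp only: sq(2))
  thus ?thesis using True by simp
qed

text \<open>
  Since a factor \<open>p\<close> is split off from \<open>Y\<close> only while \<open>p^2\<close> divides \<open>D\<close>, the exponent of \<open>p\<close> in \<open>Y\<close> may
  be one less than in \<open>D\<close>.
\<close>

lemma anisotropic_form_descent:
  fixes p d :: nat and U V W Y D :: int
  assumes ap: "anisotropic_pair p d"
    and eq: "U\<^sup>2 - int d * V\<^sup>2 + int d * int p * W\<^sup>2 = D\<^sup>2 + int p * (int d * Y)\<^sup>2"
    and D: "int p ^ Suc k dvd D"
  shows "int p ^ k dvd Y"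
  using eq D
proof (induction k arbitrary: U V W Y D)
  case (Suc k)
  have p: "int p > 0" using anisotropic_pairD(1)[OF ap] prime_gt_0_nat by simp
  have "(int p)\<^sup>2 dvd D" using Suc.prems(2) by (rule power_le_dvd) simp
  from anisotropic_form_descent_step[OF ap Suc.prems(1) this]
  obtain U' V' W' Y' where *: "U = int p * U'" "V = int p * V'" "W = int p * W'" "Y = int p * Y'"
    by (elim conjE dvdE) blast
  obtain D' where D': "D = int p * D'" "int p ^ Suc k dvd D'" using Suc.prems(2) p by (auto simp: dvd_def)
  have "(int p)\<^sup>2 * (U'\<^sup>2 - int d * V'\<^sup>2 + int d * int p * W'\<^sup>2) = (int p)\<^sup>2 * (D'\<^sup>2 + int p * (int d * Y')\<^sup>2)"
    using Suc.prems(1) unfolding * D' by (simp add: power_mult_distrib algebra_simps)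
  hence "U'\<^sup>2 - int d * V'\<^sup>2 + int d * int p * W'\<^sup>2 = D'\<^sup>2 + int p * (int d * Y')\<^sup>2" using p by simp
  hence "int p ^ k dvd Y'" using D'(2) Suc.IH by blast
  thus ?case unfolding * by simp
qed simp

text \<open>
  The form is anisotropic over the \<open>p\<close>-adic numbers, so its values being integral bounds the
  denominator of \<open>x^2\<close>: at most one factor \<open>p\<close> is lost.  That is why \<open>x^2\<close> occurs here in place
  of \<open>x\<close>: the denominator of a square cannot contain \<open>p\<close> exactly once.
\<close>

lemma anisotropic_form_integral:
  fixes x u v w :: rat
  assumes ap: "anisotropic_pair p d"
    and eq: "u\<^sup>2 - of_nat d * v\<^sup>2 + of_nat d * of_nat p * w\<^sup>2 = 1 + of_nat p * (of_nat d * x\<^sup>2)\<^sup>2"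
    and x: "x = of_int a / of_int b" "coprime a b" "b \<noteq> 0"
  shows "\<not> int p dvd b"
proof
  assume pb: "int p dvd b"
  have p: "prime (int p)" using anisotropic_pairD(1)[OF ap] by simp
  have frac: "\<exists>n e. q = of_int n / of_int e \<and> e \<noteq> 0" for q :: rat
    by (metis of_int_0_eq_iff quotient_of_div quotient_of_denom_pos less_irrefl prod.collapse)
  obtain nu eu nv ev nw ew where f: "u = of_int nu / of_int eu" "eu \<noteq> 0" "v = of_int nv / of_int ev" "ev \<noteq> 0"
    "w = of_int nw / of_int ew" "ew \<noteq> 0" using frac by metis
  define e where "e = eu * ev * ew"
  define D where "D = b\<^sup>2 * e"
  define U V W Y where "U = nu * ev * ew * b\<^sup>2" and "V = nv * eu * ew * b\<^sup>2" and "W = nw * eu * ev * b\<^sup>2" and "Y = a\<^sup>2 * e"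
  have e0: "e \<noteq> 0" using f by (simp add: e_def)
  have D0: "D \<noteq> 0" using e0 x(3) by (simp add: D_def)
  have m: "u * of_int D = of_int U" "v * of_int D = of_int V" "w * of_int D = of_int W" "x\<^sup>2 * of_int D = of_int Y"
    unfolding f x(1) D_def U_def V_def W_def Y_def e_def using f x(3) by (simp_all add: power_divide)
  have "(u * of_int D)\<^sup>2 - of_nat d * (v * of_int D)\<^sup>2 + of_nat d * of_nat p * (w * of_int D)\<^sup>2
     = (u\<^sup>2 - of_nat d * v\<^sup>2 + of_nat d * of_nat p * w\<^sup>2) * (of_int D)\<^sup>2"
    by (simp add: power_mult_distrib algebra_simps)
  also have "\<dots> = (of_int D)\<^sup>2 + of_nat p * (of_nat d * (x\<^sup>2 * of_int D))\<^sup>2"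
    unfolding eq by (simp add: power_mult_distrib algebra_simps)
  finally have "of_int (U\<^sup>2 - int d * V\<^sup>2 + int d * int p * W\<^sup>2) = (of_int (D\<^sup>2 + int p * (int d * Y)\<^sup>2) :: rat)"
    unfolding m by simp
  hence ieq: "U\<^sup>2 - int d * V\<^sup>2 + int d * int p * W\<^sup>2 = D\<^sup>2 + int p * (int d * Y)\<^sup>2"
    by (simp only: of_int_eq_iff)
  obtain D' where D': "D = int p ^ multiplicity (int p) D * D'" "\<not> int p dvd D'"
    using D0 p by (metis multiplicity_decompose' not_prime_unit)
  have "int p dvd D" unfolding D_def using pb by (simp add: power2_eq_square)
  hence "multiplicity (int p) D > 0" using D0 p by (simp add: prime_multiplicity_gt_zero_iff)
  then obtain k where k: "multiplicity (int p) D = Suc k" by (cases "multiplicity (int p) D") auto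
  have "int p ^ Suc k dvd D" using D'(1) unfolding k by (metis dvd_triv_left)
  hence "int p ^ k dvd Y" by (rule anisotropic_form_descent[OF ap ieq])
  moreover have "int p ^ 2 dvd b\<^sup>2" using pb by (rule dvd_power_same)
  ultimately have "int p ^ k * int p ^ 2 dvd Y * b\<^sup>2" by (rule mult_dvd_mono)
  also have "Y * b\<^sup>2 = int p ^ k * (int p * (a\<^sup>2 * D'))"
  proof -
    have "Y * b\<^sup>2 = a\<^sup>2 * D" unfolding Y_def D_def by simp
    also have "\<dots> = a\<^sup>2 * (int p ^ Suc k * D')" using D'(1) unfolding k by simp
    finally show ?thesis by (simp add: mult_ac)
  qed
  finally have "int p * int p dvd int p * (a\<^sup>2 * D')" using p by (auto simp: power2_eq_square)
  hence "int p dvd a\<^sup>2 * D'" using p by auto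
  hence "int p dvd a" using D'(2) p by (simp add: prime_dvd_mult_iff prime_dvd_power_iff)
  thus False using pb x(2) p by (metis coprime_common_divisor not_prime_unit)
qed

section \<open>Subrings of the rationals and solvability over them\<close>

lemma RW_mono: "W \<subseteq> W' \<Longrightarrow> RW W \<subseteq> RW W'"
proof
  fix x assume "W \<subseteq> W'" "x \<in> RW W"
  from this(2,1) show "x \<in> RW W'" by (induction rule: RW.induct) (auto intro: RW.intros)
qed

text \<open>
  An element of a subring involves only finitely many inverted primes.  This is the reason why
  solvability of an equation is an open condition on the set of inverted primes.
\<close>

lemma RW_finite:
  assumes "x \<in> RW W"
  shows "\<exists>F. finite F \<and> F \<subseteq> W \<and> x \<in> RW F"
  using assms
proof (induction rule: RW.induct)
  case one
  show ?case by (intro exI[of _ "{}"]) (auto intro: RW.one)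
next
  case (inverse p)
  thus ?case by (intro exI[of _ "{p}"]) (auto intro: RW.inverse)
next
  case (uminus x)
  thus ?case by (auto intro: RW.uminus)
next
  case (add x y)
  then obtain F G where "finite F" "F \<subseteq> W" "x \<in> RW F" "finite G" "G \<subseteq> W" "y \<in> RW G" by blast
  thus ?case using RW_mono[of F "F \<union> G"] RW_mono[of G "F \<union> G"]
    by (intro exI[of _ "F \<union> G"]) (auto intro: RW.add)
next
  case (mult x y)
  then obtain F G where "finite F" "F \<subseteq> W" "x \<in> RW F" "finite G" "G \<subseteq> W" "y \<in> RW G" by blast
  thus ?case using RW_mono[of F "F \<union> G"] RW_mono[of G "F \<union> G"]
    by (intro exI[of _ "F \<union> G"]) (auto intro: RW.mult)
qed

lemma RW_zero [simp]: "0 \<in> RW W"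
  using RW.add[OF RW.one RW.uminus[OF RW.one], of W] by simp

lemma RW_of_int [simp]: "of_int k \<in> RW W"
proof -
  have "of_nat n \<in> RW W" for n by (induction n) (auto intro: RW.add RW.one)
  thus ?thesis by (cases k) (auto intro: RW.uminus RW.one RW.add RW.uminus[of "1 + _"] simp del: of_nat_Suc)
qed

text \<open>
  Elements of the subring are the fractions whose denominators have all their prime factors
  in \<open>W\<close>.
\<close>

lemma RW_fraction:
  assumes "x \<in> RW W" "W \<subseteq> Primes"
  obtains a b :: int where "x = of_int a / of_int b" "b > 0" "coprime a b"
    "\<And>q. prime q \<Longrightarrow> int q dvd b \<Longrightarrow> q \<in> W"
proof -
  have "\<exists>a b :: int. x = of_int a / of_int b \<and> b > 0 \<and> (\<forall>q. prime q \<longrightarrow> int q dvd b \<longrightarrow> q \<in> W)"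
    using assms(1)
  proof (induction rule: RW.induct)
    case one
    show ?case by (intro exI[of _ 1]) (auto dest: prime_gt_1_nat)
  next
    case (inverse p)
    have "prime p" using inverse assms(2) by blast
    thus ?case using inverse prime_gt_0_nat[of p]
      by (intro exI[of _ 1] exI[of _ "int p"]) (auto dest: primes_dvd_imp_eq)
  next
    case (uminus x)
    then obtain a b :: int where "x = of_int a / of_int b" "b > 0" "\<forall>q. prime q \<longrightarrow> int q dvd b \<longrightarrow> q \<in> W" by blast
    thus ?case by (intro exI[of _ "-a"] exI[of _ b]) auto
  next
    case (add x y)
    then obtain a b c d :: int where "x = of_int a / of_int b" "b > 0" "\<forall>q. prime q \<longrightarrow> int q dvd b \<longrightarrow> q \<in> W"
      "y = of_int c / of_int d" "d > 0" "\<forall>q. prime q \<longrightarrow> int q dvd d \<longrightarrow> q \<in> W" by blast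
    thus ?case by (intro exI[of _ "a * d + c * b"] exI[of _ "b * d"]) (auto simp: field_simps prime_dvd_mult_iff)
  next
    case (mult x y)
    then obtain a b c d :: int where "x = of_int a / of_int b" "b > 0" "\<forall>q. prime q \<longrightarrow> int q dvd b \<longrightarrow> q \<in> W"
      "y = of_int c / of_int d" "d > 0" "\<forall>q. prime q \<longrightarrow> int q dvd d \<longrightarrow> q \<in> W" by blast
    thus ?case by (intro exI[of _ "a * c"] exI[of _ "b * d"]) (auto simp: prime_dvd_mult_iff)
  qed
  then obtain a b :: int where ab: "x = of_int a / of_int b" "b > 0" "\<forall>q. prime q \<longrightarrow> int q dvd b \<longrightarrow> q \<in> W" by blast
  define g where "g = gcd a b"
  have g: "g > 0" "a = (a div g) * g" "b = (b div g) * g" using ab(2) by (auto simp: g_def)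
  show ?thesis
  proof (rule that)
    show "x = of_int (a div g) / of_int (b div g)"
      using g ab(1) by (metis (no_types, lifting) of_int_0_eq_iff of_int_mult nonzero_mult_divide_mult_cancel_right less_irrefl)
    show "b div g > 0" using g ab(2) by (metis zero_less_mult_iff not_less_iff_gr_or_eq)
    show "coprime (a div g) (b div g)" unfolding g_def using ab(2) by (intro div_gcd_coprime) auto
    show "q \<in> W" if "prime q" "int q dvd b div g" for q
    proof -
      have "int q dvd b" using that(2) g(3) by (metis dvd_mult2)
      thus ?thesis using ab(3) that(1) by blast
    qed
  qed
qed

lemma RW_fractionI:
  assumes "b > 0" "\<And>q. prime q \<Longrightarrow> q dvd b \<Longrightarrow> q \<in> W"
  shows "of_int a / of_nat b \<in> RW W"
proof -
  have "1 / of_nat b \<in> RW W" using assms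
  proof (induction b rule: less_induct)
    case (less b)
    show ?case
    proof (cases "b = 1")
      case True
      thus ?thesis by (auto intro: RW.one)
    next
      case False
      then obtain q where q: "prime q" "q dvd b" using prime_factor_nat by blast
      then obtain s where s: "b = q * s" by blast
      have "s > 0" using s less.prems(1) by (cases s) auto
      moreover have "s < b" using s \<open>s > 0\<close> prime_gt_1_nat[OF q(1)] by simp
      ultimately have "1 / of_nat s \<in> RW W" using less.IH[of s] less.prems(2) s by auto
      moreover have "1 / of_nat q \<in> RW W" using less.prems(2)[OF q] by (rule RW.inverse)
      ultimately show ?thesis using RW.mult[of "1 / of_nat q" W "1 / of_nat s"] s by simp
    qed
  qed
  hence "of_int a * (1 / of_nat b) \<in> RW W" by (intro RW.mult RW_of_int)
  thus ?thesis by simp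
qed

lemma RW_Primes: "RW Primes = UNIV"
proof -
  have "x \<in> RW Primes" for x :: rat
  proof -
    obtain a b where ab: "quotient_of x = (a, b)" by (cases "quotient_of x")
    hence "b > 0" "x = of_int a / of_nat (nat b)"
      using quotient_of_denom_pos quotient_of_div by (force, force)
    thus ?thesis using RW_fractionI[of "nat b" Primes a] by simp
  qed
  thus ?thesis by blast
qed

definition mono_val :: "(nat \<Rightarrow> rat) \<Rightarrow> (nat \<Rightarrow>\<^sub>0 nat) \<Rightarrow> rat" where
  "mono_val v m = (\<Prod>i\<in>Poly_Mapping.keys m. v i ^ Poly_Mapping.lookup m i)"

lemma mono_val_superset:
  assumes "finite I" "Poly_Mapping.keys m \<subseteq> I"
  shows "mono_val v m = (\<Prod>i\<in>I. v i ^ Poly_Mapping.lookup m i)"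
  unfolding mono_val_def using assms by (intro prod.mono_neutral_left) (auto simp: in_keys_iff)

lemma mono_val_add: "mono_val v (m + n) = mono_val v m * mono_val v n"
proof -
  let ?I = "Poly_Mapping.keys m \<union> Poly_Mapping.keys n"
  have "Poly_Mapping.keys (m + n) \<subseteq> ?I" by (rule Poly_Mapping.keys_add)
  thus ?thesis
    using mono_val_superset[of ?I "m + n"] mono_val_superset[of ?I m] mono_val_superset[of ?I n]
    by (simp add: lookup_add power_add prod.distrib)
qed

lemma eval_rpoly_superset:
  assumes "finite K" "Poly_Mapping.keys f \<subseteq> K"
  shows "eval_rpoly v f = (\<Sum>m\<in>K. Poly_Mapping.lookup f m * mono_val v m)"
  unfolding eval_rpoly_def mono_val_def using assms by (intro sum.mono_neutral_left) (auto simp: in_keys_iff)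

lemma eval_rpoly_add: "eval_rpoly v (f + g) = eval_rpoly v f + eval_rpoly v g"
proof -
  let ?K = "Poly_Mapping.keys f \<union> Poly_Mapping.keys g"
  have "Poly_Mapping.keys (f + g) \<subseteq> ?K" by (rule Poly_Mapping.keys_add)
  thus ?thesis
    using eval_rpoly_superset[of ?K "f + g"] eval_rpoly_superset[of ?K f] eval_rpoly_superset[of ?K g]
    by (simp add: lookup_add distrib_right sum.distrib)
qed

lemma eval_rpoly_0 [simp]: "eval_rpoly v 0 = 0"
  by (simp add: eval_rpoly_def)

lemma eval_rpoly_sum: "eval_rpoly v (sum F A) = (\<Sum>a\<in>A. eval_rpoly v (F a))"
  by (induction A rule: infinite_finite_induct) (simp_all add: eval_rpoly_add)

lemma eval_rpoly_single: "eval_rpoly v (Poly_Mapping.single m c) = c * mono_val v m"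
  using eval_rpoly_superset[of "{m}" "Poly_Mapping.single m c" v] by simp

lemma rpoly_as_sum: "(f :: rpoly) = (\<Sum>m\<in>Poly_Mapping.keys f. Poly_Mapping.single m (Poly_Mapping.lookup f m))"
proof (rule poly_mapping_eqI)
  fix k
  have "Poly_Mapping.lookup (\<Sum>m\<in>Poly_Mapping.keys f. Poly_Mapping.single m (Poly_Mapping.lookup f m)) k
     = (\<Sum>m\<in>Poly_Mapping.keys f. if m = k then Poly_Mapping.lookup f m else 0)"
    unfolding lookup_sum by (intro sum.cong refl) (simp add: lookup_single when_def)
  thus "Poly_Mapping.lookup f k = Poly_Mapping.lookup (\<Sum>m\<in>Poly_Mapping.keys f. Poly_Mapping.single m (Poly_Mapping.lookup f m)) k"
    by (simp add: in_keys_iff)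
qed

lemma rpoly_mult_as_sum:
  "(f :: rpoly) * g = (\<Sum>m\<in>Poly_Mapping.keys f. \<Sum>k\<in>Poly_Mapping.keys g.
     Poly_Mapping.single (m + k) (Poly_Mapping.lookup f m * Poly_Mapping.lookup g k))"
  by (subst (1) rpoly_as_sum[of f], subst (1) rpoly_as_sum[of g]) (simp add: sum_product mult_single)

lemma eval_rpoly_mult: "eval_rpoly v (f * g) = eval_rpoly v f * eval_rpoly v g"
  unfolding rpoly_mult_as_sum[of f g] eval_rpoly_sum eval_rpoly_single mono_val_add
  by (simp add: eval_rpoly_def mono_val_def[symmetric] sum_product mult_ac)

lemma polys_over_Ints_add: "f \<in> polys_over \<int> \<Longrightarrow> g \<in> polys_over \<int> \<Longrightarrow> f + g \<in> polys_over \<int>"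
  by (simp add: polys_over_def lookup_add)

lemma polys_over_Ints_mult:
  assumes "f \<in> polys_over \<int>" "g \<in> polys_over \<int>"
  shows "f * g \<in> polys_over \<int>"
  unfolding polys_over_def mem_Collect_eq
proof
  fix j
  have "Poly_Mapping.lookup (f * g) j = (\<Sum>m\<in>Poly_Mapping.keys f. \<Sum>k\<in>Poly_Mapping.keys g.
      (Poly_Mapping.lookup f m * Poly_Mapping.lookup g k when m + k = j))"
    by (simp only: rpoly_mult_as_sum[of f g] lookup_sum lookup_single)
  also have "\<dots> \<in> \<int>" using assms by (intro Ints_sum) (simp add: when_def polys_over_def)
  finally show "Poly_Mapping.lookup (f * g) j \<in> \<int>" .
qed

lemma polys_over_Ints_subset: "polys_over \<int> \<subseteq> polys_over (RW W)"
  unfolding polys_over_def by (auto elim!: Ints_cases) (metis Ints_cases RW_of_int)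

text \<open>
  The functions given by integer polynomials.  Polynomials are constructed below only through this
  predicate and its closure properties.
\<close>

definition poly_fun :: "((nat \<Rightarrow> rat) \<Rightarrow> rat) \<Rightarrow> bool" where
  "poly_fun f \<longleftrightarrow> (\<exists>F\<in>polys_over \<int>. \<forall>v. eval_rpoly v F = f v)"

lemma poly_fun_of_int: "poly_fun (\<lambda>v. of_int c)"
  unfolding poly_fun_def
  by (intro bexI[of _ "Poly_Mapping.single 0 (of_int c)"])
     (simp_all add: eval_rpoly_single mono_val_def polys_over_def lookup_single when_def del: single_of_int)

lemma poly_fun_var: "poly_fun (\<lambda>v. v i)"
  unfolding poly_fun_def
  by (intro bexI[of _ "Poly_Mapping.single (Poly_Mapping.single i 1) 1"])
     (auto simp: eval_rpoly_single mono_val_def polys_over_def lookup_single when_def)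

lemma poly_fun_eval: "f \<in> polys_over \<int> \<Longrightarrow> poly_fun (\<lambda>v. eval_rpoly v f)"
  unfolding poly_fun_def by blast

lemma poly_fun_add: "poly_fun f \<Longrightarrow> poly_fun g \<Longrightarrow> poly_fun (\<lambda>v. f v + g v)"
  unfolding poly_fun_def using polys_over_Ints_add eval_rpoly_add by metis

lemma poly_fun_mult: "poly_fun f \<Longrightarrow> poly_fun g \<Longrightarrow> poly_fun (\<lambda>v. f v * g v)"
  unfolding poly_fun_def using polys_over_Ints_mult eval_rpoly_mult by metis

lemma poly_fun_diff: "poly_fun f \<Longrightarrow> poly_fun g \<Longrightarrow> poly_fun (\<lambda>v. f v - g v)"
  using poly_fun_add[of f "\<lambda>v. of_int (-1) * g v"] poly_fun_mult[OF poly_fun_of_int[of "-1"], of g] by simp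

lemma poly_fun_power: "poly_fun f \<Longrightarrow> poly_fun (\<lambda>v. f v ^ k)"
  using poly_fun_of_int[of 1] poly_fun_mult[of f] by (induction k) simp_all

lemma poly_fun_sum: "(\<And>a. a \<in> A \<Longrightarrow> poly_fun (f a)) \<Longrightarrow> poly_fun (\<lambda>v. \<Sum>a\<in>A. f a v)"
  using poly_fun_of_int[of 0] by (induction A rule: infinite_finite_induct) (simp_all add: poly_fun_add)

definition var_bound :: "rpoly \<Rightarrow> nat" where
  "var_bound f = Suc (Max (insert 0 (\<Union>m\<in>Poly_Mapping.keys f. Poly_Mapping.keys m)))"

lemma eval_rpoly_cong:
  assumes "\<And>i. i < var_bound f \<Longrightarrow> v i = w i"
  shows "eval_rpoly v f = eval_rpoly w f"
proof -
  have "v i = w i" if "m \<in> Poly_Mapping.keys f" "i \<in> Poly_Mapping.keys m" for m i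
  proof (rule assms)
    have "i \<le> Max (insert 0 (\<Union>m\<in>Poly_Mapping.keys f. Poly_Mapping.keys m))"
      using that by (intro Max_ge) auto
    thus "i < var_bound f" by (simp add: var_bound_def)
  qed
  thus ?thesis unfolding eval_rpoly_def by (intro sum.cong prod.cong arg_cong2[of _ _ _ _ "(*)"] refl) auto
qed

lemma dioph_holds_iff:
  "dioph_holds R g xs \<longleftrightarrow>
     (\<exists>v. (\<forall>i<length xs. v i = xs ! i) \<and> (\<forall>i\<ge>length xs. v i \<in> R) \<and> eval_rpoly v g = 0)"
proof
  assume "dioph_holds R g xs"
  then obtain y where "\<forall>i. y i \<in> R" "eval_rpoly (append_vals xs y) g = 0" unfolding dioph_holds_def by blast
  thus "\<exists>v. (\<forall>i<length xs. v i = xs ! i) \<and> (\<forall>i\<ge>length xs. v i \<in> R) \<and> eval_rpoly v g = 0"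
    by (intro exI[of _ "append_vals xs y"]) (auto simp: append_vals_def)
next
  assume "\<exists>v. (\<forall>i<length xs. v i = xs ! i) \<and> (\<forall>i\<ge>length xs. v i \<in> R) \<and> eval_rpoly v g = 0"
  then obtain v where v: "\<forall>i<length xs. v i = xs ! i" "\<forall>i\<ge>length xs. v i \<in> R" "eval_rpoly v g = 0" by blast
  have "append_vals xs (\<lambda>i. v (i + length xs)) = v"
    using v(1) by (auto simp: append_vals_def fun_eq_iff)
  thus "dioph_holds R g xs" unfolding dioph_holds_def using v by (intro exI[of _ "\<lambda>i. v (i + length xs)"]) auto
qed

text \<open>
  \<open>solvable_at g xs W\<close> is a positive fact about the subring of \<open>W\<close>: the tuple \<open>xs\<close> lies in
  the subring and in the diophantine set defined by \<open>g\<close>.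
\<close>

definition solvable_at :: "rpoly \<Rightarrow> rat list \<Rightarrow> nat set \<Rightarrow> bool" where
  "solvable_at g xs W \<longleftrightarrow> set xs \<subseteq> RW W \<and> dioph_holds (RW W) g xs"

lemma solvable_at_iff:
  "solvable_at g xs W \<longleftrightarrow> (\<exists>v. (\<forall>i<length xs. v i = xs ! i) \<and> (\<forall>i. v i \<in> RW W) \<and> eval_rpoly v g = 0)"
proof
  assume "solvable_at g xs W"
  then obtain v where v: "set xs \<subseteq> RW W" "\<forall>i<length xs. v i = xs ! i" "\<forall>i\<ge>length xs. v i \<in> RW W"
    "eval_rpoly v g = 0" unfolding solvable_at_def dioph_holds_iff by blast
  have "v i \<in> RW W" for i using v(1-3) by (cases "i < length xs") auto
  thus "\<exists>v. (\<forall>i<length xs. v i = xs ! i) \<and> (\<forall>i. v i \<in> RW W) \<and> eval_rpoly v g = 0"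
    using v(2,4) by (intro exI[of _ v]) simp
next
  assume "\<exists>v. (\<forall>i<length xs. v i = xs ! i) \<and> (\<forall>i. v i \<in> RW W) \<and> eval_rpoly v g = 0"
  then obtain v where v: "\<forall>i<length xs. v i = xs ! i" "\<forall>i. v i \<in> RW W" "eval_rpoly v g = 0" by blast
  have "set xs \<subseteq> RW W" using v(1,2) by (metis in_set_conv_nth subsetI)
  thus "solvable_at g xs W" unfolding solvable_at_def dioph_holds_iff
    using v by (intro conjI exI[of _ v]) simp_all
qed

lemma solvable_at_mono: "solvable_at g xs W \<Longrightarrow> W \<subseteq> W' \<Longrightarrow> solvable_at g xs W'"
  unfolding solvable_at_iff by (elim exE conjE, rule exI, intro conjI allI) (auto dest: RW_mono)

lemma solvable_at_finite:
  assumes "solvable_at g xs W"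
  shows "\<exists>F. finite F \<and> F \<subseteq> W \<and> solvable_at g xs F"
proof -
  obtain v where v: "\<forall>i<length xs. v i = xs ! i" "\<forall>i. v i \<in> RW W" "eval_rpoly v g = 0"
    using assms unfolding solvable_at_iff by blast
  define K where "K = max (var_bound g) (length xs)"
  have "\<forall>i. \<exists>F. finite F \<and> F \<subseteq> W \<and> v i \<in> RW F" using v(2) RW_finite by blast
  then obtain F where F: "\<And>i. finite (F i)" "\<And>i. F i \<subseteq> W" "\<And>i. v i \<in> RW (F i)" by metis
  define G where "G = (\<Union>i<K. F i)"
  define w where "w i = (if i < K then v i else 0)" for i
  have "w i \<in> RW G" for i
    using F(3)[of i] RW_mono[of "F i" G] by (auto simp: w_def G_def)
  moreover have "eval_rpoly w g = 0"
    using v(3) eval_rpoly_cong[of g w v] by (simp add: w_def K_def)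
  moreover have "\<forall>i<length xs. w i = xs ! i" using v(1) by (simp add: w_def K_def less_max_iff_disj)
  ultimately have "solvable_at g xs G" unfolding solvable_at_iff by blast
  moreover have "finite G" "G \<subseteq> W" using F(1,2) by (auto simp: G_def)
  ultimately show ?thesis by blast
qed

text \<open>
  The conditions \<open>X i = xs ! i\<close> become integer equations after multiplication by denominators, and a
  sum of squares turns the system into one equation.  So a positive fact about a tuple of
  rational numbers is membership of one integer polynomial in \<open>HTP\<close>, although the tuple itself has
  to lie in the subring.
\<close>

lemma solvable_at_as_HTP:
  assumes "g \<in> polys_over \<int>"
  obtains f where "f \<in> polys_over \<int>" "\<And>W. f \<in> HTP (RW W) \<longleftrightarrow> solvable_at g xs W"
proof -
  define num where "num i = fst (quotient_of (xs ! i))" for i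
  define den where "den i = snd (quotient_of (xs ! i))" for i
  have x: "xs ! i = of_int (num i) / of_int (den i)" "den i \<noteq> 0" for i
    using quotient_of_div[of "xs ! i"] quotient_of_denom_pos[of "xs ! i"]
    by (metis num_def den_def prod.collapse, metis den_def less_irrefl prod.collapse)
  define q where "q v = (eval_rpoly v g)\<^sup>2 + (\<Sum>i<length xs. (of_int (den i) * v i - of_int (num i))\<^sup>2)" for v
  have "poly_fun q" unfolding q_def
    by (intro poly_fun_add poly_fun_power poly_fun_sum poly_fun_diff poly_fun_mult poly_fun_of_int poly_fun_var poly_fun_eval assms)
  then obtain f where f: "f \<in> polys_over \<int>" "\<And>v. eval_rpoly v f = q v" unfolding poly_fun_def by blast
  have "q v = 0 \<longleftrightarrow> (\<forall>i<length xs. v i = xs ! i) \<and> eval_rpoly v g = 0" for v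
  proof -
    have "q v = 0 \<longleftrightarrow> (eval_rpoly v g)\<^sup>2 = 0 \<and> (\<Sum>i<length xs. (of_int (den i) * v i - of_int (num i))\<^sup>2) = 0"
      unfolding q_def by (intro add_nonneg_eq_0_iff sum_nonneg) auto
    also have "(\<Sum>i<length xs. (of_int (den i) * v i - of_int (num i))\<^sup>2) = 0 \<longleftrightarrow> (\<forall>i<length xs. v i = xs ! i)"
    proof -
      have "of_int (den i) * v i - of_int (num i) = 0 \<longleftrightarrow> v i = xs ! i" for i
        unfolding x(1)[of i] using x(2)[of i] by (simp add: field_simps)
      thus ?thesis by (subst sum_nonneg_eq_0_iff) auto
    qed
    finally show ?thesis by auto
  qed
  hence "f \<in> HTP (RW W) \<longleftrightarrow> solvable_at g xs W" for W
    unfolding HTP_def solvable_at_iff using f polys_over_Ints_subset[of W] by auto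
  thus ?thesis using f(1) that by blast
qed

section \<open>Category and genericity in the Cantor space\<close>

definition cylinder :: "nat set \<Rightarrow> nat \<Rightarrow> nat set set" where
  "cylinder W N = {W'. W' \<subseteq> Primes \<and> (\<forall>p<N. p \<in> W' \<longleftrightarrow> p \<in> W)}"

lemma cylinderI: "W' \<subseteq> Primes \<Longrightarrow> (\<And>p. p < N \<Longrightarrow> p \<in> W' \<longleftrightarrow> p \<in> W) \<Longrightarrow> W' \<in> cylinder W N"
  unfolding cylinder_def by simp

lemma cylinderD: "W' \<in> cylinder W N \<Longrightarrow> W' \<subseteq> Primes" "W' \<in> cylinder W N \<Longrightarrow> p < N \<Longrightarrow> p \<in> W' \<longleftrightarrow> p \<in> W"
  unfolding cylinder_def by simp_all

lemma cylinder_self: "W \<subseteq> Primes \<Longrightarrow> W \<in> cylinder W N"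
  by (simp add: cylinder_def)

lemma cylinder_trans: "V \<in> cylinder W N \<Longrightarrow> N \<le> M \<Longrightarrow> V' \<in> cylinder V M \<Longrightarrow> V' \<in> cylinder W N"
  unfolding cylinder_def by auto

text \<open>
  Open sets of the Cantor space, described through cylinders; the topology is used only in this
  form.
\<close>

lemma openin_cantor_primes:
  "openin cantor_primes U \<longleftrightarrow> U \<subseteq> Pow Primes \<and> (\<forall>W\<in>U. \<exists>N. cylinder W N \<subseteq> U)"
proof -
  define c where "c W = restrict (\<lambda>p. p \<in> W) Primes" for W
  let ?T = "product_topology (\<lambda>_. discrete_topology (UNIV :: bool set)) Primes"
  have ext: "c W = c W' \<Longrightarrow> W = W'" if "W \<subseteq> Primes" "W' \<subseteq> Primes" for W W'
  proof -
    assume "c W = c W'"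
    have "p \<in> W \<longleftrightarrow> p \<in> W'" if "prime p" for p
      using fun_cong[OF \<open>c W = c W'\<close>, of p] that by (simp add: c_def)
    thus "W = W'" using that by blast
  qed
  have "openin cantor_primes U \<longleftrightarrow> (\<exists>T. openin ?T T \<and> U = c -` T \<inter> Pow Primes)"
    unfolding cantor_primes_def openin_pullback_topology c_def ..
  also have "\<dots> \<longleftrightarrow> U \<subseteq> Pow Primes \<and> (\<forall>W\<in>U. \<exists>N. cylinder W N \<subseteq> U)"
  proof (intro iffI conjI ballI)
    assume "\<exists>T. openin ?T T \<and> U = c -` T \<inter> Pow Primes"
    then obtain T where T: "openin ?T T" "U = c -` T \<inter> Pow Primes" by blast
    show "U \<subseteq> Pow Primes" unfolding T(2) by (rule Int_lower2)
    fix W assume W: "W \<in> U"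
    hence cW: "c W \<in> T" using T(2) by simp
    obtain X where X: "finite {i \<in> Primes. X i \<noteq> topspace (discrete_topology UNIV)}"
      "c W \<in> Pi\<^sub>E Primes X" "Pi\<^sub>E Primes X \<subseteq> T"
      using bspec[OF T(1)[unfolded openin_product_topology_alt] cW] by (elim exE conjE) (rule that)
    define N where "N = Suc (Max (insert 0 {i \<in> Primes. X i \<noteq> topspace (discrete_topology UNIV)}))"
    have "W' \<in> U" if "W' \<in> cylinder W N" for W'
    proof -
      have "c W' \<in> Pi\<^sub>E Primes X"
      proof (rule PiE_I)
        fix p assume p: "p \<in> Primes"
        show "c W' p \<in> X p"
        proof (cases "X p = UNIV")
          case False
          hence "p \<le> Max (insert 0 {i \<in> Primes. X i \<noteq> topspace (discrete_topology UNIV)})"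
            using p X(1) by (intro Max_ge) auto
          hence "p < N" by (simp add: N_def)
          hence "c W' p = c W p" using cylinderD(2)[OF that] p by (simp add: c_def)
          thus ?thesis using X(2) p by auto
        qed simp
      qed (simp add: c_def)
      hence "c W' \<in> T" using X(3) by (rule rev_subsetD)
      thus ?thesis unfolding T(2) using cylinderD(1)[OF that] by simp
    qed
    thus "\<exists>N. cylinder W N \<subseteq> U" by blast
  next
    assume U: "U \<subseteq> Pow Primes \<and> (\<forall>W\<in>U. \<exists>N. cylinder W N \<subseteq> U)"
    have "openin ?T (c ` U)" unfolding openin_product_topology_alt
    proof (rule ballI)
      fix x assume "x \<in> c ` U"
      then obtain W where W: "W \<in> U" "x = c W" by blast
      then obtain N where N: "cylinder W N \<subseteq> U" using U by blast
      define X where "X i = (if i < N then {c W i} else UNIV)" for i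
      have "finite {i \<in> Primes. X i \<noteq> topspace (discrete_topology UNIV)}"
        by (rule finite_subset[of _ "{..<N}"]) (auto simp: X_def)
      moreover have "x \<in> Pi\<^sub>E Primes X" using W(2) by (auto simp: X_def c_def)
      moreover have "Pi\<^sub>E Primes X \<subseteq> c ` U"
      proof
        fix y assume y: "y \<in> Pi\<^sub>E Primes X"
        define W' where "W' = {p \<in> Primes. y p}"
        have "c W' = y"
        proof
          show "c W' p = y p" for p
            using PiE_arb[OF y, of p] by (cases "prime p") (simp_all add: c_def W'_def)
        qed
        moreover have "W' \<in> cylinder W N"
        proof (rule cylinderI)
          fix p assume p: "p < N"
          show "p \<in> W' \<longleftrightarrow> p \<in> W"
          proof (cases "p \<in> Primes")
            case True
            hence "y p \<in> X p" using y by blast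
            thus ?thesis using p True by (simp add: X_def W'_def c_def)
          next
            case False
            thus ?thesis using U W(1) unfolding W'_def by blast
          qed
        qed (auto simp: W'_def)
        ultimately show "y \<in> c ` U" using N by blast
      qed
      ultimately show "\<exists>X. finite {i \<in> Primes. X i \<noteq> topspace (discrete_topology UNIV)} \<and>
          (\<forall>i\<in>Primes. openin (discrete_topology UNIV) (X i)) \<and> x \<in> Pi\<^sub>E Primes X \<and> Pi\<^sub>E Primes X \<subseteq> c ` U"
        by (intro exI[of _ X]) simp
    qed
    moreover have "U = c -` (c ` U) \<inter> Pow Primes"
    proof (intro equalityI subsetI)
      fix W assume "W \<in> c -` (c ` U) \<inter> Pow Primes"
      then obtain W' where "W' \<in> U" "c W = c W'" "W \<subseteq> Primes" by auto
      thus "W \<in> U" using ext[of W W'] U by auto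
    qed (use U in auto)
    ultimately show "\<exists>T. openin ?T T \<and> U = c -` T \<inter> Pow Primes" by (intro exI[of _ "c ` U"] conjI)
  qed
  finally show ?thesis .
qed

lemma topspace_cantor_primes: "topspace cantor_primes = Pow Primes"
proof
  show "topspace cantor_primes \<subseteq> Pow Primes"
    using openin_cantor_primes[of "topspace cantor_primes"] by simp
  have "openin cantor_primes (Pow Primes)" unfolding openin_cantor_primes by (auto simp: cylinder_def)
  thus "Pow Primes \<subseteq> topspace cantor_primes" by (rule openin_subset)
qed

lemma openin_cylinder: "openin cantor_primes (cylinder W N)"
  unfolding openin_cantor_primes
proof (intro conjI ballI)
  show "cylinder W N \<subseteq> Pow Primes" by (auto simp: cylinder_def)
  show "\<exists>M. cylinder V M \<subseteq> cylinder W N" if "V \<in> cylinder W N" for V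
    using cylinder_trans[OF that order_refl] by blast
qed

lemma closure_of_cantor_primes:
  "V \<in> cantor_primes closure_of S \<longleftrightarrow> V \<subseteq> Primes \<and> (\<forall>N. \<exists>W\<in>S. W \<in> cylinder V N)"
proof
  assume V: "V \<in> cantor_primes closure_of S"
  hence VP: "V \<subseteq> Primes" and T: "\<And>T. V \<in> T \<Longrightarrow> openin cantor_primes T \<Longrightarrow> \<exists>y. y \<in> S \<and> y \<in> T"
    unfolding in_closure_of topspace_cantor_primes by auto
  have "\<exists>W\<in>S. W \<in> cylinder V N" for N
    using T[OF cylinder_self[OF VP] openin_cylinder] by auto
  thus "V \<subseteq> Primes \<and> (\<forall>N. \<exists>W\<in>S. W \<in> cylinder V N)" using VP by simp
next
  assume a: "V \<subseteq> Primes \<and> (\<forall>N. \<exists>W\<in>S. W \<in> cylinder V N)"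
  show "V \<in> cantor_primes closure_of S"
    unfolding in_closure_of topspace_cantor_primes
  proof (intro conjI allI impI)
    show "V \<in> Pow Primes" using a by simp
    fix T assume T: "V \<in> T \<and> openin cantor_primes T"
    then obtain N where "cylinder V N \<subseteq> T" unfolding openin_cantor_primes by metis
    moreover obtain W where "W \<in> S" "W \<in> cylinder V N" using a by metis
    ultimately show "\<exists>y. y \<in> S \<and> y \<in> T" by auto
  qed
qed

lemma interior_of_cantor_primes:
  "V \<in> cantor_primes interior_of S \<longleftrightarrow> V \<subseteq> Primes \<and> (\<exists>N. cylinder V N \<subseteq> S)"
proof
  assume "V \<in> cantor_primes interior_of S"
  then obtain T where T: "openin cantor_primes T" "T \<subseteq> S" "V \<in> T" unfolding interior_of_def by blast
  then obtain N where "cylinder V N \<subseteq> T" unfolding openin_cantor_primes by metis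
  moreover have "V \<subseteq> Primes" using T openin_subset[OF T(1)] unfolding topspace_cantor_primes by blast
  ultimately show "V \<subseteq> Primes \<and> (\<exists>N. cylinder V N \<subseteq> S)" using T(2) by blast
next
  assume "V \<subseteq> Primes \<and> (\<exists>N. cylinder V N \<subseteq> S)"
  then obtain N where "V \<subseteq> Primes" "cylinder V N \<subseteq> S" by blast
  thus "V \<in> cantor_primes interior_of S"
    using interior_of_maximal[OF _ openin_cylinder[of V N], of S] cylinder_self[of V N] by auto
qed

lemma not_nowhere_dense:
  assumes "S \<subseteq> Pow Primes" "\<not> nowhere_dense_in cantor_primes S"
  obtains W N where "W \<subseteq> Primes" "\<And>V M. V \<in> cylinder W N \<Longrightarrow> \<exists>W'\<in>S. W' \<in> cylinder V M"
proof -
  obtain U where U: "openin cantor_primes U" "U \<subseteq> cantor_primes closure_of S" "U \<noteq> {}"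
    using assms unfolding nowhere_dense_in_def topspace_cantor_primes by blast
  then obtain W where "W \<in> U" by blast
  then obtain N where N: "W \<subseteq> Primes" "cylinder W N \<subseteq> U" using U(1) unfolding openin_cantor_primes by blast
  have D: "\<exists>W'\<in>S. W' \<in> cylinder V M" if "V \<in> cylinder W N" for V M
  proof -
    have "V \<in> cantor_primes closure_of S" using that N(2) U(2) by blast
    thus ?thesis unfolding closure_of_cantor_primes by blast
  qed
  show ?thesis by (rule that[OF N(1) D])
qed

lemma nowhere_dense_avoid:
  assumes "nowhere_dense_in cantor_primes S" "W \<subseteq> Primes"
  shows "\<exists>V M. V \<in> cylinder W N \<and> M > N \<and> cylinder V M \<inter> S = {}"
proof -
  have "cylinder W N \<noteq> {}" using cylinder_self[OF assms(2)] by blast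
  hence "\<not> cylinder W N \<subseteq> cantor_primes closure_of S"
    using assms(1) openin_cylinder unfolding nowhere_dense_in_def by blast
  then obtain V where V: "V \<in> cylinder W N" "V \<notin> cantor_primes closure_of S" by blast
  then obtain M where M: "\<forall>W\<in>S. W \<notin> cylinder V M"
    unfolding closure_of_cantor_primes using cylinderD(1) by blast
  have "cylinder V (max M (Suc N)) \<subseteq> cylinder V M" by (auto simp: cylinder_def)
  thus ?thesis using V(1) M by (intro exI[of _ V] exI[of _ "max M (Suc N)"]) auto
qed

text \<open>
  The Baire category theorem for this space: shrink cylinders successively so that the \<open>i\<close>-th one
  misses \<open>K i\<close>; the conditions converge to a point because their lengths increase.
\<close>

lemma cantor_primes_Baire:
  assumes K: "\<And>i :: nat. nowhere_dense_in cantor_primes (K i)" and W: "W \<subseteq> Primes"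
  shows "\<exists>V\<in>cylinder W N. \<forall>i. V \<notin> K i"
proof -
  define R where "R i s t \<longleftrightarrow> fst t \<in> cylinder (fst s) (snd s) \<and> snd s < snd t \<and> cylinder (fst t) (snd t) \<inter> K i = {}"
    for i and s t :: "nat set \<times> nat"
  define nxt where "nxt i s = (SOME t. fst t \<subseteq> Primes \<and> R i s t)" for i s
  have nxt: "fst (nxt i s) \<subseteq> Primes \<and> R i s (nxt i s)" if "fst s \<subseteq> Primes" for i s
  proof -
    obtain V M where "V \<in> cylinder (fst s) (snd s)" "M > snd s" "cylinder V M \<inter> K i = {}"
      using nowhere_dense_avoid[OF K[of i] \<open>fst s \<subseteq> Primes\<close>, of "snd s"] by auto
    hence "fst (V, M) \<subseteq> Primes \<and> R i s (V, M)" using cylinderD(1)[of V] by (simp add: R_def)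
    thus ?thesis unfolding nxt_def by (rule someI)
  qed
  define s where "s = rec_nat (W, N) nxt"
  have s0: "s 0 = (W, N)" and sS: "s (Suc i) = nxt i (s i)" for i by (simp_all add: s_def)
  have sP: "fst (s i) \<subseteq> Primes" for i by (induction i) (use W nxt in \<open>auto simp: s0 sS\<close>)
  have sR: "R i (s i) (s (Suc i))" for i using nxt[OF sP] by (simp add: sS)
  have big: "snd (s i) \<ge> i" for i
    by (induction i) (use sR in \<open>auto simp: R_def Suc_le_eq intro: order_le_less_trans\<close>)
  have mono: "fst (s j) \<in> cylinder (fst (s i)) (snd (s i)) \<and> snd (s i) \<le> snd (s j)" if "i \<le> j" for i j
    using that
  proof (induction j rule: dec_induct)
    case base
    show ?case using cylinder_self[OF sP] by simp
  next
    case (step j)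
    thus ?case using sR[of j] cylinder_trans[of "fst (s j)" "fst (s i)" "snd (s i)" "snd (s j)" "fst (s (Suc j))"]
      unfolding R_def by auto
  qed
  define V where "V = {p. \<exists>i. p < snd (s i) \<and> p \<in> fst (s i)}"
  have V: "V \<in> cylinder (fst (s i)) (snd (s i))" for i
  proof (rule cylinderI)
    show "V \<subseteq> Primes" using sP unfolding V_def by blast
    fix p assume p: "p < snd (s i)"
    have "p \<in> fst (s j) \<longleftrightarrow> p \<in> fst (s i)" if "p < snd (s j)" for j
      using mono[of i j] mono[of j i] p that cylinderD(2) by (metis nat_le_linear)
    thus "p \<in> V \<longleftrightarrow> p \<in> fst (s i)" using p unfolding V_def by blast
  qed
  have "V \<notin> K i" for i using V[of "Suc i"] sR[of i] unfolding R_def by blast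
  thus ?thesis using V[of 0] s0 by auto
qed

lemma U_eq_cylinder:
  assumes "\<sigma> \<in> binary_strings"
  obtains W N where "W \<subseteq> Primes" "\<U> \<sigma> = cylinder W N"
proof -
  obtain N where N: "dom \<sigma> = {p \<in> Primes. p < N}" using assms unfolding binary_strings_def by blast
  define W where "W = {p. \<sigma> p = Some True}"
  have WP: "W \<subseteq> Primes" using N unfolding W_def by (auto simp: dom_def)
  have eq: "V \<in> \<U> \<sigma> \<longleftrightarrow> V \<in> cylinder W N" for V
  proof (cases "V \<subseteq> Primes")
    case True
    have "\<sigma> \<subseteq>\<^sub>m char_map V \<longleftrightarrow> (\<forall>p<N. p \<in> V \<longleftrightarrow> p \<in> W)"
    proof
      assume a: "\<sigma> \<subseteq>\<^sub>m char_map V"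
      show "\<forall>p<N. p \<in> V \<longleftrightarrow> p \<in> W"
      proof (intro allI impI)
        fix p assume "p < N"
        show "p \<in> V \<longleftrightarrow> p \<in> W"
        proof (cases "prime p")
          case True
          hence "p \<in> dom \<sigma>" using N \<open>p < N\<close> by blast
          hence "\<sigma> p = char_map V p" using a unfolding map_le_def by blast
          thus ?thesis using True unfolding W_def char_map_def by auto
        next
          case False
          thus ?thesis using \<open>V \<subseteq> Primes\<close> WP by blast
        qed
      qed
    next
      assume a: "\<forall>p<N. p \<in> V \<longleftrightarrow> p \<in> W"
      show "\<sigma> \<subseteq>\<^sub>m char_map V" unfolding map_le_def
      proof
        fix p assume "p \<in> dom \<sigma>"
        moreover from this obtain b where "\<sigma> p = Some b" by blast
        ultimately show "\<sigma> p = char_map V p" using N a unfolding W_def char_map_def by (cases b) auto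
      qed
    qed
    thus ?thesis using True unfolding \<U>_def cylinder_def by simp
  qed (simp add: \<U>_def cylinder_def)
  have "\<U> \<sigma> = cylinder W N" using eq by auto
  thus ?thesis by (rule that[OF WP])
qed

lemma cylinder_eq_U:
  assumes "W \<subseteq> Primes"
  obtains \<sigma> where "\<sigma> \<in> binary_strings" "\<U> \<sigma> = cylinder W N"
proof
  define \<sigma> where "\<sigma> = char_map W |` {p \<in> Primes. p < N}"
  show "\<sigma> \<in> binary_strings" unfolding binary_strings_def \<sigma>_def char_map_def by (auto simp: dom_def restrict_map_def split: if_splits)
  show "\<U> \<sigma> = cylinder W N"
    using assms unfolding \<U>_def cylinder_def \<sigma>_def char_map_def map_le_def
    by (auto simp: restrict_map_def dom_def split: if_splits)
qed

lemma HTP_iff_solvable_at: "f \<in> polys_over \<int> \<Longrightarrow> f \<in> HTP (RW W) \<longleftrightarrow> solvable_at f [] W"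
  unfolding HTP_def solvable_at_iff using polys_over_Ints_subset[of W] by auto

lemma solvable_at_open:
  assumes "solvable_at g xs W"
  obtains N where "\<And>W'. W' \<in> cylinder W N \<Longrightarrow> solvable_at g xs W'"
proof -
  obtain F where F: "finite F" "F \<subseteq> W" "solvable_at g xs F" using solvable_at_finite[OF assms] by blast
  define N where "N = Suc (Max (insert 0 F))"
  have "p < N" if "p \<in> F" for p
    using Max_ge[of "insert 0 F" p] F(1) that by (simp add: N_def less_Suc_eq_le)
  hence "F \<subseteq> W'" if "W' \<in> cylinder W N" for W' using F(2) cylinderD(2)[OF that] by blast
  hence "solvable_at g xs W'" if "W' \<in> cylinder W N" for W'
    using solvable_at_mono[OF F(3)] that by simp
  thus ?thesis by (rule that)
qed

lemma A_eq: "f \<in> polys_over \<int> \<Longrightarrow> \<A> f = {W. W \<subseteq> Primes \<and> solvable_at f [] W}"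
  unfolding \<A>_def using HTP_iff_solvable_at by blast

text \<open>
  The boundary of an open set is nowhere dense.
\<close>

lemma nowhere_dense_B:
  assumes "f \<in> polys_over \<int>"
  shows "nowhere_dense_in cantor_primes (\<B> f)"
  unfolding nowhere_dense_in_def
proof (intro conjI allI impI)
  show "\<B> f \<subseteq> topspace cantor_primes" unfolding \<B>_def topspace_cantor_primes by blast
  fix U assume U: "openin cantor_primes U \<and> U \<subseteq> cantor_primes closure_of \<B> f"
  show "U = {}"
  proof (rule ccontr)
    assume "U \<noteq> {}"
    then obtain V where V: "V \<in> U" by blast
    then obtain N where N: "cylinder V N \<subseteq> U" using U unfolding openin_cantor_primes by blast
    have disj: "W \<notin> \<A> f" if "W \<in> U" for W
    proof
      assume "W \<in> \<A> f"
      then obtain M where M: "\<And>W'. W' \<in> cylinder W M \<Longrightarrow> solvable_at f [] W'"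
        unfolding A_eq[OF assms] using solvable_at_open by blast
      have "W \<in> cantor_primes closure_of \<B> f" using U \<open>W \<in> U\<close> by auto
      then obtain W' where "W' \<in> \<B> f" "W' \<in> cylinder W M"
        unfolding closure_of_cantor_primes by metis
      thus False using M cylinderD(1) unfolding \<B>_def A_eq[OF assms] by blast
    qed
    have "V \<in> cantor_primes closure_of \<B> f" using U V by auto
    then obtain W where W: "W \<in> \<B> f" "W \<in> cylinder V N"
      unfolding closure_of_cantor_primes by metis
    have "cylinder W N \<subseteq> U" using N cylinder_trans[OF W(2) order_refl] by blast
    hence "cylinder W N \<subseteq> Pow Primes - \<A> f" using disj cylinderD(1) by blast
    hence "W \<in> cantor_primes interior_of (Pow Primes - \<A> f)"
      unfolding interior_of_cantor_primes using cylinderD(1)[OF W(2)] by blast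
    thus False using W(1) unfolding \<B>_def by blast
  qed
qed

text \<open>
  A generic point in the closure of the set where a positive fact holds belongs to that set.
\<close>

lemma generic_solvable_at:
  assumes "HTP_generic V" "g \<in> polys_over \<int>" "\<And>N. \<exists>W\<in>cylinder V N. solvable_at g xs W"
  shows "solvable_at g xs V"
proof (rule ccontr)
  assume n: "\<not> solvable_at g xs V"
  obtain f where f: "f \<in> polys_over \<int>" "\<And>W. f \<in> HTP (RW W) \<longleftrightarrow> solvable_at g xs W"
    using solvable_at_as_HTP[OF assms(2)] by blast
  have "V \<in> Pow Primes - \<A> f" using assms(1) n f(2) unfolding HTP_generic_def \<A>_def by blast
  hence "V \<in> cantor_primes interior_of (Pow Primes - \<A> f)"
    using assms(1) f(1) unfolding HTP_generic_def \<B>_def by blast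
  then obtain N where "cylinder V N \<subseteq> Pow Primes - \<A> f" unfolding interior_of_cantor_primes by blast
  thus False using assms(3)[of N] f(2) unfolding \<A>_def by blast
qed

text \<open>
  Every set close enough to a cofinite set is a subset of it, and solvability is monotone.
\<close>

lemma cofinite_generic:
  assumes "finite F"
  shows "HTP_generic (Primes - F)"
  unfolding HTP_generic_def
proof (intro conjI ballI)
  fix f assume f: "f \<in> polys_over \<int>"
  show "Primes - F \<notin> \<B> f"
  proof
    assume B: "Primes - F \<in> \<B> f"
    define N where "N = Suc (Max (insert 0 F))"
    have F: "p < N" if "p \<in> F" for p
      using Max_ge[of "insert 0 F" p] assms that by (simp add: N_def less_Suc_eq_le)
    have "cylinder (Primes - F) N \<subseteq> Pow Primes - \<A> f"
    proof
      fix W assume W: "W \<in> cylinder (Primes - F) N"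
      hence "W \<subseteq> Primes - F" using F cylinderD[OF W] by blast
      hence "W \<notin> \<A> f" using B solvable_at_mono[of f "[]" W "Primes - F"]
        unfolding \<B>_def A_eq[OF f] by blast
      thus "W \<in> Pow Primes - \<A> f" using cylinderD(1)[OF W] by blast
    qed
    hence "Primes - F \<in> cantor_primes interior_of (Pow Primes - \<A> f)"
      unfolding interior_of_cantor_primes by blast
    thus False using B unfolding \<B>_def by blast
  qed
qed blast

section \<open>Diophantine models over different subrings\<close>

lemma dioph_set_iff: "xs \<in> dioph_set (RW W) n h \<longleftrightarrow> length xs = n \<and> solvable_at h xs W"
  unfolding dioph_set_def tuples_def solvable_at_def by auto

lemma dioph_graph_iff:
  "(xs, ys, zs) \<in> dioph_graph (RW W) n g \<longleftrightarrow>
     length xs = n \<and> length ys = n \<and> length zs = n \<and> solvable_at g (xs @ ys @ zs) W"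
  unfolding dioph_graph_def tuples_def solvable_at_def by auto

text \<open>
  Whether a triple of polynomials defines a model depends only on which tuples of length \<open>n\<close>, or
  \<open>3 n\<close>, the polynomials accept; this is the comparison of two polynomials over two subrings.
\<close>

definition same_solvable :: "nat \<Rightarrow> rpoly \<Rightarrow> nat set \<Rightarrow> rpoly \<Rightarrow> nat set \<Rightarrow> bool" where
  "same_solvable k g W g' W' \<longleftrightarrow>
     (\<forall>xs. length xs = k \<longrightarrow> (solvable_at g xs W \<longleftrightarrow> solvable_at g' xs W'))"

lemma dioph_set_eq_iff:
  "dioph_set (RW W) n h = dioph_set (RW W') n h' \<longleftrightarrow> same_solvable n h W h' W'"
  unfolding same_solvable_def Set.set_eq_iff dioph_set_iff by auto

lemma dioph_graph_eq_iff:
  "dioph_graph (RW W) n g = dioph_graph (RW W') n g' \<longleftrightarrow> same_solvable (n + (n + n)) g W g' W'"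
proof
  assume eq: "dioph_graph (RW W) n g = dioph_graph (RW W') n g'"
  show "same_solvable (n + (n + n)) g W g' W'"
    unfolding same_solvable_def
  proof (intro allI impI)
    fix ts :: "rat list" assume ts: "length ts = n + (n + n)"
    define xs ys zs where "xs = take n ts" and "ys = take n (drop n ts)" and "zs = drop (n + n) ts"
    have "ts = xs @ ys @ zs" unfolding xs_def ys_def zs_def by (metis append_take_drop_id drop_drop)
    moreover have "length xs = n" "length ys = n" "length zs = n"
      using ts unfolding xs_def ys_def zs_def by simp_all
    ultimately show "solvable_at g ts W \<longleftrightarrow> solvable_at g' ts W'" using eq dioph_graph_iff by metis
  qed
next
  assume *: "same_solvable (n + (n + n)) g W g' W'"
  have "t \<in> dioph_graph (RW W) n g \<longleftrightarrow> t \<in> dioph_graph (RW W') n g'" for t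
  proof -
    obtain xs ys zs where t: "t = (xs, ys, zs)" by (cases t)
    show ?thesis using *[unfolded same_solvable_def, rule_format, of "xs @ ys @ zs"]
      unfolding t dioph_graph_iff by auto
  qed
  thus "dioph_graph (RW W) n g = dioph_graph (RW W') n g'" by auto
qed

lemma solvable_list_open:
  assumes "\<forall>(g, xs)\<in>set L. solvable_at g xs W"
  shows "\<exists>N. \<forall>W'\<in>cylinder W N. \<forall>(g, xs)\<in>set L. solvable_at g xs W'"
  using assms
proof (induction L)
  case (Cons a L)
  obtain g xs where a: "a = (g, xs)" by (cases a)
  obtain N where N: "\<forall>W'\<in>cylinder W N. \<forall>(g, xs)\<in>set L. solvable_at g xs W'" using Cons by auto
  have "solvable_at g xs W" using Cons.prems a by simp
  then obtain M where M: "\<And>W'. W' \<in> cylinder W M \<Longrightarrow> solvable_at g xs W'" using solvable_at_open by metis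
  have "cylinder W (max M N) \<subseteq> cylinder W M" "cylinder W (max M N) \<subseteq> cylinder W N" by (auto simp: cylinder_def)
  thus ?case using N M a by (intro exI[of _ "max M N"]) auto
qed simp

definition dense_in_cylinder :: "nat set set \<Rightarrow> nat set \<Rightarrow> nat \<Rightarrow> bool" where
  "dense_in_cylinder E W N \<longleftrightarrow> (\<forall>V\<in>cylinder W N. \<forall>M. \<exists>W'\<in>E. W' \<in> cylinder V M)"

locale integer_triple =
  fixes n :: nat and h hadd hmul :: rpoly
  assumes polys: "h \<in> polys_over \<int>" "hadd \<in> polys_over \<int>" "hmul \<in> polys_over \<int>"
begin

definition model_iso :: "nat set \<Rightarrow> (int \<Rightarrow> rat list) \<Rightarrow> bool" where
  "model_iso W \<phi> \<longleftrightarrow>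
     bij_betw \<phi> UNIV (dioph_set (RW W) n h) \<and>
     dioph_graph (RW W) n hadd = {(\<phi> a, \<phi> b, \<phi> (a + b)) | a b. True} \<and>
     dioph_graph (RW W) n hmul = {(\<phi> a, \<phi> b, \<phi> (a * b)) | a b. True}"

abbreviation models :: "nat set \<Rightarrow> bool" where
  "models W \<equiv> dioph_model_via (RW W) n h hadd hmul"

lemma models_iff: "models W \<longleftrightarrow> (\<exists>\<phi>. model_iso W \<phi>)"
  using polys polys_over_Ints_subset[of W] unfolding dioph_model_via_def model_iso_def by auto

lemma model_isoD:
  assumes "model_iso W \<phi>"
  shows "inj \<phi>"
    "(x, y, z) \<in> dioph_graph (RW W) n hadd \<longleftrightarrow> (\<exists>a b. x = \<phi> a \<and> y = \<phi> b \<and> z = \<phi> (a + b))"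
    "(x, y, z) \<in> dioph_graph (RW W) n hmul \<longleftrightarrow> (\<exists>a b. x = \<phi> a \<and> y = \<phi> b \<and> z = \<phi> (a * b))"
  using assms unfolding model_iso_def by (auto simp: bij_betw_def)

lemma model_iso_same_solvable:
  assumes "model_iso W \<phi>" "model_iso W' \<phi>"
  shows "same_solvable n h W h W'" "same_solvable (n + (n + n)) hadd W hadd W'"
    "same_solvable (n + (n + n)) hmul W hmul W'"
proof -
  have "dioph_set (RW W) n h = dioph_set (RW W') n h" "dioph_graph (RW W) n hadd = dioph_graph (RW W') n hadd"
    "dioph_graph (RW W) n hmul = dioph_graph (RW W') n hmul"
    using assms unfolding model_iso_def bij_betw_def by simp_all
  thus "same_solvable n h W h W'" "same_solvable (n + (n + n)) hadd W hadd W'"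
    "same_solvable (n + (n + n)) hmul W hmul W'"
    by (simp_all only: dioph_set_eq_iff dioph_graph_eq_iff)
qed

text \<open>
  The ring of integers is rigid.  Suppose that any finitely many positive facts, each true over \<open>W\<close>
  or over \<open>W'\<close>, hold together in some model \<open>W''\<close>.  Then \<open>\<phi>\<close> and \<open>\<phi>'\<close> have the same value at 0 and
  at 1, which are characterised by \<open>x + x = x\<close> and \<open>x x = x \<noteq> 0\<close>; hence at all positive integers, since
  addition over \<open>W''\<close> is a function, and at all negative ones by cancellation over \<open>W''\<close>.
\<close>

lemma model_iso_unique:
  assumes \<phi>: "model_iso W \<phi>" and \<phi>': "model_iso W' \<phi>'"
    and joint: "\<And>L. (\<And>g xs. (g, xs) \<in> set L \<Longrightarrow> solvable_at g xs W \<or> solvable_at g xs W') \<Longrightarrow>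
      \<exists>W'' \<phi>''. model_iso W'' \<phi>'' \<and> (\<forall>(g, xs)\<in>set L. solvable_at g xs W'')"
  shows "\<phi> = \<phi>'"
proof -
  let ?A = "\<lambda>W. dioph_graph (RW W) n hadd" and ?M = "\<lambda>W. dioph_graph (RW W) n hmul"
  have joint3: "\<exists>W'' \<phi>''. model_iso W'' \<phi>'' \<and>
      (x1, y1, z1) \<in> dioph_graph (RW W'') n g1 \<and> (x2, y2, z2) \<in> dioph_graph (RW W'') n g2 \<and>
      (x3, y3, z3) \<in> dioph_graph (RW W'') n g3"
    if 1: "(x1, y1, z1) \<in> dioph_graph (RW W) n g1 \<or> (x1, y1, z1) \<in> dioph_graph (RW W') n g1"
      and 2: "(x2, y2, z2) \<in> dioph_graph (RW W) n g2 \<or> (x2, y2, z2) \<in> dioph_graph (RW W') n g2"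
      and 3: "(x3, y3, z3) \<in> dioph_graph (RW W) n g3 \<or> (x3, y3, z3) \<in> dioph_graph (RW W') n g3"
    for g1 g2 g3 x1 y1 z1 x2 y2 z2 x3 y3 z3
  proof -
    let ?L = "[(g1, x1 @ y1 @ z1), (g2, x2 @ y2 @ z2), (g3, x3 @ y3 @ z3)]"
    have "solvable_at g xs W \<or> solvable_at g xs W'" if "(g, xs) \<in> set ?L" for g xs
      using that 1 2 3 by (auto simp: dioph_graph_iff)
    from joint[of ?L, OF this] show ?thesis using 1 2 3 by (auto simp: dioph_graph_iff)
  qed
  have is_zero: "x = \<phi>'' 0" if m: "model_iso W'' \<phi>''" and z: "(x, x, x) \<in> ?A W''" for W'' \<phi>'' x
  proof -
    obtain a b where ab: "x = \<phi>'' a" "x = \<phi>'' b" "x = \<phi>'' (a + b)"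
      using z unfolding model_isoD(2)[OF m] by (elim exE conjE) (rule that)
    have "a = b" by (rule injD[OF model_isoD(1)[OF m]]) (use ab in simp)
    moreover have "a = a + b" by (rule injD[OF model_isoD(1)[OF m]]) (use ab in simp)
    ultimately show ?thesis using ab(1) by simp
  qed
  have is_one: "x = \<phi>'' 1" if m: "model_iso W'' \<phi>''" and o: "(x, x, x) \<in> ?M W''" and x0: "x \<noteq> \<phi>'' 0" for W'' \<phi>'' x
  proof -
    obtain a b where ab: "x = \<phi>'' a" "x = \<phi>'' b" "x = \<phi>'' (a * b)"
      using o unfolding model_isoD(3)[OF m] by (elim exE conjE) (rule that)
    have "a = b" by (rule injD[OF model_isoD(1)[OF m]]) (use ab in simp)
    moreover have "a = a * b" by (rule injD[OF model_isoD(1)[OF m]]) (use ab in simp)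
    moreover have "a \<noteq> 0" using x0 ab(1) by auto
    ultimately show ?thesis using ab(1) by simp
  qed
  have Z: "(\<phi> 0, \<phi> 0, \<phi> 0) \<in> ?A W" "(\<phi>' 0, \<phi>' 0, \<phi>' 0) \<in> ?A W'"
    unfolding model_isoD(2)[OF \<phi>] model_isoD(2)[OF \<phi>'] by (metis add_0)+
  have O: "(\<phi> 1, \<phi> 1, \<phi> 1) \<in> ?M W" "(\<phi>' 1, \<phi>' 1, \<phi>' 1) \<in> ?M W'"
    unfolding model_isoD(3)[OF \<phi>] model_isoD(3)[OF \<phi>'] by (metis mult_1)+
  have zero: "\<phi> 0 = \<phi>' 0"
  proof -
    obtain W'' \<phi>'' where "model_iso W'' \<phi>''" "(\<phi> 0, \<phi> 0, \<phi> 0) \<in> ?A W''"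
      "(\<phi>' 0, \<phi>' 0, \<phi>' 0) \<in> ?A W''"
      using joint3[OF disjI1[OF Z(1)] disjI2[OF Z(2)] disjI1[OF Z(1)]] by auto
    thus ?thesis using is_zero by metis
  qed
  have one: "\<phi> 1 = \<phi>' 1"
  proof -
    obtain W'' \<phi>'' where *: "model_iso W'' \<phi>''" "(\<phi> 0, \<phi> 0, \<phi> 0) \<in> ?A W''"
      "(\<phi> 1, \<phi> 1, \<phi> 1) \<in> ?M W''" "(\<phi>' 1, \<phi>' 1, \<phi>' 1) \<in> ?M W''"
      using joint3[OF disjI1[OF Z(1)] disjI1[OF O(1)] disjI2[OF O(2)]] by auto
    have "\<phi> 1 \<noteq> \<phi> 0" "\<phi>' 1 \<noteq> \<phi>' 0"
      using model_isoD(1)[OF \<phi>] model_isoD(1)[OF \<phi>'] by (auto dest!: injD)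
    thus ?thesis using is_zero[OF *(1,2)] zero is_one[OF *(1,3)] is_one[OF *(1,4)] by simp
  qed
  have fun_add: "z = z'" if "(x, y, z) \<in> ?A W" "(x, y, z') \<in> ?A W'" for x y z z'
  proof -
    obtain W'' \<phi>'' where *: "model_iso W'' \<phi>''" "(x, y, z) \<in> ?A W''" "(x, y, z') \<in> ?A W''"
      using joint3[of x y z hadd x y z' hadd x y z hadd] \<open>(x, y, z) \<in> ?A W\<close> \<open>(x, y, z') \<in> ?A W'\<close> by auto
    from model_isoD(1)[OF *(1)] *(2,3) show ?thesis unfolding model_isoD(2)[OF *(1)] by (auto dest: injD)
  qed
  have cancel_add: "y = y'" if "(x, y, z) \<in> ?A W" "(x, y', z) \<in> ?A W'" for x y y' z
  proof -
    obtain W'' \<phi>'' where *: "model_iso W'' \<phi>''" "(x, y, z) \<in> ?A W''" "(x, y', z) \<in> ?A W''"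
      using joint3[of x y z hadd x y' z hadd x y z hadd] \<open>(x, y, z) \<in> ?A W\<close> \<open>(x, y', z) \<in> ?A W'\<close> by auto
    obtain a b where ab: "x = \<phi>'' a" "y = \<phi>'' b" "z = \<phi>'' (a + b)"
      using *(2) unfolding model_isoD(2)[OF *(1)] by (elim exE conjE) (rule that)
    obtain a' b' where ab': "x = \<phi>'' a'" "y' = \<phi>'' b'" "z = \<phi>'' (a' + b')"
      using *(3) unfolding model_isoD(2)[OF *(1)] by (elim exE conjE) (rule that)
    have "a = a'" by (rule injD[OF model_isoD(1)[OF *(1)]]) (use ab ab' in simp)
    moreover have "a + b = a' + b'" by (rule injD[OF model_isoD(1)[OF *(1)]]) (use ab ab' in simp)
    ultimately show ?thesis using ab ab' by simp
  qed
  have A: "(\<phi> a, \<phi> b, \<phi> (a + b)) \<in> ?A W" "(\<phi>' a, \<phi>' b, \<phi>' (a + b)) \<in> ?A W'" for a b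
    unfolding model_isoD(2)[OF \<phi>] model_isoD(2)[OF \<phi>'] by blast+
  have nat: "\<phi> (int k) = \<phi>' (int k)" for k
  proof (induction k)
    case (Suc k)
    show ?case using fun_add[OF A(1)[of "int k" 1] A(2)[of "int k" 1, folded Suc one]] by (simp add: add.commute)
  qed (simp add: zero)
  have neg: "\<phi> (- int k) = \<phi>' (- int k)" for k
  proof (rule cancel_add)
    show "(\<phi> (int k), \<phi> (- int k), \<phi> 0) \<in> ?A W" using A(1)[of "int k" "- int k"] by simp
    show "(\<phi> (int k), \<phi>' (- int k), \<phi> 0) \<in> ?A W'" using A(2)[of "int k" "- int k"] nat zero by simp
  qed
  show ?thesis
  proof
    show "\<phi> a = \<phi>' a" for a using nat neg by (cases a rule: int_cases2) simp_all
  qed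
qed

lemma model_iso_subset:
  assumes "W \<subseteq> W'" "model_iso W \<phi>" "model_iso W' \<phi>'"
  shows "\<phi> = \<phi>'"
proof (rule model_iso_unique[OF assms(2,3)])
  fix L assume "\<And>g xs. (g, xs) \<in> set L \<Longrightarrow> solvable_at g xs W \<or> solvable_at g xs W'"
  hence "\<forall>(g, xs)\<in>set L. solvable_at g xs W'" using solvable_at_mono[OF _ assms(1)] by fastforce
  thus "\<exists>W'' \<phi>''. model_iso W'' \<phi>'' \<and> (\<forall>(g, xs)\<in>set L. solvable_at g xs W'')"
    using assms(3) by metis
qed

text \<open>
  Facts true over \<open>W\<close> or over \<open>W'\<close> are true over \<open>W \<union> W'\<close>, which lies in the same cylinder, and they
  stay true nearby; density provides a nearby model.
\<close>

lemma models_coincide: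
  assumes E: "dense_in_cylinder E V N" "\<And>W. W \<in> E \<Longrightarrow> \<exists>\<phi>. model_iso W \<phi>"
    and W: "W \<in> cylinder V N" "W' \<in> cylinder V N"
    and \<phi>: "model_iso W \<phi>" "model_iso W' \<phi>'"
  shows "\<phi> = \<phi>'"
proof (rule model_iso_unique[OF \<phi>])
  fix L
  assume L: "\<And>g xs. (g, xs) \<in> set L \<Longrightarrow> solvable_at g xs W \<or> solvable_at g xs W'"
  have "\<forall>(g, xs)\<in>set L. solvable_at g xs (W \<union> W')"
    using L solvable_at_mono[of _ _ W "W \<union> W'"] solvable_at_mono[of _ _ W' "W \<union> W'"] by fastforce
  then obtain M where M: "\<forall>W''\<in>cylinder (W \<union> W') M. \<forall>(g, xs)\<in>set L. solvable_at g xs W''"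
    using solvable_list_open by metis
  have "W \<union> W' \<in> cylinder V N" using W unfolding cylinder_def by auto
  then obtain W'' where W'': "W'' \<in> E" "W'' \<in> cylinder (W \<union> W') M"
    using E(1) unfolding dense_in_cylinder_def by metis
  then obtain \<phi>'' where "model_iso W'' \<phi>''" using E(2) by metis
  thus "\<exists>W'' \<phi>''. model_iso W'' \<phi>'' \<and> (\<forall>(g, xs)\<in>set L. solvable_at g xs W'')"
    using M W''(2) by metis
qed

text \<open>
  All the models in the dense set have the same isomorphism \<open>\<phi>\<close>, so each positive fact has one truth
  value throughout that set.  A generic \<open>V\<close> has the same truth value: a fact true over \<open>V\<close> is true
  nearby, and a fact true on a dense set is true over a generic \<open>V\<close>.
\<close>

lemma generic_model:
  assumes E: "dense_in_cylinder E W N" "\<And>W. W \<in> E \<Longrightarrow> \<exists>\<phi>. model_iso W \<phi>"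
    and V: "HTP_generic V" "V \<in> cylinder W N"
  shows "models V"
proof -
  have near: "\<exists>W'\<in>E. W' \<in> cylinder V M \<and> W' \<in> cylinder W N" for M
  proof -
    obtain W' where W': "W' \<in> E" "W' \<in> cylinder V (max M N)" using E(1) V(2) unfolding dense_in_cylinder_def by metis
    have "W' \<in> cylinder V M" "W' \<in> cylinder V N" using W'(2) by (auto simp: cylinder_def)
    thus ?thesis using W'(1) cylinder_trans[OF V(2) order_refl] by auto
  qed
  obtain W0 where W0: "W0 \<in> E" "W0 \<in> cylinder W N" using near by auto
  then obtain \<phi> where \<phi>: "model_iso W0 \<phi>" using E(2) by metis
  have same: "model_iso W' \<phi>" if W': "W' \<in> E" "W' \<in> cylinder W N" for W'
  proof -
    obtain \<phi>' where \<phi>': "model_iso W' \<phi>'" using E(2)[OF W'(1)] by metis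
    have "\<phi> = \<phi>'" by (rule models_coincide[OF E W0(2) W'(2) \<phi> \<phi>'])
    thus ?thesis using \<phi>' by simp
  qed
  have transfer: "same_solvable k g V g W0"
    if g: "g \<in> polys_over \<int>" and c: "\<And>W'. model_iso W' \<phi> \<Longrightarrow> same_solvable k g W' g W0" for g k
    unfolding same_solvable_def
  proof (intro allI impI iffI)
    fix xs :: "rat list" assume k: "length xs = k"
    have eq: "solvable_at g xs W' \<longleftrightarrow> solvable_at g xs W0" if "W' \<in> E" "W' \<in> cylinder W N" for W'
      using c[OF same[OF that]] k unfolding same_solvable_def by simp
    show "solvable_at g xs W0" if "solvable_at g xs V"
    proof -
      obtain M where "\<And>W'. W' \<in> cylinder V M \<Longrightarrow> solvable_at g xs W'"
        using solvable_at_open[OF \<open>solvable_at g xs V\<close>] by metis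
      thus ?thesis using near[of M] eq by auto
    qed
    show "solvable_at g xs V" if "solvable_at g xs W0"
    proof (rule generic_solvable_at[OF V(1) g])
      show "\<exists>W'\<in>cylinder V M. solvable_at g xs W'" for M using near[of M] eq that by auto
    qed
  qed
  have eq: "same_solvable n h V h W0" "same_solvable (n + (n + n)) hadd V hadd W0"
    "same_solvable (n + (n + n)) hmul V hmul W0"
    using transfer polys model_iso_same_solvable[OF _ \<phi>] by auto
  have "model_iso V \<phi>"
    using \<phi> dioph_set_eq_iff[THEN iffD2, OF eq(1)] dioph_graph_eq_iff[THEN iffD2, OF eq(2)]
      dioph_graph_eq_iff[THEN iffD2, OF eq(3)] unfolding model_iso_def by simp
  thus ?thesis using models_iff by auto
qed

end

section \<open>Meager or dense\<close>

instance poly_mapping :: (countable, "{zero,countable}") countable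
proof
  define gr where "gr p = (\<lambda>k. (k, Poly_Mapping.lookup p k)) ` Poly_Mapping.keys p" for p :: "'a \<Rightarrow>\<^sub>0 'b"
  have cnt: "countable {A :: ('a \<times> 'b) set. finite A}" by (rule countable_Collect_finite)
  have "inj gr"
  proof (rule injI)
    fix p q :: "'a \<Rightarrow>\<^sub>0 'b" assume eq: "gr p = gr q"
    have mem: "(k, y) \<in> gr p \<longleftrightarrow> y = Poly_Mapping.lookup p k \<and> y \<noteq> 0" for p :: "'a \<Rightarrow>\<^sub>0 'b" and k y
      by (auto simp: gr_def in_keys_iff)
    show "p = q"
    proof (rule poly_mapping_eqI)
      fix k
      have "y = Poly_Mapping.lookup p k \<and> y \<noteq> 0 \<longleftrightarrow> y = Poly_Mapping.lookup q k \<and> y \<noteq> 0" for y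
        using mem[of k y p] mem[of k y q] eq by simp
      thus "Poly_Mapping.lookup p k = Poly_Mapping.lookup q k" by metis
    qed
  qed
  moreover have "inj_on (to_nat_on {A :: ('a \<times> 'b) set. finite A}) (range gr)"
    by (rule inj_on_subset[OF inj_on_to_nat_on[OF cnt]]) (auto simp: gr_def)
  ultimately have "inj (to_nat_on {A :: ('a \<times> 'b) set. finite A} \<circ> gr)" by (intro comp_inj_on)
  thus "\<exists>to_nat :: ('a \<Rightarrow>\<^sub>0 'b) \<Rightarrow> nat. inj to_nat" by blast
qed

lemma clear_denominators:
  obtains F :: rpoly and c :: rat where "F \<in> polys_over \<int>" "c \<noteq> 0" "\<And>v. eval_rpoly v F = c * eval_rpoly v f"
proof -
  define den where "den m = snd (quotient_of (Poly_Mapping.lookup f m))" for m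
  have den: "den m \<noteq> 0" "of_int (den m) * Poly_Mapping.lookup f m \<in> \<int>" for m
  proof -
    obtain a b where ab: "quotient_of (Poly_Mapping.lookup f m) = (a, b)" by (cases "quotient_of (Poly_Mapping.lookup f m)")
    hence "b > 0" "Poly_Mapping.lookup f m = of_int a / of_int b"
      using quotient_of_denom_pos quotient_of_div by (force, force)
    thus "den m \<noteq> 0" "of_int (den m) * Poly_Mapping.lookup f m \<in> \<int>" using ab by (simp_all add: den_def)
  qed
  define c :: int where "c = (\<Prod>m\<in>Poly_Mapping.keys f. den m)"
  define F where "F = Poly_Mapping.single 0 (of_int c) * f"
  have lookup_F: "Poly_Mapping.lookup F m = of_int c * Poly_Mapping.lookup f m" for m
    unfolding F_def mult_map_scale_conv_mult[symmetric] by (simp add: Poly_Mapping.map.rep_eq when_def)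
  have "Poly_Mapping.lookup F m \<in> \<int>" for m
  proof (cases "m \<in> Poly_Mapping.keys f")
    case True
    hence "c = den m * (\<Prod>m\<in>Poly_Mapping.keys f - {m}. den m)" unfolding c_def by (intro prod.remove) auto
    hence "Poly_Mapping.lookup F m = of_int (\<Prod>m\<in>Poly_Mapping.keys f - {m}. den m) * (of_int (den m) * Poly_Mapping.lookup f m)"
      unfolding lookup_F by simp
    thus ?thesis using den(2)[of m] by (simp only: Ints_mult Ints_of_int)
  next
    case False
    thus ?thesis unfolding lookup_F by (simp add: in_keys_iff)
  qed
  hence 1: "F \<in> polys_over \<int>" unfolding polys_over_def by simp
  have 2: "(of_int c :: rat) \<noteq> 0" unfolding c_def using den(1) by simp
  have 3: "eval_rpoly v F = of_int c * eval_rpoly v f" for v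
    unfolding F_def eval_rpoly_mult eval_rpoly_single by (simp add: mono_val_def)
  show ?thesis by (rule that[OF 1 2 3])
qed

lemma admits_dioph_model_iff:
  "admits_dioph_model (RW W) \<longleftrightarrow>
     (\<exists>n h hadd hmul. integer_triple h hadd hmul \<and> dioph_model_via (RW W) n h hadd hmul)"
proof
  assume "admits_dioph_model (RW W)"
  then obtain n h hadd hmul where m: "dioph_model_via (RW W) n h hadd hmul" unfolding admits_dioph_model_def by blast
  have cl: "\<exists>F\<in>polys_over \<int>. dioph_set (RW W) n F = dioph_set (RW W) n f \<and> dioph_graph (RW W) n F = dioph_graph (RW W) n f" for f
  proof -
    obtain F c where F: "F \<in> polys_over \<int>" "c \<noteq> 0" "\<And>v. eval_rpoly v F = c * eval_rpoly v f"
      using clear_denominators[of f] by metis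
    hence "dioph_holds (RW W) F xs = dioph_holds (RW W) f xs" for xs unfolding dioph_holds_def by simp
    thus ?thesis using F(1) unfolding dioph_set_def dioph_graph_def by auto
  qed
  obtain h' hadd' hmul' where *: "h' \<in> polys_over \<int>" "hadd' \<in> polys_over \<int>" "hmul' \<in> polys_over \<int>"
    "dioph_set (RW W) n h' = dioph_set (RW W) n h" "dioph_graph (RW W) n hadd' = dioph_graph (RW W) n hadd"
    "dioph_graph (RW W) n hmul' = dioph_graph (RW W) n hmul"
    using cl[of h] cl[of hadd] cl[of hmul] by metis
  have "dioph_model_via (RW W) n h' hadd' hmul'"
    using m *(1-3) polys_over_Ints_subset[of W] unfolding dioph_model_via_def *(4-6) by auto
  thus "\<exists>n h hadd hmul. integer_triple h hadd hmul \<and> dioph_model_via (RW W) n h hadd hmul"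
    using *(1-3) unfolding integer_triple_def by metis
qed (auto simp: admits_dioph_model_def)

text \<open>
  The class is a countable union over the integer triples, so for one triple the models are dense in
  some cylinder.
\<close>

lemma nonmeager_dense_triple:
  assumes "\<not> meager_in cantor_primes \<D>"
  obtains n h hadd hmul W N where "integer_triple h hadd hmul" "W \<subseteq> Primes"
    "dense_in_cylinder {V. V \<subseteq> Primes \<and> dioph_model_via (RW V) n h hadd hmul} W N"
proof -
  define S where "S = (\<lambda>(n, h, hadd, hmul). if integer_triple h hadd hmul
     then {V. V \<subseteq> Primes \<and> dioph_model_via (RW V) n h hadd hmul} else {})"
  have D: "\<D> = (\<Union>i. S (from_nat i))"
  proof (intro equalityI subsetI)
    fix V assume "V \<in> \<D>"
    then obtain n h hadd hmul where *: "V \<subseteq> Primes" "integer_triple h hadd hmul"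
      "dioph_model_via (RW V) n h hadd hmul" unfolding \<D>_def admits_dioph_model_iff by auto
    have "V \<in> S (from_nat (to_nat (n, h, hadd, hmul)))" using * by (simp add: S_def)
    thus "V \<in> (\<Union>i. S (from_nat i))" by (rule UN_I[OF UNIV_I])
  next
    fix V assume "V \<in> (\<Union>i. S (from_nat i))"
    then obtain i where "V \<in> S (from_nat i)" by (elim UN_E)
    thus "V \<in> \<D>" unfolding \<D>_def admits_dioph_model_def 
      by (cases "from_nat i :: nat \<times> rpoly \<times> rpoly \<times> rpoly") (auto simp: S_def split: if_splits)
  qed
  have "\<exists>i. \<not> nowhere_dense_in cantor_primes (S (from_nat i))"
  proof (rule ccontr)
    assume "\<not> ?thesis"
    hence "(\<forall>i. nowhere_dense_in cantor_primes (S (from_nat i))) \<and> \<D> = (\<Union>i. S (from_nat i))" using D by simp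
    hence "meager_in cantor_primes \<D>" unfolding meager_in_def by (rule exI[of _ "\<lambda>i. S (from_nat i)"])
    thus False using assms by simp
  qed
  then obtain i where i: "\<not> nowhere_dense_in cantor_primes (S (from_nat i))" by (elim exE)
  define t :: "nat \<times> rpoly \<times> rpoly \<times> rpoly" where "t = from_nat i"
  have t: "\<not> nowhere_dense_in cantor_primes (S t)" using i unfolding t_def .
  obtain n h hadd hmul where tt: "t = (n, h, hadd, hmul)" by (cases t)
  have "S t \<subseteq> Pow Primes" by (auto simp: S_def tt)
  then obtain W N where WN: "W \<subseteq> Primes" "\<And>V M. V \<in> cylinder W N \<Longrightarrow> \<exists>W'\<in>S t. W' \<in> cylinder V M"
    using not_nowhere_dense[OF _ t] by metis
  hence "S t \<noteq> {}" using cylinder_self[OF WN(1)] by fastforce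
  hence p: "integer_triple h hadd hmul" by (auto simp: S_def tt split: if_splits)
  hence "S t = {V. V \<subseteq> Primes \<and> dioph_model_via (RW V) n h hadd hmul}" by (simp add: S_def tt)
  hence "dense_in_cylinder {V. V \<subseteq> Primes \<and> dioph_model_via (RW V) n h hadd hmul} W N"
    using WN(2) unfolding dense_in_cylinder_def by simp
  thus ?thesis by (rule that[OF p WN(1)])
qed

text \<open>
  The sets that are not generic form a meager set, so Baire's theorem avoids them and \<open>M\<close>
  simultaneously.
\<close>

lemma generic_in_cylinder_not_meager:
  assumes "meager_in cantor_primes M" "W \<subseteq> Primes"
  obtains V where "V \<in> cylinder W N" "HTP_generic V" "V \<notin> M"
proof -
  obtain K where K: "\<And>i :: nat. nowhere_dense_in cantor_primes (K i)" "M = (\<Union>i. K i)"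
    using assms(1) unfolding meager_in_def by auto
  define B' where "B' f = (if f \<in> polys_over \<int> then \<B> f else {})" for f
  have e: "nowhere_dense_in cantor_primes {}" by (simp add: nowhere_dense_in_def)
  define L where "L i = (if even i then K (i div 2) else B' (from_nat (i div 2)))" for i
  have "nowhere_dense_in cantor_primes (L i)" for i
    using K(1) nowhere_dense_B e by (simp add: L_def B'_def)
  then obtain V where V: "V \<in> cylinder W N" "\<And>i. V \<notin> L i" using cantor_primes_Baire[OF _ assms(2)] by metis
  have "V \<notin> \<B> f" if "f \<in> polys_over \<int>" for f
    using V(2)[of "2 * to_nat f + 1"] that by (simp add: L_def B'_def)
  hence 1: "HTP_generic V" unfolding HTP_generic_def using cylinderD(1)[OF V(1)] by simp
  have "V \<notin> K i" for i using V(2)[of "2 * i"] by (simp add: L_def)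
  hence 2: "V \<notin> M" unfolding K(2) by simp
  show ?thesis by (rule that[OF V(1) 1 2])
qed

section \<open>The rational field\<close>

text \<open>
  A diophantine condition over the rational numbers which implies that \<open>p\<close> does not divide the
  denominator of \<open>x\<close>, and which holds if neither \<open>p\<close> nor \<open>d\<close> divides that denominator.
\<close>

definition integrality_certificate :: "nat \<Rightarrow> nat \<Rightarrow> rat \<Rightarrow> bool" where
  "integrality_certificate p d x \<longleftrightarrow> (\<exists>u v w. u\<^sup>2 - of_nat d * v\<^sup>2 + of_nat d * of_nat p * w\<^sup>2 =
     1 + of_nat p * (of_nat d * x\<^sup>2)\<^sup>2)"

lemma RW_has_certificate:
  assumes "anisotropic_pair p d" "V \<subseteq> Primes" "p \<notin> V" "d \<notin> V" "x \<in> RW V"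
  shows "integrality_certificate p d x"
proof -
  obtain a b :: int where ab: "x = of_int a / of_int b" "b > 0" "coprime a b"
    "\<And>q. prime q \<Longrightarrow> int q dvd b \<Longrightarrow> q \<in> V" using RW_fraction[OF assms(5,2)] by metis
  note P = anisotropic_pairD[OF assms(1)]
  have "\<not> int p dvd b" "\<not> int d dvd b" using ab(4)[OF P(1)] ab(4)[OF P(2)] assms(3,4) by auto
  hence "\<not> int p dvd b\<^sup>2" "\<not> int d dvd b\<^sup>2"
    using int_prime_dvd_power2[OF P(1)] int_prime_dvd_power2[OF P(2)] by auto
  moreover have "coprime (a\<^sup>2) (b\<^sup>2)" using ab(3) by simp
  moreover have "x\<^sup>2 = of_int (a\<^sup>2) / of_int (b\<^sup>2)" unfolding ab(1) by (simp add: power_divide)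
  ultimately show ?thesis
    unfolding integrality_certificate_def using anisotropic_form_represents[OF assms(1), of "a\<^sup>2" "b\<^sup>2"] by auto
qed

lemma certificates_imp_RW:
  assumes "\<And>p. p \<in> S \<Longrightarrow> anisotropic_pair p (d p) \<and> integrality_certificate p (d p) x"
  shows "x \<in> RW (Primes - S)"
proof -
  obtain a b where ab: "quotient_of x = (a, b)" by (cases "quotient_of x")
  have b: "b > 0" "x = of_int a / of_int b" "coprime a b"
    using quotient_of_denom_pos[OF ab] quotient_of_div[OF ab] quotient_of_coprime[OF ab] by auto
  have "q \<in> Primes - S" if "prime q" "q dvd nat b" for q
  proof -
    have "int q dvd b" using that(2) b(1) by (metis int_dvd_int_iff int_nat_eq less_imp_le)
    moreover have "\<not> int q dvd b" if "q \<in> S"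
    proof -
      obtain u v w where "u\<^sup>2 - of_nat (d q) * v\<^sup>2 + of_nat (d q) * of_nat q * w\<^sup>2 =
          1 + of_nat q * (of_nat (d q) * x\<^sup>2)\<^sup>2"
        using assms[OF \<open>q \<in> S\<close>] unfolding integrality_certificate_def by metis
      thus ?thesis using anisotropic_form_integral[of q "d q" u v w x a b] assms[OF \<open>q \<in> S\<close>] b by auto
    qed
    ultimately show ?thesis using \<open>prime q\<close> by blast
  qed
  hence "of_int a / of_nat (nat b) \<in> RW (Primes - S)" using b(1) by (intro RW_fractionI) auto
  thus ?thesis using b(1,2) by simp
qed

text \<open>
  Membership in the set defined by \<open>g\<close> with all relevant variables certified, expressed by one
  polynomial.  The witnesses for variable \<open>i\<close> and the \<open>j\<close>-th prime occupy three fresh variables.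
\<close>

lemma certified_polynomial:
  fixes S :: "nat set" and d :: "nat \<Rightarrow> nat"
  assumes g: "g \<in> polys_over \<int>" and S: "finite S" and K: "var_bound g \<le> K"
  shows "\<exists>G\<in>polys_over \<int>. \<forall>xs. length xs \<le> K \<longrightarrow> (solvable_at G xs Primes \<longleftrightarrow>
       (\<exists>v. (\<forall>i<length xs. v i = xs ! i) \<and> (\<forall>i<K. \<forall>p\<in>S. integrality_certificate p (d p) (v i)) \<and> eval_rpoly v g = 0))"
proof -
  obtain ps where ps: "set ps = S" using finite_list[OF S] by metis
  define r where "r = length ps"
  define slot where "slot i j k = K + 3 * (i * r + j) + k" for i j k
  define e where "e p x u v w = u\<^sup>2 - of_int (int (d p)) * v\<^sup>2 + of_int (int (d p)) * of_int (int p) * w\<^sup>2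
     - (of_int 1 + of_int (int p) * (of_int (int (d p)) * x\<^sup>2)\<^sup>2)" for p and x u v w :: rat
  have e: "integrality_certificate p (d p) x \<longleftrightarrow> (\<exists>u v w. e p x u v w = 0)" for p x
    unfolding integrality_certificate_def e_def by simp
  define q where "q v = (eval_rpoly v g)\<^sup>2 + (\<Sum>i<K. \<Sum>j<r. (e (ps ! j) (v i) (v (slot i j 0)) (v (slot i j 1)) (v (slot i j 2)))\<^sup>2)" for v
  have "poly_fun q" unfolding q_def e_def
    by (intro poly_fun_add poly_fun_power poly_fun_sum poly_fun_diff poly_fun_mult poly_fun_of_int poly_fun_var poly_fun_eval g)
  then obtain G where G: "G \<in> polys_over \<int>" "\<And>v. eval_rpoly v G = q v" unfolding poly_fun_def by metis
  have q0: "q v = 0 \<longleftrightarrow> eval_rpoly v g = 0 \<and>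
     (\<forall>i<K. \<forall>j<r. e (ps ! j) (v i) (v (slot i j 0)) (v (slot i j 1)) (v (slot i j 2)) = 0)" for v
  proof -
    have "q v = 0 \<longleftrightarrow> (eval_rpoly v g)\<^sup>2 = 0 \<and>
       (\<Sum>i<K. \<Sum>j<r. (e (ps ! j) (v i) (v (slot i j 0)) (v (slot i j 1)) (v (slot i j 2)))\<^sup>2) = 0"
      unfolding q_def by (intro add_nonneg_eq_0_iff sum_nonneg) auto
    thus ?thesis by (simp add: sum_nonneg_eq_0_iff sum_nonneg Ball_def)
  qed
  have "solvable_at G xs Primes \<longleftrightarrow>
       (\<exists>v. (\<forall>i<length xs. v i = xs ! i) \<and> (\<forall>i<K. \<forall>p\<in>S. integrality_certificate p (d p) (v i)) \<and> eval_rpoly v g = 0)"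
    if len: "length xs \<le> K" for xs
  proof
    assume "solvable_at G xs Primes"
    then obtain v where v: "\<forall>i<length xs. v i = xs ! i" "q v = 0" unfolding solvable_at_iff G(2) by metis
    have "integrality_certificate p (d p) (v i)" if i: "i < K" and p: "p \<in> S" for i p
    proof -
      obtain j where "j < r" "p = ps ! j" using p ps unfolding r_def by (metis in_set_conv_nth)
      thus ?thesis unfolding e using v(2) i unfolding q0 by metis
    qed
    thus "\<exists>v. (\<forall>i<length xs. v i = xs ! i) \<and> (\<forall>i<K. \<forall>p\<in>S. integrality_certificate p (d p) (v i)) \<and> eval_rpoly v g = 0"
      using v q0 by (intro exI[of _ v]) simp
  next
    assume "\<exists>v. (\<forall>i<length xs. v i = xs ! i) \<and> (\<forall>i<K. \<forall>p\<in>S. integrality_certificate p (d p) (v i)) \<and> eval_rpoly v g = 0"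
    then obtain v where v: "\<forall>i<length xs. v i = xs ! i" "\<forall>i<K. \<forall>p\<in>S. integrality_certificate p (d p) (v i)"
      "eval_rpoly v g = 0" by auto
    have "\<exists>c. i < K \<longrightarrow> j < r \<longrightarrow> e (ps ! j) (v i) (c 0) (c 1) (c (2 :: nat)) = 0" for i j
    proof (cases "i < K \<and> j < r")
      case True
      hence "integrality_certificate (ps ! j) (d (ps ! j)) (v i)" using v(2) ps unfolding r_def by auto
      then obtain x y z where "e (ps ! j) (v i) x y z = 0" unfolding e by auto
      thus ?thesis by (intro exI[of _ "\<lambda>k. if k = 0 then x else if k = 1 then y else z"]) simp
    qed auto
    then obtain c where c: "\<And>i j. i < K \<Longrightarrow> j < r \<Longrightarrow> e (ps ! j) (v i) (c i j 0) (c i j 1) (c i j (2 :: nat)) = 0"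
      by metis
    define w where "w m = (if m < K then v m else
       c (((m - K) div 3) div r) (((m - K) div 3) mod r) ((m - K) mod 3))" for m
    have w1: "w i = v i" if "i < K" for i using that by (simp add: w_def)
    have w2: "w (slot i j k) = c i j k" if "j < r" "k < 3" for i j k
    proof -
      have "(3 * t + k) div 3 = t" "(3 * t + k) mod 3 = k" for t using that(2) by presburger+
      note this[of "i * r + j"]
      moreover have "(i * r + j) div r = i" "(i * r + j) mod r = j" using that(1) by auto
      ultimately show ?thesis by (simp add: w_def slot_def)
    qed
    have "eval_rpoly w g = 0" using v(3) eval_rpoly_cong[of g w v] w1 K by simp
    moreover have "e (ps ! j) (w i) (w (slot i j 0)) (w (slot i j 1)) (w (slot i j 2)) = 0" if "i < K" "j < r" for i j
      using c[OF that] w1[OF that(1)] w2[OF that(2)] by simp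
    ultimately have "q w = 0" unfolding q0 by blast
    moreover have "\<forall>i<length xs. w i = xs ! i" using v(1) w1 len by simp
    ultimately show "solvable_at G xs Primes" unfolding solvable_at_iff G(2) RW_Primes by auto
  qed
  thus ?thesis using G(1) by (intro bexI[of _ G] allI impI)
qed

text \<open>
  Certified rational numbers form a diophantine set between two of the subrings, so a single
  polynomial over the rational numbers is squeezed between the conditions that \<open>g\<close> defines over
  them.
\<close>

lemma transfer_to_rationals:
  assumes g: "g \<in> polys_over \<int>" and S: "finite S" and d: "\<forall>p\<in>S. anisotropic_pair p (d p)"
  shows "\<exists>G\<in>polys_over \<int>. \<forall>xs. length xs = k \<longrightarrow>
    (solvable_at g xs (Primes - (S \<union> d ` S)) \<longrightarrow> solvable_at G xs Primes) \<and>
    (solvable_at G xs Primes \<longrightarrow> solvable_at g xs (Primes - S))"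
proof -
  define K where "K = max (var_bound g) k"
  have K: "var_bound g \<le> K" "k \<le> K" by (simp_all add: K_def)
  obtain G where G: "G \<in> polys_over \<int>"
    "\<And>xs. length xs \<le> K \<Longrightarrow> solvable_at G xs Primes \<longleftrightarrow>
       (\<exists>v. (\<forall>i<length xs. v i = xs ! i) \<and> (\<forall>i<K. \<forall>p\<in>S. integrality_certificate p (d p) (v i)) \<and> eval_rpoly v g = 0)"
    using certified_polynomial[OF g S K(1), of d] by (elim bexE) simp
  have 1: "solvable_at G xs Primes" if len: "length xs = k" and s: "solvable_at g xs (Primes - (S \<union> d ` S))" for xs
  proof -
    obtain v where v: "\<forall>i<length xs. v i = xs ! i" "\<forall>i. v i \<in> RW (Primes - (S \<union> d ` S))" "eval_rpoly v g = 0"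
      using s unfolding solvable_at_iff by metis
    have "integrality_certificate p (d p) (v i)" if "p \<in> S" for p i
      using RW_has_certificate[OF bspec[OF d that], of "Primes - (S \<union> d ` S)" "v i"] v(2) that by auto
    thus ?thesis using v(1,3) G(2)[of xs] len K(2) by auto
  qed
  have 2: "solvable_at g xs (Primes - S)" if len: "length xs = k" and s: "solvable_at G xs Primes" for xs
  proof -
    obtain v where v: "\<forall>i<length xs. v i = xs ! i" "\<forall>i<K. \<forall>p\<in>S. integrality_certificate p (d p) (v i)" "eval_rpoly v g = 0"
      using s G(2)[of xs] len K(2) by auto
    define w where "w i = (if i < K then v i else 0)" for i
    have "w i \<in> RW (Primes - S)" for i
      using certificates_imp_RW[of S d "v i"] d v(2) by (simp add: w_def)
    moreover have "eval_rpoly w g = 0" using v(3) eval_rpoly_cong[of g w v] K(1) by (simp add: w_def)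
    moreover have "\<forall>i<length xs. w i = xs ! i" using v(1) len K(2) by (simp add: w_def)
    ultimately show ?thesis unfolding solvable_at_iff by blast
  qed
  show ?thesis using G(1) 1 2 by (intro bexI[of _ G] allI impI conjI)
qed

context integer_triple
begin

text \<open>
  Let \<open>S\<close> be the set of primes that the cylinder excludes.  The complements \<open>V1\<close> of \<open>S\<close> and \<open>V2\<close> of
  \<open>S\<close> together with large auxiliary primes \<open>d p\<close> both lie in the cylinder, and they are generic
  because they are cofinite.  They carry the same model by rigidity, and the polynomials over the
  rational numbers squeezed between the conditions over \<open>V2\<close> and those over \<open>V1\<close> define that model
  too.
\<close>

lemma Primes_in_D:
  assumes W: "W \<subseteq> Primes" and V: "\<And>V. V \<in> cylinder W N \<Longrightarrow> HTP_generic V \<Longrightarrow> models V"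
  shows "Primes \<in> \<D>"
proof -
  define S where "S = {p. prime p \<and> p < N \<and> p \<notin> W}"
  have S: "finite S" by (simp add: S_def)
  have "\<exists>d. anisotropic_pair p d \<and> d > N" if "p \<in> S" for p
    using anisotropic_pair_exists[of p N] that unfolding S_def by auto
  then obtain d where d: "\<And>p. p \<in> S \<Longrightarrow> anisotropic_pair p (d p)" "\<And>p. p \<in> S \<Longrightarrow> d p > N" by metis
  have dP: "\<forall>p\<in>S. anisotropic_pair p (d p)" using d(1) by (rule ballI)
  define V1 where "V1 = Primes - S"
  define V2 where "V2 = Primes - (S \<union> d ` S)"
  have c: "V1 \<in> cylinder W N" "V2 \<in> cylinder W N"
    using W d(2) by (auto simp: V1_def V2_def S_def intro!: cylinderI dest: less_asym)
  have gen: "HTP_generic V1" "HTP_generic V2" unfolding V1_def V2_def using S by (intro cofinite_generic; simp)+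
  obtain \<phi> \<phi>' where \<phi>: "model_iso V1 \<phi>" "model_iso V2 \<phi>'"
    using V[OF c(1) gen(1)] V[OF c(2) gen(2)] unfolding models_iff by metis
  have sub: "V2 \<subseteq> V1" unfolding V1_def V2_def by auto
  have "\<phi>' = \<phi>" by (rule model_iso_subset[OF sub \<phi>(2,1)])
  hence same: "same_solvable n h V1 h V2" "same_solvable (n + (n + n)) hadd V1 hadd V2"
    "same_solvable (n + (n + n)) hmul V1 hmul V2"
    using model_iso_same_solvable[OF \<phi>(1)] \<phi>(2) by auto
  have transfer: "\<exists>G\<in>polys_over \<int>. same_solvable k G Primes g V1"
    if g: "g \<in> polys_over \<int>" and eq: "same_solvable k g V1 g V2" for g k
  proof -
    obtain G where G: "G \<in> polys_over \<int>" "\<forall>xs. length xs = k \<longrightarrow>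
        (solvable_at g xs V2 \<longrightarrow> solvable_at G xs Primes) \<and> (solvable_at G xs Primes \<longrightarrow> solvable_at g xs V1)"
      using transfer_to_rationals[OF g S dP, of k, folded V1_def V2_def] by (elim bexE) simp
    thus ?thesis using eq unfolding same_solvable_def by (intro bexI[of _ G] allI impI) auto
  qed
  obtain H Hadd Hmul where H: "H \<in> polys_over \<int>" "Hadd \<in> polys_over \<int>" "Hmul \<in> polys_over \<int>"
    and eq: "same_solvable n H Primes h V1" "same_solvable (n + (n + n)) Hadd Primes hadd V1"
      "same_solvable (n + (n + n)) Hmul Primes hmul V1"
    using transfer[OF polys(1) same(1)] transfer[OF polys(2) same(2)] transfer[OF polys(3) same(3)] by metis
  have "dioph_model_via (RW Primes) n H Hadd Hmul"
    using \<phi>(1) H polys_over_Ints_subset[of Primes] dioph_set_eq_iff[THEN iffD2, OF eq(1)]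
      dioph_graph_eq_iff[THEN iffD2, OF eq(2)] dioph_graph_eq_iff[THEN iffD2, OF eq(3)]
    unfolding model_iso_def dioph_model_via_def by auto
  thus ?thesis unfolding \<D>_def admits_dioph_model_def by auto
qed

end

theorem theorem5p3:
  "let possibility1 = meager_in cantor_primes \<D>;
       possibility2 = (\<exists>n. \<exists>h \<in> polys_over \<int>. \<exists>hadd \<in> polys_over \<int>. \<exists>hmul \<in> polys_over \<int>.
         \<exists>\<sigma> \<in> binary_strings. \<forall>V \<in> \<U> \<sigma>. HTP_generic V \<longrightarrow>
           dioph_model_via (RW V) n h hadd hmul)
   in (possibility1 \<or> possibility2) \<and> \<not> (possibility1 \<and> possibility2) \<and>
      (possibility2 \<longrightarrow> Primes \<in> \<D>)"
proof -
  define possibility2 where "possibility2 \<longleftrightarrow>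
    (\<exists>n. \<exists>h \<in> polys_over \<int>. \<exists>hadd \<in> polys_over \<int>. \<exists>hmul \<in> polys_over \<int>.
         \<exists>\<sigma> \<in> binary_strings. \<forall>V \<in> \<U> \<sigma>. HTP_generic V \<longrightarrow> dioph_model_via (RW V) n h hadd hmul)"
  have p2: possibility2 if nonmeager: "\<not> meager_in cantor_primes \<D>"
  proof -
    obtain n h hadd hmul W N where t: "integer_triple h hadd hmul" and W: "W \<subseteq> Primes"
      "dense_in_cylinder {V. V \<subseteq> Primes \<and> dioph_model_via (RW V) n h hadd hmul} W N"
      by (rule nonmeager_dense_triple[OF nonmeager])
    interpret integer_triple n h hadd hmul by (rule t)
    obtain \<sigma> where \<sigma>: "\<sigma> \<in> binary_strings" "\<U> \<sigma> = cylinder W N" by (rule cylinder_eq_U[OF W(1)])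
    have E: "\<exists>\<phi>. model_iso V \<phi>" if "V \<in> {V. V \<subseteq> Primes \<and> models V}" for V
      using that models_iff[of V] by simp
    have "\<forall>V \<in> \<U> \<sigma>. HTP_generic V \<longrightarrow> models V"
      using generic_model[OF W(2) E] unfolding \<sigma>(2) by simp
    thus ?thesis unfolding possibility2_def
      by (intro exI[of _ n] bexI[OF _ polys(1)] bexI[OF _ polys(2)] bexI[OF _ polys(3)] bexI[OF _ \<sigma>(1)])
  qed
  have conseq: "\<not> meager_in cantor_primes \<D> \<and> Primes \<in> \<D>" if p: possibility2
  proof -
    obtain n h hadd hmul \<sigma> where *: "h \<in> polys_over \<int>" "hadd \<in> polys_over \<int>" "hmul \<in> polys_over \<int>"
      "\<sigma> \<in> binary_strings" "\<forall>V \<in> \<U> \<sigma>. HTP_generic V \<longrightarrow> dioph_model_via (RW V) n h hadd hmul"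
      using p unfolding possibility2_def by (elim exE bexE) (rule that)
    interpret integer_triple n h hadd hmul by unfold_locales (fact *(1-3))+
    obtain W N where W: "W \<subseteq> Primes" "\<U> \<sigma> = cylinder W N" by (rule U_eq_cylinder[OF *(4)])
    have V: "models V" if "V \<in> cylinder W N" "HTP_generic V" for V using *(5) that W(2) by simp
    have "\<not> meager_in cantor_primes \<D>"
    proof
      assume meager: "meager_in cantor_primes \<D>"
      obtain V where "V \<in> cylinder W N" "HTP_generic V" "V \<notin> \<D>"
        by (rule generic_in_cylinder_not_meager[OF meager W(1)])
      thus False using V[of V] cylinderD(1)[of V W N] unfolding \<D>_def admits_dioph_model_def by auto
    qed
    thus ?thesis using Primes_in_D[OF W(1) V] by simp
  qed
  show ?thesis unfolding Let_def possibility2_def[symmetric] using p2 conseq by blast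
qed

end
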